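(* Let $d_x,d_y$ be positive integers, let $A\in\mathbb{Q}[x,y]$ be a nonzero polynomial with $\deg_xA<d_x$ and $\deg_yA<d_y$, and let \[B(x,y)=\sum_{0\le i\le d_x,\ 0\le j\le d_y}b_{i,j}x^iy^j\in\mathbb{Q}[(b_{i,j});x,y],\] where the $b_{i,j}$ are indeterminates. Then the polynomial computed by Algorithm AlgebraicDiagonal with input $A/B$ (over the ground field $\mathbb{Q}((b_{i,j}))$, and with the variable $t$ of the output renamed $x$) is irreducible of degree $\binom{d_x+d_y}{d_x}$, as a polynomial in $\Delta$, over the field $\mathbb{Q}((b_{i,j});x)$ of rational functions in $x$ and the $b_{i,j}$.
   Context: Algorithm AlgebraicDiagonal takes $A,B\in\mathbb{K}[x,y]$ with $B(0,0)\ne0$ ($\mathbb{K}$ a field of characteristic $0$) and returns a polynomial $\Phi(t,\Delta)\in\mathbb{K}[t,\Delta]$ annihilating the diagonal $\operatorname{Diag}(A/B)(t)=\sum_n f_{n,n}t^n$ of $A/B=\sum f_{i,j}x^iy^j$. It proceeds as follows: write $G=\frac1y\frac AB\left(\frac ty,y\right)$ as $P/Q$ with $P,Q\in\mathbb{K}[t,y]$ coprime; let $R(z)=$ AlgebraicResidues$(P/Q)$, with $P,Q$ viewed as polynomials in $y$ over $\mathbb{K}(t)$; let $c$ be the number of small branches of $Q$, i.e. of distinct roots $y(t)$ of $Q(t,y)=0$ (Puiseux series in $t$) tending to $0$ as $t\to0$; return $\Phi(t,\Delta)$, where $\Phi(t,z)$ is the numerator of $\Sigma_cR$, i.e. the polynomial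 obtained by clearing denominators in $t$. AlgebraicResidues$(P/Q)$: take a squarefree decomposition $Q=Q_1Q_2^2\cdots Q_m^m$ in $y$ ($Q_i$ squarefree, pairwise coprime, $\deg_yQ_m>0$); for each $i$ set $R_i=1$ if $\deg_yQ_i=0$; otherwise let $U_i(y)=Q(y)/Q_i(y)^i$, $V_i(y,u)=(Q_i(y+u)-Q_i(y))/u$, let $S_{i-1}=A_i(y)/B_i(y)$ ($A_i,B_i$ coprime) be the coefficient of $u^{i-1}$ in the Taylor expansion at $u=0$ of $\frac{P(y+u)}{U_i(y+u)V_i(y,u)^i}$, and let $R_i(z)=\operatorname{Resultant}_y(A_i-zB_i,Q_i)$; return $R_1\cdots R_m$. For $R$ of degree $d$ in $z$ with roots $\alpha_1,\dots,\alpha_d$ (with multiplicity) in an algebraic closure, $\Sigma_cR=\prod_{i_1<\cdots<i_c}\bigl(z-(\alpha_{i_1}+\cdots+\alpha_{i_c})\bigr)$. *)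

theory Defs
  imports
    "HOL-Computational_Algebra.Computational_Algebra"
    "HOL-Library.Poly_Mapping"
    "HOL-Algebra.Algebraic_Closure_Type"
    "Subresultants.Resultant_Prelim"
begin

text \<open>
  Bivariate polynomials are elements of \<open>'a poly poly\<close>: the inner variable is \<open>x\<close> (or \<open>t\<close>),
  the outer variable is \<open>y\<close>.  The steps of the algorithm that involve a choice (a coprime
  numerator and denominator, a squarefree decomposition, clearing denominators) are only
  determined up to units, so the algorithms are relations between inputs and possible outputs.
\<close>

definition degree_x :: "'a::zero poly poly \<Rightarrow> nat" where
  "degree_x p = (MAX j\<in>{..degree p}. degree (coeff p j))"

definition poly_eval2 :: "('a::zero \<Rightarrow> 'b::comm_semiring_0) \<Rightarrow> 'a poly poly \<Rightarrow> 'b \<Rightarrow> 'b \<Rightarrow> 'b" where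
  "poly_eval2 h p u v = poly (map_poly (\<lambda>q. poly (map_poly h q) u) p) v"

text \<open>The rational function \<open>(1/y) (A/B)(t/y, y)\<close> in \<open>K(t,y)\<close>.\<close>

definition diagonal_integrand :: "'a::field poly poly \<Rightarrow> 'a poly poly \<Rightarrow> 'a poly poly fract" where
  "diagonal_integrand A B =
    (let c = (\<lambda>a. to_fract [:[:a:]:]); t = to_fract [:[:0, 1:]:]; y = to_fract [:0, 1:]
     in 1 / y * (poly_eval2 c A (t / y) y / poly_eval2 c B (t / y) y))"


text \<open>
  \<open>puiseux N f\<close> is the Puiseux series \<open>f(t^(1/N))\<close>, represented by its coefficient function
  (the value at \<open>r\<close> is the coefficient of \<open>t^r\<close>), so that equal Puiseux series given by
  different \<open>N\<close> are identified.  For \<open>s = t^(1/N)\<close>, the series is a root of \<open>Q(t,y)\<close> iff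
  \<open>Q(s^N, f(s)) = 0\<close>.
\<close>

definition puiseux :: "nat \<Rightarrow> 'a::zero fls \<Rightarrow> rat \<Rightarrow> 'a" where
  "puiseux N f = (\<lambda>r. if r * of_nat N \<in> \<int> then fls_nth f \<lfloor>r * of_nat N\<rfloor> else 0)"

definition small_branches :: "'a::field_char_0 poly poly \<Rightarrow> (rat \<Rightarrow> 'a alg_closure) set" where
  "small_branches Q =
    {puiseux N f | N f. N > 0 \<and>
       poly_eval2 (\<lambda>a. fls_const (to_ac a)) Q (fls_X ^ N) f = 0 \<and>
       (\<forall>r\<le>0. puiseux N f r = 0)}"


text \<open>\<open>p(y + u)\<close> as a polynomial in \<open>u\<close> with coefficients in \<open>F[y]\<close>.\<close>

definition poly_translate :: "'a::comm_ring_1 poly \<Rightarrow> 'a poly poly" where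
  "poly_translate p = pcompose (map_poly (\<lambda>c. [:c:]) p) [:[:0, 1:], 1:]"

text \<open>
  The Taylor expansion in \<open>u\<close>, over \<open>F(y)\<close>, of \<open>P(y+u) / (U(y+u) V(y,u)^i)\<close>, where
  \<open>U = Q / q^i\<close> and \<open>V = (q(y+u) - q(y)) / u\<close>; both of these divisions are exact.
\<close>

definition residue_series ::
    "'a::field poly \<Rightarrow> 'a poly \<Rightarrow> 'a poly \<Rightarrow> nat \<Rightarrow> 'a poly fract fps" where
  "residue_series P Q q i =
    (let U = Q div q ^ i; V = (poly_translate q - [:q:]) div [:0, 1:]
     in fps_of_poly (map_poly to_fract (poly_translate P)) /
        fps_of_poly (map_poly to_fract (poly_translate U * V ^ i)))"

text \<open>The resultant with respect to \<open>y\<close> of \<open>A - z B\<close> and \<open>q\<close>, as a polynomial in \<open>z\<close>.\<close>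

definition residue_resultant :: "'a::field poly \<Rightarrow> 'a poly \<Rightarrow> 'a poly \<Rightarrow> 'a poly" where
  "residue_resultant A B q =
    (let lift = map_poly (\<lambda>c. [:c:])
     in resultant (lift A - smult [:0, 1:] (lift B)) (lift q))"

definition residue_factor ::
    "'a::field poly \<Rightarrow> 'a poly \<Rightarrow> 'a poly \<Rightarrow> nat \<Rightarrow> 'a poly \<Rightarrow> bool" where
  "residue_factor P Q q i R \<longleftrightarrow>
    (if degree q = 0 then R = 1
     else \<exists>A B. B \<noteq> 0 \<and> coprime A B \<and>
            Fract A B = fps_nth (residue_series P Q q i) (i - 1) \<and>
            R = residue_resultant A B q)"

definition squarefree_decomposition :: "'a::field poly \<Rightarrow> nat \<Rightarrow> (nat \<Rightarrow> 'a poly) \<Rightarrow> bool" where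
  "squarefree_decomposition Q m q \<longleftrightarrow>
     m \<ge> 1 \<and> Q = (\<Prod>i=1..m. q i ^ i) \<and>
     (\<forall>i\<in>{1..m}. squarefree (q i)) \<and>
     (\<forall>i\<in>{1..m}. \<forall>j\<in>{1..m}. i \<noteq> j \<longrightarrow> coprime (q i) (q j)) \<and>
     degree (q m) > 0"

definition algebraic_residues :: "'a::field_char_0 poly \<Rightarrow> 'a poly \<Rightarrow> 'a poly \<Rightarrow> bool" where
  "algebraic_residues P Q R \<longleftrightarrow>
    (\<exists>m q r. squarefree_decomposition Q m q \<and>
       (\<forall>i\<in>{1..m}. residue_factor P Q (q i) i (r i)) \<and>
       R = (\<Prod>i=1..m. r i))"

text \<open>
  \<open>S = \<Sigma>\<^sub>c R\<close>: here \<open>\<alpha>\<close> enumerates the roots of \<open>R\<close> with multiplicity, and the product over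
  \<open>i\<^sub>1 < \<dots> < i\<^sub>c\<close> is taken over the \<open>c\<close>-element sets of indices.
\<close>

definition pure_composed_sum :: "nat \<Rightarrow> 'a::field_char_0 poly \<Rightarrow> 'a poly \<Rightarrow> bool" where
  "pure_composed_sum c R S \<longleftrightarrow>
    (\<exists>\<alpha> :: nat \<Rightarrow> 'a alg_closure.
       map_poly to_ac R = smult (to_ac (lead_coeff R)) (\<Prod>i<degree R. [:- \<alpha> i, 1:]) \<and>
       map_poly to_ac S = (\<Prod>I\<in>{I. I \<subseteq> {..<degree R} \<and> card I = c}. [:- (\<Sum>i\<in>I. \<alpha> i), 1:]))"


lemma of_nat_fract: "(of_nat n :: 'a::idom fract) = Fract (of_nat n) 1"
  by (induction n) (simp_all add: Zero_fract_def One_fract_def add_fract)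

instance fract :: ("{idom, ring_char_0}") field_char_0
  by standard (auto intro!: injI simp: of_nat_fract eq_fract)

text \<open>
  \<open>algebraic_diagonal A B \<Phi>\<close>: on input \<open>A/B\<close> the algorithm returns \<open>\<Phi>\<close>, an element of
  \<open>K[t][\<Delta>]\<close>.  It is the numerator \<open>\<Phi>\<close> of \<open>\<Sigma>\<^sub>c R\<close> written as \<open>\<Phi> / D\<close> in lowest terms, with
  \<open>D\<close> in \<open>K[t]\<close>.
\<close>

definition algebraic_diagonal ::
    "'a::field_char_0 poly poly \<Rightarrow> 'a poly poly \<Rightarrow> 'a poly poly \<Rightarrow> bool" where
  "algebraic_diagonal A B \<Phi> \<longleftrightarrow>
    coeff (coeff B 0) 0 \<noteq> 0 \<and>
    (\<exists>P Q R S D.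
       Q \<noteq> 0 \<and> coprime P Q \<and> Fract P Q = diagonal_integrand A B \<and>
       algebraic_residues (map_poly to_fract P) (map_poly to_fract Q) R \<and>
       pure_composed_sum (card (small_branches Q)) R S \<and>
       D \<noteq> 0 \<and> coprime [:D:] \<Phi> \<and> smult (to_fract D) S = map_poly to_fract \<Phi>)"


text \<open>
  The field of rational functions over the rationals in indeterminates indexed by \<open>'v\<close>: the
  fraction field of the polynomial ring.  The order on \<open>'v\<close> is irrelevant; it is only used by
  the library to show that the polynomial ring is an integral domain.
\<close>

type_synonym 'v rat_fun = "(('v \<Rightarrow>\<^sub>0 nat) \<Rightarrow>\<^sub>0 rat) fract"

definition indet :: "'v::linorder \<Rightarrow> 'v rat_fun" where
  "indet v = to_fract (Poly_Mapping.single (Poly_Mapping.single v 1) 1)"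

definition box_poly :: "nat \<Rightarrow> nat \<Rightarrow> (nat \<Rightarrow> nat \<Rightarrow> 'a::comm_ring_1) \<Rightarrow> 'a poly poly" where
  "box_poly d\<^sub>x d\<^sub>y b = (\<Sum>i\<le>d\<^sub>x. \<Sum>j\<le>d\<^sub>y. monom (monom (b i j) i) j)"

end

theory Submission
  imports Defs "Subresultants.More_Homomorphisms"
begin

text \<open>
  Write \<open>d = dx + dy\<close>.  The denominator of the integrand is \<open>Q = y^dx B(t/y, y)\<close>, a polynomial of degree
  \<open>d\<close> in \<open>y\<close> whose \<open>d + 1\<close> coefficients involve disjoint sets of indeterminates, so that \<open>Q\<close> is a generic
  polynomial.  Explicitly, there is an endomorphism \<open>\<phi>\<close> of the field of rational functions which turns \<open>Q\<close> into
  \<open>e (y - t W_1) \<dots> (y - t W_d)\<close>, where \<open>e\<close> and the \<open>W_l\<close> are indeterminates, and every permutation of the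
  \<open>W_l\<close> induces an automorphism fixing the image of \<open>\<phi>\<close> pointwise.  A polynomial whose image under \<open>\<phi>\<close> is
  a product of distinct linear factors permuted transitively by these automorphisms is irreducible, so no Galois
  theory is needed.

  The residues are \<open>r_l = P/Q'\<close> at the roots, and a permutation of the roots permutes them accordingly.  If
  two sums of \<open>c\<close> residues over different index sets \<open>I\<close>, \<open>J\<close> coincided, then subtracting from this relation its
  image under the transposition of some \<open>a \<in> I - J\<close> and \<open>b \<in> J - I\<close> would give \<open>r_a = r_b\<close>, hence all
  residues would be equal; this contradicts \<open>deg P \<le> d - 2\<close>.  So the sums are distinct, and they are permuted
  transitively.

  Finally \<open>c = dx\<close>: the small branches are \<open>y = t w(t)\<close>, where \<open>w(0)\<close> is one of the \<open>dx\<close> simple roots of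
  \<open>\<Sum>i. b_(i,0) w^(dx - i)\<close>.
\<close>

section \<open>Extension of field homomorphisms to the algebraic closure\<close>

text \<open>The composed sum is specified through roots in an algebraic closure, whereas \<phi> and
  the permutations act on the field itself; moreover \<phi> does not fix the b's and is not
  surjective. To compare the two sides, \<phi> is extended to the closure: the extension carries the
  roots of R to the residues r_l, which lie in the field. The same extension theorem, applied to the
  inclusion into the closure, shows that an element fixed by all homomorphisms over the base lies in
  the base. Hence the composed sum has coefficients in the field, on which the existence of an
  output rests. The other concern is that the algorithm is a relation, so each of its choices has to
  be harmless. Irreducibility of Q forces the trivial squarefree decomposition, and a coprime pair
  P, Q is determined up to a nonzero constant k of Q((b)), which is why the splitting of Q is
  carried along for all constant multiples.\<close>

lemma to_ac_hom: "field_hom (to_ac :: 'a::field \<Rightarrow> 'a alg_closure)"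
  by unfold_locales auto

text \<open>
  A homomorphism from a ring between the base field and its algebraic closure is represented by its graph, which
  makes unions of chains available for Zorn's lemma.
\<close>

definition partial_hom :: "('a::field \<Rightarrow> 'b::field) \<Rightarrow> ('a alg_closure \<times> 'b) set \<Rightarrow> bool" where
  "partial_hom \<phi> G \<longleftrightarrow> (\<forall>x. (to_ac x, \<phi> x) \<in> G) \<and> (\<forall>b. (0, b) \<in> G \<longrightarrow> b = 0) \<and>
     (\<forall>a b c d. (a, b) \<in> G \<longrightarrow> (c, d) \<in> G \<longrightarrow> (a + c, b + d) \<in> G \<and> (a * c, b * d) \<in> G)"

definition coeffs_in :: "('a::zero \<times> 'b::zero) set \<Rightarrow> 'a poly \<Rightarrow> 'b poly \<Rightarrow> bool" where
  "coeffs_in G p q \<longleftrightarrow> (\<forall>i. (coeff p i, coeff q i) \<in> G)"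

context
  fixes \<phi> :: "'a::field \<Rightarrow> 'b::field" and G
  assumes \<phi>: "field_hom \<phi>" and G: "partial_hom \<phi> G"
begin

interpretation \<phi>: field_hom \<phi> by (rule \<phi>)

lemma partial_hom_base: "(to_ac x, \<phi> x) \<in> G" using G by (auto simp: partial_hom_def)
lemma partial_hom_eq_0: "(0, b) \<in> G \<Longrightarrow> b = 0" using G by (auto simp: partial_hom_def)
lemma partial_hom_zero: "(0, 0) \<in> G" using partial_hom_base[of 0] by simp
lemma partial_hom_one: "(1, 1) \<in> G" using partial_hom_base[of 1] by simp
lemma partial_hom_add: "(a, b) \<in> G \<Longrightarrow> (c, d) \<in> G \<Longrightarrow> (a + c, b + d) \<in> G" using G by (auto simp: partial_hom_def)
lemma partial_hom_mult: "(a, b) \<in> G \<Longrightarrow> (c, d) \<in> G \<Longrightarrow> (a * c, b * d) \<in> G" using G by (auto simp: partial_hom_def)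
lemma partial_hom_minus: "(a, b) \<in> G \<Longrightarrow> (- a, - b) \<in> G"
  using partial_hom_mult[OF partial_hom_base[of "-1"], of a b] by (simp add: \<phi>.hom_uminus)
lemma partial_hom_diff: "(a, b) \<in> G \<Longrightarrow> (c, d) \<in> G \<Longrightarrow> (a - c, b - d) \<in> G"
  using partial_hom_add[OF _ partial_hom_minus] by fastforce
text \<open>Two values of the same element differ by a value of \<open>0\<close>, so the clause on
  \<open>0\<close> in \<open>partial_hom\<close> makes the relation single-valued.\<close>

lemma partial_hom_unique: "(a, b) \<in> G \<Longrightarrow> (a, c) \<in> G \<Longrightarrow> b = c"
  using partial_hom_diff[of a b a c] partial_hom_eq_0[of "b - c"] by simp
lemma partial_hom_power: "(a, b) \<in> G \<Longrightarrow> (a ^ n, b ^ n) \<in> G"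
  by (induction n) (auto intro: partial_hom_one partial_hom_mult)
lemma partial_hom_sum: "(\<And>i. i \<in> I \<Longrightarrow> (f i, g i) \<in> G) \<Longrightarrow> (sum f I, sum g I) \<in> G"
  by (induction I rule: infinite_finite_induct) (auto intro: partial_hom_zero partial_hom_add)

lemma partial_hom_poly:
  assumes "coeffs_in G p q" "(a, b) \<in> G" shows "(poly p a, poly q b) \<in> G"
proof -
  let ?n = "max (degree p) (degree q)"
  have *: "poly r x = (\<Sum>i\<le>n. coeff r i * x ^ i)" if "degree r \<le> n" for r :: "'z::comm_ring_1 poly" and x n
    unfolding poly_altdef by (rule sum.mono_neutral_left) (use that in \<open>auto simp: coeff_eq_0\<close>)
  have "(\<Sum>i\<le>?n. coeff p i * a ^ i, \<Sum>i\<le>?n. coeff q i * b ^ i) \<in> G"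
    by (rule partial_hom_sum) (use assms in \<open>auto simp: coeffs_in_def intro: partial_hom_mult partial_hom_power\<close>)
  thus ?thesis by (simp add: *[of p ?n] *[of q ?n])
qed

text \<open>A nonzero \<open>x\<close> satisfies a relation of least degree over the base field; its
  constant coefficient \<open>c\<close> is nonzero, so \<open>c + x s(x) = 0\<close> writes the
  inverse of \<open>x\<close> as a polynomial in \<open>x\<close>. The domain, a ring of algebraic
  elements, is therefore a field.\<close>

lemma partial_hom_inverse:
  assumes "(x, y) \<in> G" "x \<noteq> 0" shows "(inverse x, inverse y) \<in> G"
proof -
  obtain r0 where "r0 \<noteq> 0 \<and> poly (map_poly to_ac r0) x = 0"
    using alg_closure_algebraic[of x] by metis
  then obtain r where r: "r \<noteq> 0" "poly (map_poly to_ac r) x = 0"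
    and min: "\<And>s. s \<noteq> 0 \<Longrightarrow> poly (map_poly to_ac s) x = 0 \<Longrightarrow> degree r \<le> degree s"
    using ex_has_least_nat[of "\<lambda>r. r \<noteq> 0 \<and> poly (map_poly to_ac r) x = 0" r0 degree] by blast
  obtain c s where rcs: "r = pCons c s" by (cases r)
  interpret ac: field_hom "to_ac :: 'a \<Rightarrow> _" by (rule to_ac_hom)
  have eq: "to_ac c + x * poly (map_poly to_ac s) x = 0"
    using r(2) by (simp add: rcs ac.map_poly_pCons_hom)
  \<comment> \<open>Otherwise a factor \<open>x\<close> could be cancelled, and \<open>s\<close>
    would be a relation of smaller degree.\<close>
  have c: "c \<noteq> 0"
  proof
    assume "c = 0"
    with eq assms have "poly (map_poly to_ac s) x = 0" by simp
    moreover have "s \<noteq> 0" using r rcs \<open>c = 0\<close> by auto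
    ultimately show False using min[of s] rcs by simp
  qed
  define u where "u = poly (map_poly to_ac s) x"
  define v where "v = poly (map_poly \<phi> s) y"
  have uv: "(u, v) \<in> G" unfolding u_def v_def
    by (rule partial_hom_poly[OF _ assms(1)]) (auto simp: coeffs_in_def intro: partial_hom_base)
  have "(u * to_ac (- inverse c), v * \<phi> (- inverse c)) \<in> G" by (intro partial_hom_mult uv partial_hom_base)
  moreover have "x * u = - to_ac c" using eq by (simp add: u_def add_eq_0_iff)
  hence "u * to_ac (- inverse c) = inverse x"
    using c assms by (simp add: field_simps)
  ultimately obtain z where z: "(inverse x, z) \<in> G" by auto
  have "(x * inverse x, y * z) \<in> G" by (intro partial_hom_mult assms z)
  hence "y * z = 1" using partial_hom_unique partial_hom_one assms by auto
  hence "z = inverse y" by (metis inverse_unique)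
  with z show ?thesis by simp
qed

lemma coeffs_in_arith:
  assumes "coeffs_in G p q" "coeffs_in G p' q'"
  shows "coeffs_in G (p + p') (q + q')" "coeffs_in G (p - p') (q - q')" "coeffs_in G (p * p') (q * q')"
proof -
  show "coeffs_in G (p * p') (q * q')" unfolding coeffs_in_def coeff_mult
    using assms by (auto simp: coeffs_in_def intro: partial_hom_sum partial_hom_mult)
qed (use assms in \<open>auto simp: coeffs_in_def intro: partial_hom_add partial_hom_diff\<close>)

lemma coeffs_in_monom: "(a, b) \<in> G \<Longrightarrow> coeffs_in G (monom a n) (monom b n)"
  by (auto simp: coeffs_in_def coeff_monom intro: partial_hom_zero)

text \<open>Here \<open>p\<close> is the minimal polynomial of \<open>a\<close> over the domain of
  \<open>G\<close>, and \<open>q\<close> is its image. Division of \<open>f\<close> by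
  \<open>p\<close> is carried out in parallel on the images: whenever a leading term is removed from
  \<open>f\<close>, the corresponding multiple of \<open>q\<close> is removed from \<open>g\<close>.
  This makes sending \<open>a\<close> to \<open>b\<close> well defined.\<close>

lemma coeffs_in_root_transfer:
  assumes pq: "coeffs_in G p q" and monic: "lead_coeff p = 1" and deg: "degree p > 0"
    and q: "poly q b = 0" and p: "poly p a = 0"
    and min: "\<And>r s. coeffs_in G r s \<Longrightarrow> r \<noteq> 0 \<Longrightarrow> poly r a = 0 \<Longrightarrow> degree p \<le> degree r"
    and fg: "coeffs_in G f g" and f: "poly f a = 0"
  shows "poly g b = 0"
  using fg f
proof (induction "degree f" arbitrary: f g rule: less_induct)
  case less
  show ?case
  proof (cases "f = 0")
    case True
    hence "coeff g i = 0" for i using less.prems by (auto simp: coeffs_in_def intro: partial_hom_eq_0)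
    hence "g = 0" by (auto simp: poly_eq_iff)
    thus ?thesis by simp
  next
    case False
    let ?n = "degree f"
    have le: "degree p \<le> ?n" using min less.prems False by blast
    define f1 where "f1 = f - monom (coeff f ?n) (?n - degree p) * p"
    define g1 where "g1 = g - monom (coeff g ?n) (?n - degree p) * q"
    have in1: "coeffs_in G f1 g1" unfolding f1_def g1_def
      by (intro coeffs_in_arith coeffs_in_monom pq less.prems)
        (use less.prems in \<open>auto simp: coeffs_in_def\<close>)
    have "degree f1 \<le> ?n" unfolding f1_def
      by (rule degree_diff_le) (use le in \<open>auto intro!: order_trans[OF degree_mult_le] simp: degree_monom_eq False\<close>)
    moreover have "coeff f1 ?n = 0" unfolding f1_def using le monic
      by (simp add: coeff_monom_mult)
    ultimately have "degree f1 < ?n"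
      using deg le by (metis coeff_0_degree_minus_1 diff_less le_neq_implies_less leading_coeff_0_iff less_le_trans degree_0)
    moreover have "poly f1 a = 0" by (simp add: f1_def less.prems p)
    ultimately have "poly g1 b = 0" using less.hyps in1 by blast
    thus ?thesis by (simp add: g1_def q)
  qed
qed

end

lemma partial_hom_Union_chain:
  assumes "\<C> \<noteq> {}" "subset.chain {G. partial_hom \<phi> G} \<C>"
  shows "partial_hom \<phi> (\<Union>\<C>)"
  unfolding partial_hom_def
proof (intro conjI allI impI)
  have C: "\<And>G. G \<in> \<C> \<Longrightarrow> partial_hom \<phi> G" and ch: "\<And>G H. G \<in> \<C> \<Longrightarrow> H \<in> \<C> \<Longrightarrow> G \<subseteq> H \<or> H \<subseteq> G"
    using assms(2) by (auto simp: subset.chain_def)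
  show "(to_ac x, \<phi> x) \<in> \<Union>\<C>" for x using assms(1) C by (force simp: partial_hom_def)
  show "b = 0" if "(0, b) \<in> \<Union>\<C>" for b using that C by (force simp: partial_hom_def)
  fix a b c d assume "(a, b) \<in> \<Union>\<C>" "(c, d) \<in> \<Union>\<C>"
  then obtain G H where GH: "G \<in> \<C>" "H \<in> \<C>" "(a, b) \<in> G" "(c, d) \<in> H" by auto
  then obtain M where "M \<in> \<C>" "(a, b) \<in> M" "(c, d) \<in> M" using ch[of G H] by blast
  with C[of M] show "(a + c, b + d) \<in> \<Union>\<C>" "(a * c, b * d) \<in> \<Union>\<C>"
    unfolding partial_hom_def by blast+
qed

text \<open>Adjoining one element: \<open>a\<close> is sent to a root \<open>b\<close> of the image
  of its minimal polynomial over the domain of \<open>G\<close>, and the new graph consists of the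
  values of corresponding polynomials at \<open>a\<close> and \<open>b\<close>.\<close>

lemma partial_hom_extend:
  fixes \<phi> :: "'a::field \<Rightarrow> 'b::alg_closed_field"
  assumes \<phi>: "field_hom \<phi>" and G: "partial_hom \<phi> G"
  shows "\<exists>H b. partial_hom \<phi> H \<and> G \<subseteq> H \<and> (a, b) \<in> H"
proof -
  note ph = partial_hom_base[OF \<phi> G] partial_hom_one[OF \<phi> G] partial_hom_zero[OF \<phi> G]
  interpret ac: field_hom "to_ac :: 'a \<Rightarrow> _" by (rule to_ac_hom)
  interpret \<phi>: field_hom \<phi> by (rule \<phi>)
  let ?P = "\<lambda>p. p \<noteq> 0 \<and> poly p a = 0 \<and> (\<exists>q. coeffs_in G p q)"
  obtain r0 :: "'a poly" where "r0 \<noteq> 0" "poly (map_poly to_ac r0) a = 0"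
    using alg_closure_algebraic[of a] by metis
  hence "?P (map_poly to_ac r0)"
    using ph(1) by (auto simp: coeffs_in_def intro!: exI[of _ "map_poly \<phi> r0"])
  then obtain p0 where "?P p0" and min0: "\<And>s. ?P s \<Longrightarrow> degree p0 \<le> degree s"
    using ex_has_least_nat[of ?P _ degree] by blast
  then obtain q0 where p0: "p0 \<noteq> 0" "poly p0 a = 0" "coeffs_in G p0 q0" by blast
  define c where "c = lead_coeff p0"
  define p where "p = [:inverse c:] * p0"
  define q where "q = [:inverse (coeff q0 (degree p0)):] * q0"
  have c: "c \<noteq> 0" using p0 by (simp add: c_def)
  have "(c, coeff q0 (degree p0)) \<in> G" using p0(3) by (auto simp: coeffs_in_def c_def)
  hence "coeffs_in G [:inverse c:] [:inverse (coeff q0 (degree p0)):]"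
    using coeffs_in_monom[OF \<phi> G partial_hom_inverse[OF \<phi> G], of c _ 0] c by (simp add: monom_0)
  hence pq: "coeffs_in G p q" unfolding p_def q_def by (rule coeffs_in_arith(3)[OF \<phi> G _ p0(3)])
  have degp: "degree p = degree p0" using c by (simp add: p_def)
  have monic: "lead_coeff p = 1" using c by (simp add: degp) (simp add: p_def c_def)
  have pa: "poly p a = 0" by (simp add: p_def p0)
  have dpos: "degree p > 0"
  proof (rule ccontr)
    assume "\<not> degree p > 0"
    hence "p = [:1:]" using monic by (metis degree_eq_zeroE gr0I lead_coeff_pCons(2))
    with pa show False by simp
  qed
  \<comment> \<open>The leading coefficient \<open>1\<close> of \<open>p\<close> corresponds to
    \<open>1\<close>, so \<open>q\<close> is not constant and has a root in the algebraically closed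
    target.\<close>
  have "(1, coeff q (degree p)) \<in> G" using pq monic by (metis coeffs_in_def)
  hence "coeff q (degree p) = 1" using partial_hom_unique[OF \<phi> G] ph(2) by metis
  hence "degree q > 0" using dpos by (metis le_degree less_le_trans zero_neq_one)
  then obtain b where b: "poly q b = 0" using alg_closed_imp_poly_has_root by blast
  define H where "H = {(poly f a, poly g b) | f g. coeffs_in G f g}"
  have sub: "G \<subseteq> H"
  proof (rule subrelI)
    fix x y assume "(x, y) \<in> G"
    hence "coeffs_in G [:x:] [:y:]" using coeffs_in_monom[OF \<phi> G, of x y 0] by (simp add: monom_0)
    hence "(poly [:x:] a, poly [:y:] b) \<in> H" unfolding H_def by blast
    thus "(x, y) \<in> H" by simp
  qed
  have "partial_hom \<phi> H" unfolding partial_hom_def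
  proof (intro conjI allI impI)
    show "(to_ac x, \<phi> x) \<in> H" for x using sub ph(1) by blast
    show "y = 0" if "(0, y) \<in> H" for y
    proof -
      from that obtain f g where "poly f a = 0" "y = poly g b" "coeffs_in G f g" by (auto simp: H_def)
      moreover have "degree p \<le> degree r" if "coeffs_in G r s" "r \<noteq> 0" "poly r a = 0" for r s
        using min0[of r] that degp by auto
      ultimately show ?thesis
        using coeffs_in_root_transfer[OF \<phi> G pq monic dpos b pa] by blast
    qed
    fix x y z w assume xy: "(x, y) \<in> H" and zw: "(z, w) \<in> H"
    have "(x + z, y + w) \<in> H \<and> (x * z, y * w) \<in> H"
    proof -
      obtain f g f' g' where *: "x = poly f a" "y = poly g b" "z = poly f' a" "w = poly g' b"
        "coeffs_in G f g" "coeffs_in G f' g'" using xy zw unfolding H_def by auto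
      have "x + z = poly (f + f') a" "y + w = poly (g + g') b" "x * z = poly (f * f') a" "y * w = poly (g * g') b"
        using * by auto
      thus ?thesis using coeffs_in_arith[OF \<phi> G *(5,6)] unfolding H_def by blast
    qed
    thus "(x + z, y + w) \<in> H" "(x * z, y * w) \<in> H" by auto
  qed
  moreover have "coeffs_in G [:0, 1:] [:0, 1:]"
    using coeffs_in_monom[OF \<phi> G ph(2), of 1] by (simp add: monom_altdef)
  hence "(poly [:0, 1:] a, poly [:0, 1:] b) \<in> H" unfolding H_def by blast
  hence "(a, b) \<in> H" by simp
  ultimately show ?thesis using sub by blast
qed

text \<open>Zorn's lemma on the graphs containing \<open>G\<close>; by the one-element extension a
  maximal graph is total. Starting from an arbitrary \<open>G\<close> makes it possible to prescribe
  the image of a chosen element.\<close>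

theorem alg_closure_hom_extension:
  fixes \<phi> :: "'a::field \<Rightarrow> 'b::alg_closed_field"
  assumes \<phi>: "field_hom \<phi>" and G: "partial_hom \<phi> G"
  obtains \<Theta> where "field_hom \<Theta>" "\<And>x. \<Theta> (to_ac x) = \<phi> x" "\<And>a b. (a, b) \<in> G \<Longrightarrow> \<Theta> a = b"
proof -
  let ?A = "{H. partial_hom \<phi> H \<and> G \<subseteq> H}"
  have "\<exists>M\<in>?A. \<forall>N\<in>?A. M \<subseteq> N \<longrightarrow> N = M"
  proof (rule subset_Zorn_nonempty)
    show "?A \<noteq> {}" using G by blast
    fix \<C> assume C: "\<C> \<noteq> {}" "subset.chain ?A \<C>"
    hence "subset.chain {G. partial_hom \<phi> G} \<C>" by (auto simp: subset.chain_def)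
    hence "partial_hom \<phi> (\<Union>\<C>)" using partial_hom_Union_chain C(1) by blast
    moreover obtain G' where "G' \<in> \<C>" using C(1) by blast
    moreover from this have "G \<subseteq> G'" using C(2) by (auto simp: subset.chain_def)
    ultimately show "\<Union>\<C> \<in> ?A" by blast
  qed
  then obtain M where M': "M \<in> ?A" and max: "\<forall>N\<in>?A. M \<subseteq> N \<longrightarrow> N = M" ..
  hence M: "partial_hom \<phi> M" "G \<subseteq> M" by auto
  have ex: "\<exists>b. (a, b) \<in> M" for a
  proof -
    obtain H b where H: "partial_hom \<phi> H" "M \<subseteq> H" "(a, b) \<in> H"
      using partial_hom_extend[OF \<phi> M(1), of a] by auto
    hence "H \<in> ?A" using M(2) by auto
    with max H(2) have "H = M" by simp
    with H(3) show ?thesis by auto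
  qed
  define \<Theta> where "\<Theta> a = (SOME b. (a, b) \<in> M)" for a
  have \<Theta>: "(a, \<Theta> a) \<in> M" for a unfolding \<Theta>_def using someI_ex[OF ex] .
  have eq: "\<Theta> a = b" if "(a, b) \<in> M" for a b using partial_hom_unique[OF \<phi> M(1)] \<Theta> that by blast
  have "\<Theta> (to_ac x) = \<phi> x" for x by (intro eq partial_hom_base[OF \<phi> M(1)])
  moreover have "field_hom \<Theta>"
    by unfold_locales
      (auto intro!: eq partial_hom_zero[OF \<phi> M(1)] partial_hom_one[OF \<phi> M(1)] partial_hom_add[OF \<phi> M(1)] partial_hom_mult[OF \<phi> M(1)] \<Theta>)
  moreover have "\<Theta> a = b" if "(a, b) \<in> G" for a b using eq that M(2) by blast
  ultimately show ?thesis using that by blast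
qed

lemma partial_hom_range:
  assumes "field_hom \<phi>" shows "partial_hom \<phi> (range (\<lambda>x. (to_ac x, \<phi> x)))"
proof -
  interpret field_hom \<phi> by fact
  show ?thesis unfolding partial_hom_def
    by (auto simp: image_iff hom_add hom_mult) (metis to_ac_add hom_add, metis to_ac_mult hom_mult)
qed

text \<open>An element outside the base field has a minimal polynomial of degree at least two, which
  is separable in characteristic 0 and so has a second root \<open>y\<close>; some homomorphism over
  the base then moves \<open>x\<close> to \<open>y\<close>.\<close>

lemma alg_closure_fixed_imp_base:
  fixes x :: "'a::field_char_0 alg_closure"
  assumes fixed: "\<And>\<Theta> :: 'a alg_closure \<Rightarrow> 'a alg_closure.
    field_hom \<Theta> \<Longrightarrow> (\<And>c. \<Theta> (to_ac c) = to_ac c) \<Longrightarrow> \<Theta> x = x"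
  shows "x \<in> range to_ac"
proof -
  interpret ac: field_hom "to_ac :: 'a \<Rightarrow> _" by (rule to_ac_hom)
  interpret acp: map_poly_inj_idom_hom "to_ac :: 'a \<Rightarrow> _" ..
  let ?e = "\<lambda>r. map_poly to_ac (r :: 'a poly)"
  let ?P = "\<lambda>r. r \<noteq> 0 \<and> poly (?e r) x = 0"
  obtain r0 where "?P r0" using alg_closure_algebraic[of x] by metis
  then obtain p where p: "p \<noteq> 0" "poly (?e p) x = 0"
    and min: "\<And>s. ?P s \<Longrightarrow> degree p \<le> degree s"
    using ex_has_least_nat[of ?P _ degree] by blast
  have min': "s = 0" if "poly (?e s) x = 0" "degree s < degree p" for s
    using min[of s] that by fastforce
  have dvd: "p dvd f" if "poly (?e f) x = 0" for f
  proof -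
    have "?e f = ?e (f div p * p + f mod p)" by simp
    also have "\<dots> = ?e (f div p) * ?e p + ?e (f mod p)" by (simp only: acp.hom_mult acp.hom_add)
    finally have "poly (?e (f mod p)) x = 0" using that p by simp
    moreover have "f mod p = 0 \<or> degree (f mod p) < degree p" using degree_mod_less[of p f] p by auto
    ultimately have "f mod p = 0" using min' by blast
    thus ?thesis by (simp add: mod_eq_0_iff_dvd)
  qed
  have deg: "degree p > 0"
  proof (rule ccontr)
    assume "\<not> degree p > 0"
    then obtain c where "p = [:c:]" by (metis degree_eq_zeroE gr0I)
    with p show False by simp
  qed
  obtain q where q: "?e p = [:-x, 1:] * q" using p(2) poly_eq_0_iff_dvd by (metis dvdE)
  \<comment> \<open>A double root would also be a root of the derivative, which has smaller degree
    and, in characteristic 0, is not zero.\<close>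
  have qx: "poly q x \<noteq> 0"
  proof
    assume "poly q x = 0"
    hence "poly (pderiv (?e p)) x = 0" unfolding q by (simp only: pderiv_mult poly_add poly_mult) (simp add: pderiv_pCons)
    hence "poly (?e (pderiv p)) x = 0" by (simp add: ac.map_poly_pderiv)
    moreover have "degree (pderiv p) < degree p" using deg by (simp add: degree_pderiv)
    ultimately have "pderiv p = 0" by (rule min')
    thus False using deg by (simp add: pderiv_eq_0_iff)
  qed
  hence q0: "q \<noteq> 0" by auto
  have degq: "degree (?e p) = Suc (degree q)" unfolding q by (subst degree_mult_eq) (use q0 in auto)
  show ?thesis
  proof (cases "degree q = 0")
    case True
    with degq have d1: "degree p = 1" by simp
    then obtain a b where ab: "p = [:a, b:]" "b \<noteq> 0"
      by (cases p) (auto split: if_splits elim!: degree_eq_zeroE)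
    with p have "to_ac a + x * to_ac b = 0" by (simp add: ac.map_poly_pCons_hom)
    hence "x = to_ac (- a / b)" using ab(2) by (simp add: field_simps add_eq_0_iff)
    thus ?thesis by blast
  next
    case False
    then obtain y where y: "poly q y = 0" using alg_closed_imp_poly_has_root by blast
    with qx have neq: "y \<noteq> x" by auto
    \<comment> \<open>The map from \<open>f(x)\<close> to \<open>f(y)\<close> is well defined
      because \<open>p\<close>, which divides every \<open>f\<close> vanishing at \<open>x\<close>,
      also vanishes at \<open>y\<close>.\<close>
    define G where "G = {(poly (?e f) x, poly (?e f) y) | f. True}"
    have "partial_hom to_ac G" unfolding partial_hom_def
    proof (intro conjI allI impI)
      show "(to_ac c, to_ac c) \<in> G" for c unfolding G_def by (auto intro!: exI[of _ "[:c:]"] simp: ac.map_poly_pCons_hom)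
      show "b = 0" if "(0, b) \<in> G" for b
      proof -
        from that obtain f where f: "poly (?e f) x = 0" "b = poly (?e f) y" by (auto simp: G_def)
        then obtain g where "f = p * g" using dvd by (metis dvdE)
        thus ?thesis using f(2) by (simp add: acp.hom_mult q y)
      qed
      fix a b c d assume "(a, b) \<in> G" "(c, d) \<in> G"
      then obtain f g where *: "a = poly (?e f) x" "b = poly (?e f) y" "c = poly (?e g) x" "d = poly (?e g) y"
        by (auto simp: G_def)
      show "(a + c, b + d) \<in> G" unfolding G_def using * by (auto intro!: exI[of _ "f + g"] simp: acp.hom_add)
      show "(a * c, b * d) \<in> G" unfolding G_def using * by (auto intro!: exI[of _ "f * g"] simp: acp.hom_mult)
    qed
    then obtain \<Theta> where \<Theta>: "field_hom \<Theta>" "\<And>c. \<Theta> (to_ac c) = to_ac c" "\<And>a b. (a, b) \<in> G \<Longrightarrow> \<Theta> a = b"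
      using alg_closure_hom_extension[OF to_ac_hom] by metis
    have "(x, y) \<in> G" unfolding G_def by (auto intro!: exI[of _ "[:0, 1:]"] simp: ac.map_poly_pCons_hom)
    with \<Theta> fixed neq show ?thesis by metis
  qed
qed

section \<open>Resultants and the polynomial of residues\<close>

lemma alg_closed_linear_factors:
  fixes p :: "'a::alg_closed_field poly"
  assumes "p \<noteq> 0"
  obtains y where "p = smult (lead_coeff p) (\<Prod>i<degree p. [:- y i, 1:])"
proof -
  obtain M where M: "size M = degree p" "p = smult (lead_coeff p) (\<Prod>x\<in>#M. [:- x, 1:])"
    using alg_closed_imp_factorization[OF assms] by blast
  obtain ys where ys: "mset ys = M" using ex_mset by blast
  have "(\<Prod>x\<in>#M. [:- x, 1:]) = prod_list (map (\<lambda>x. [:- x, 1:]) ys)"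
    by (metis ys mset_map prod_mset_prod_list)
  also have "\<dots> = (\<Prod>i<degree p. [:- (ys ! i), 1:])"
    using M(1) ys by (auto simp: prod.list_conv_set_nth lessThan_atLeast0 intro!: prod.cong)
  finally show ?thesis using M that by metis
qed

lemma degree_prod_linear:
  fixes \<rho> :: "'i \<Rightarrow> 'a::idom"
  shows "degree (\<Prod>l\<in>I. [:- \<rho> l, 1:]) = card I" "lead_coeff (\<Prod>l\<in>I. [:- \<rho> l, 1:]) = 1"
proof -
  show "degree (\<Prod>l\<in>I. [:- \<rho> l, 1:]) = card I"
    by (subst degree_prod_eq_sum_degree) auto
  show "lead_coeff (\<Prod>l\<in>I. [:- \<rho> l, 1:]) = 1"
    by (simp add: lead_coeff_prod)
qed

lemma poly_prod_linear_eq_0_iff: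
  fixes \<rho> :: "'i \<Rightarrow> 'a::idom"
  assumes "finite I"
  shows "poly (\<Prod>l\<in>I. [:- \<rho> l, 1:]) x = 0 \<longleftrightarrow> x \<in> \<rho> ` I"
  using assms by (auto simp: poly_prod)

text \<open>Both sides agree at \<open>n\<close> points and in the coefficient of index
  \<open>n\<close>. That coefficient stands in for the leading one so that
  \<open>degree p < n\<close> is covered: it is then \<open>0\<close>, and \<open>p\<close>
  vanishes.\<close>

lemma distinct_roots_factorization:
  fixes p :: "'a::idom poly"
  assumes "inj_on \<rho> {..<n}" "\<And>l. l < n \<Longrightarrow> poly p (\<rho> l) = 0" "degree p \<le> n"
  shows "p = smult (coeff p n) (\<Prod>l<n. [:- \<rho> l, 1:])"
proof (rule poly_eqI_degree_lead_coeff[where A = "\<rho> ` {..<n}" and n = n])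
  note deg = degree_prod_linear[of \<rho> "{..<n}"]
  show "coeff p n = coeff (smult (coeff p n) (\<Prod>l<n. [:- \<rho> l, 1:])) n" using deg by simp
  show "degree (smult (coeff p n) (\<Prod>l<n. [:- \<rho> l, 1:])) \<le> n"
    using deg degree_smult_le[of "coeff p n" "\<Prod>l<n. [:- \<rho> l, 1:]"] by simp
  show "poly p z = poly (smult (coeff p n) (\<Prod>l<n. [:- \<rho> l, 1:])) z" if "z \<in> \<rho> ` {..<n}" for z
    using that assms(2) by (auto simp: poly_prod)
qed (use assms in \<open>auto simp: card_image\<close>)

lemma distinct_roots_imp_0:
  fixes p :: "'a::idom poly"
  assumes "inj_on \<rho> {..<n}" "\<And>l. l < n \<Longrightarrow> poly p (\<rho> l) = 0" "degree p < n"
  shows "p = 0"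
  using distinct_roots_factorization[OF assms(1,2)] assms(3) by (simp add: coeff_eq_0)

section \<open>Sylvester matrices with prescribed formal degrees\<close>

lemma sylvester_mat_sub_index_mult:
  fixes p q :: "'a::comm_ring_1 poly"
  assumes "i < m + n" "j < m + n" "degree p \<le> m" "degree q \<le> n"
  shows "sylvester_mat_sub m n p q $$ (i, j) =
    (if i < n then coeff (monom 1 (n - 1 - i) * p) (m + n - 1 - j)
     else coeff (monom 1 (m + n - 1 - i) * q) (m + n - 1 - j))"
proof -
  have "m + i - j = m + n - 1 - j - (n - 1 - i)" if "i < n" using that by simp
  moreover have "i - j = m + n - 1 - j - (m + n - 1 - i)" using assms(1) by simp
  ultimately show ?thesis
    using assms by (auto simp: sylvester_mat_sub_index coeff_monom_mult intro: coeff_eq_0)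
qed

lemma poly_altdef_le:
  fixes p :: "'a::comm_ring_1 poly"
  assumes "degree p \<le> n"
  shows "poly p x = (\<Sum>i\<le>n. coeff p i * x ^ i)"
  unfolding poly_altdef by (rule sum.mono_neutral_left) (use assms in \<open>auto simp: coeff_eq_0\<close>)

text \<open>The rows of the Sylvester matrix are the coefficient lists, in descending order, of
  multiples of \<open>p\<close> and \<open>q\<close> by powers of the variable, so the vector of
  descending powers of a common root lies in the kernel. Degree bounds take the place of exact
  degrees because degrees may drop under specialization.\<close>

lemma resultant_sub_common_root:
  fixes p q :: "'a::idom poly"
  assumes "degree p \<le> m" "degree q \<le> n" "m + n > 0" "poly p x = 0" "poly q x = 0"
  shows "resultant_sub m n p q = 0"
proof -
  let ?N = "m + n"
  let ?S = "sylvester_mat_sub m n p q"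
  define v where "v = vec ?N (\<lambda>j. x ^ (?N - 1 - j))"
  have eval: "(\<Sum>j<?N. coeff r (?N - 1 - j) * x ^ (?N - 1 - j)) = poly r x" if "degree r < ?N" for r
  proof -
    have "(\<Sum>j<?N. coeff r (?N - 1 - j) * x ^ (?N - 1 - j)) = (\<Sum>j<?N. coeff r j * x ^ j)"
      by (subst (2) sum.nat_diff_reindex[symmetric]) simp
    also have "\<dots> = (\<Sum>j\<le>?N - 1. coeff r j * x ^ j)" using assms(3) by (intro sum.cong) auto
    also have "(\<Sum>j\<le>?N - 1. coeff r j * x ^ j) = poly r x"
      using that by (subst poly_altdef_le[of r "?N - 1"]) auto
    finally show ?thesis .
  qed
  have "?S *\<^sub>v v = 0\<^sub>v ?N"
  proof (rule eq_vecI)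
    fix i assume "i < dim_vec (0\<^sub>v ?N :: 'a vec)"
    hence i: "i < ?N" by simp
    define r where "r = (if i < n then monom 1 (n - 1 - i) * p else monom 1 (?N - 1 - i) * q)"
    have "degree r < ?N"
    proof (cases "i < n")
      case True
      have "degree r \<le> (n - 1 - i) + degree p" unfolding r_def using True
        by (auto intro!: order_trans[OF degree_mult_le] simp: degree_monom_eq)
      with True assms show ?thesis by linarith
    next
      case False
      have "degree r \<le> (?N - 1 - i) + degree q" unfolding r_def using False
        by (auto intro!: order_trans[OF degree_mult_le] simp: degree_monom_eq)
      with False assms i show ?thesis by linarith
    qed
    have "(?S *\<^sub>v v) $ i = (\<Sum>j<?N. ?S $$ (i, j) * x ^ (?N - 1 - j))"
      using i by (simp add: v_def scalar_prod_def lessThan_atLeast0)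
    also have "\<dots> = (\<Sum>j<?N. coeff r (?N - 1 - j) * x ^ (?N - 1 - j))"
      by (rule sum.cong) (use i assms in \<open>auto simp: sylvester_mat_sub_index_mult r_def\<close>)
    also have "\<dots> = poly r x" by (rule eval) fact
    also have "\<dots> = 0" using assms by (simp add: r_def)
    finally show "(?S *\<^sub>v v) $ i = 0\<^sub>v ?N $ i" using i by simp
  qed simp
  \<comment> \<open>The last entry is the power of exponent \<open>0\<close>, so the vector is
    nonzero even for \<open>x = 0\<close>.\<close>
  moreover have "v $ (?N - 1) = 1" using assms(3) by (simp add: v_def)
  hence "v \<noteq> 0\<^sub>v ?N" using assms(3) by auto
  moreover have "v \<in> carrier_vec ?N" by (simp add: v_def)
  ultimately show ?thesis
    unfolding resultant_sub_def using det_0_iff_vec_prod_zero[OF sylvester_mat_sub_carrier] by blast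
qed

lemma sum_lessThan_add: "(\<Sum>i<n + m. h i) = (\<Sum>i<n. h i) + (\<Sum>i<m. h (n + i :: nat) :: 'a::comm_monoid_add)"
  by (induction m) (auto simp: add.assoc)

text \<open>A linear relation between the rows, read as the coefficients of \<open>f\<close> and
  \<open>g\<close>, says that \<open>f * p + g * q\<close> vanishes. The degree bounds are
  conditional because the zero polynomial has degree \<open>0\<close>, while \<open>m\<close> or
  \<open>n\<close> may be \<open>0\<close>.\<close>

lemma resultant_sub_eq_0_imp:
  fixes p q :: "'a::idom poly"
  assumes "degree p \<le> m" "degree q \<le> n" "resultant_sub m n p q = 0"
  obtains f g where "f \<noteq> 0 \<or> g \<noteq> 0" "f \<noteq> 0 \<Longrightarrow> degree f < n" "g \<noteq> 0 \<Longrightarrow> degree g < m" "f * p + g * q = 0"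
proof -
  let ?N = "m + n"
  let ?S = "sylvester_mat_sub m n p q"
  have T: "transpose_mat ?S \<in> carrier_mat ?N ?N" using sylvester_mat_sub_carrier by simp
  have "det (transpose_mat ?S) = 0"
    using assms(3) det_transpose[OF sylvester_mat_sub_carrier, of m n p q] by (simp add: resultant_sub_def)
  then obtain v where v: "v \<in> carrier_vec ?N" "v \<noteq> 0\<^sub>v ?N" "transpose_mat ?S *\<^sub>v v = 0\<^sub>v ?N"
    using det_0_iff_vec_prod_zero[OF T] by blast
  define f where "f = (\<Sum>i<n. monom (v $ i) (n - 1 - i))"
  define g where "g = (\<Sum>i<m. monom (v $ (n + i)) (m - 1 - i))"
  have cf: "coeff f (n - 1 - i) = v $ i" if "i < n" for i
  proof -
    have "coeff f (n - 1 - i) = (\<Sum>j<n. if j = i then v $ j else 0)"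
      unfolding f_def coeff_sum coeff_monom by (rule sum.cong) (use that in auto)
    thus ?thesis using that by simp
  qed
  have cg: "coeff g (m - 1 - i) = v $ (n + i)" if "i < m" for i
  proof -
    have "coeff g (m - 1 - i) = (\<Sum>j<m. if j = i then v $ (n + j) else 0)"
      unfolding g_def coeff_sum coeff_monom by (rule sum.cong) (use that in auto)
    thus ?thesis using that by simp
  qed
  have df: "degree f < n" if "f \<noteq> 0"
  proof -
    have "n > 0" using that by (auto simp: f_def intro: Nat.gr0I)
    thus ?thesis unfolding f_def
      by (intro degree_sum_less) (auto intro: le_less_trans[OF degree_monom_le])
  qed
  have dg: "degree g < m" if "g \<noteq> 0"
  proof -
    have "m > 0" using that by (auto simp: g_def intro: Nat.gr0I)
    thus ?thesis unfolding g_def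
      by (intro degree_sum_less) (auto intro: le_less_trans[OF degree_monom_le])
  qed
  have "f \<noteq> 0 \<or> g \<noteq> 0"
  proof (rule ccontr)
    assume "\<not> ?thesis"
    hence "v $ i = 0" if "i < ?N" for i
      using cf[of i] cg[of "i - n"] that by (cases "i < n") auto
    hence "v = 0\<^sub>v ?N" using v(1) by auto
    with v(2) show False by simp
  qed
  moreover have "f * p + g * q = 0"
  proof (rule poly_eqI)
    fix k
    show "coeff (f * p + g * q) k = coeff 0 k"
    proof (cases "k < ?N")
      case True
      define j where "j = ?N - 1 - k"
      have j: "j < ?N" "k = ?N - 1 - j" using True by (auto simp: j_def)
      have "f * p + g * q = (\<Sum>i<n. smult (v $ i) (monom 1 (n - 1 - i) * p)) +
          (\<Sum>i<m. smult (v $ (n + i)) (monom 1 (m - 1 - i) * q))"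
        unfolding f_def g_def sum_distrib_right
        by (intro arg_cong2[of _ _ _ _ "(+)"] sum.cong) (auto simp: smult_monom simp flip: mult_smult_left)
      hence "coeff (f * p + g * q) k = (\<Sum>i<n. v $ i * coeff (monom 1 (n - 1 - i) * p) k) +
          (\<Sum>i<m. v $ (n + i) * coeff (monom 1 (m - 1 - i) * q) k)"
        by (simp add: coeff_sum)
      also have "(\<Sum>i<n. v $ i * coeff (monom 1 (n - 1 - i) * p) k) = (\<Sum>i<n. v $ i * ?S $$ (i, j))"
        by (rule sum.cong) (use j assms in \<open>auto simp: sylvester_mat_sub_index_mult\<close>)
      also have "(\<Sum>i<m. v $ (n + i) * coeff (monom 1 (m - 1 - i) * q) k) =
          (\<Sum>i<m. v $ (n + i) * ?S $$ (n + i, j))"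
        by (rule sum.cong) (use j assms in \<open>auto simp: sylvester_mat_sub_index_mult\<close>)
      also have "(\<Sum>i<n. v $ i * ?S $$ (i, j)) + \<dots> = (\<Sum>i<n + m. v $ i * ?S $$ (i, j))"
        by (rule sum_lessThan_add[symmetric])
      also have "\<dots> = (transpose_mat ?S *\<^sub>v v) $ j"
        using j v(1) by (auto simp: scalar_prod_def lessThan_atLeast0 add.commute mult.commute intro!: sum.cong)
      also have "\<dots> = 0" using v(3) j by simp
      finally show ?thesis by simp
    next
      case False
      have "degree (f * p) < ?N \<or> f = 0" "degree (g * q) < ?N \<or> g = 0"
        using df dg assms(1,2) degree_mult_le[of f p] degree_mult_le[of g q] by fastforce+
      hence "coeff (f * p) k = 0" "coeff (g * q) k = 0"
        using False by (auto simp: coeff_eq_0)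
      thus ?thesis by simp
    qed
  qed
  ultimately show ?thesis using that df dg by blast
qed

text \<open>Evaluated at \<open>z\<close>, the resultant vanishes iff \<open>A - z B\<close> and
  \<open>q\<close> have a common root, i.e. iff \<open>z\<close> is one of the \<open>n\<close>
  distinct values of \<open>A/B\<close> at the roots of \<open>q\<close>. Its degree in
  \<open>z\<close> is at most \<open>n\<close>, so these values account for all of it.\<close>

lemma residue_resultant_distinct:
  fixes A B q :: "'a::field_char_0 poly"
  assumes n: "degree q = n" "n > 0" and inj: "inj_on \<rho> {..<n}"
    and root: "\<And>l. l < n \<Longrightarrow> poly q (\<rho> l) = 0" and B: "\<And>l. l < n \<Longrightarrow> poly B (\<rho> l) \<noteq> 0"
    and dist: "inj_on (\<lambda>l. poly A (\<rho> l) / poly B (\<rho> l)) {..<n}"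
  obtains c where "c \<noteq> 0"
    "residue_resultant A B q = smult c (\<Prod>l<n. [:- (poly A (\<rho> l) / poly B (\<rho> l)), 1:])"
proof -
  define F where "F = map_poly (\<lambda>c. [:c:]) A - smult [:0, 1:] (map_poly (\<lambda>c. [:c:]) B)"
  define G where "G = map_poly (\<lambda>c. [:c:]) q"
  define m where "m = degree F"
  define R where "R = residue_resultant A B q"
  have degG: "degree G = n" unfolding G_def n(1)[symmetric] by (rule degree_map_poly) auto
  have R: "R = det (sylvester_mat_sub m n F G)"
    unfolding R_def residue_resultant_def Let_def F_def[symmetric] G_def[symmetric]
      resultant_sub resultant_sub_def m_def degG ..
  have cF: "coeff F i = [:coeff A i, - coeff B i:]" for i by (simp add: F_def coeff_map_poly)
  \<comment> \<open>The degree of \<open>A - z B\<close> can drop for special \<open>z\<close>; the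
    formal degree \<open>m\<close> is kept fixed so that evaluation commutes with the
    determinant.\<close>
  have eval: "poly R z = resultant_sub m n (A - smult z B) q" for z
  proof -
    have ev: "comm_ring_hom (\<lambda>p :: 'a poly. poly p z)" by unfold_locales auto
    have "poly R z = det (map_mat (\<lambda>p. poly p z) (sylvester_mat_sub m n F G))"
      unfolding R by (rule comm_ring_hom.hom_det[OF ev, symmetric])
    also have "\<dots> = resultant_sub m n (map_poly (\<lambda>p. poly p z) F) (map_poly (\<lambda>p. poly p z) G)"
      by (simp add: sylvester_mat_sub_map resultant_sub_def)
    also have "map_poly (\<lambda>p. poly p z) F = A - smult z B"
      by (rule poly_eqI) (simp add: coeff_map_poly cF)
    also have "map_poly (\<lambda>p. poly p z) G = q"
      by (rule poly_eqI) (simp add: coeff_map_poly G_def)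
    finally show ?thesis .
  qed
  have degz: "degree (A - smult z B) \<le> m" for z
  proof (rule degree_le, intro allI impI)
    fix i assume "m < i"
    hence "coeff F i = 0" by (simp add: m_def coeff_eq_0)
    thus "coeff (A - smult z B) i = 0" by (simp add: cF)
  qed
  let ?r = "\<lambda>l. poly A (\<rho> l) / poly B (\<rho> l)"
  have zero: "poly R (?r l) = 0" if "l < n" for l
    unfolding eval by (rule resultant_sub_common_root[where x = "\<rho> l"])
      (use that degz n root B in auto)
  have nonzero: "poly R z \<noteq> 0" if "z \<notin> ?r ` {..<n}" for z
  proof
    assume "poly R z = 0"
    then obtain f g where fg: "f \<noteq> 0 \<or> g \<noteq> 0" "f \<noteq> 0 \<Longrightarrow> degree f < n"
      "f * (A - smult z B) + g * q = 0"
      unfolding eval using resultant_sub_eq_0_imp[OF degz, of q n] n(1) by (metis order_refl)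
    \<comment> \<open>At each root of \<open>q\<close> the factor \<open>A - z B\<close> is nonzero,
      so \<open>f\<close> itself must vanish there; \<open>n\<close> roots are too many for its
      degree.\<close>
    have "poly f (\<rho> l) = 0" if "l < n" for l
    proof -
      have "poly (f * (A - smult z B) + g * q) (\<rho> l) = 0" by (simp add: fg)
      moreover have "poly (A - smult z B) (\<rho> l) \<noteq> 0"
      proof
        assume "poly (A - smult z B) (\<rho> l) = 0"
        hence "z = ?r l" using B[OF that] by (simp add: field_simps)
        thus False using \<open>z \<notin> _\<close> that by blast
      qed
      ultimately show ?thesis using root[OF that] by simp
    qed
    hence "f = 0" using fg(2) distinct_roots_imp_0[OF inj] by blast
    with fg n show False by auto
  qed
  \<comment> \<open>Only the \<open>n\<close> rows built from \<open>F\<close> involve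
    \<open>z\<close>, and they do so linearly; the other entries are constants. The Leibniz formula
    then bounds the degree.\<close>
  have deg: "degree R \<le> n" unfolding R det_def'[OF sylvester_mat_sub_carrier]
  proof (rule degree_sum_le)
    show "finite {p. p permutes {0..<m + n}}" by (simp add: finite_permutations)
    fix p assume "p \<in> {p. p permutes {0..<m + n}}"
    hence p: "p i < m + n" if "i < m + n" for i using that permutes_in_image[of p _ i] by auto
    have "degree (signof p * (\<Prod>i = 0..<m + n. sylvester_mat_sub m n F G $$ (i, p i))) \<le>
        degree (\<Prod>i = 0..<m + n. sylvester_mat_sub m n F G $$ (i, p i))"
      by (auto simp: sign_def)
    also have "\<dots> \<le> (\<Sum>i = 0..<m + n. degree (sylvester_mat_sub m n F G $$ (i, p i)))"
      using degree_prod_sum_le[of "{0..<m+n}" "\<lambda>i. sylvester_mat_sub m n F G $$ (i, p i)"]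
      by (simp add: o_def)
    also have "\<dots> \<le> (\<Sum>i = 0..<m + n. if i < n then 1 else 0)"
      by (rule sum_mono) (use p in \<open>auto simp: sylvester_mat_sub_index cF G_def coeff_map_poly\<close>)
    also have "\<dots> = n" by (simp add: sum.If_cases Int_def) (subst card_lessThan[symmetric], rule arg_cong[of _ _ card], auto)
    finally show "degree (signof p * (\<Prod>i = 0..<m + n. sylvester_mat_sub m n F G $$ (i, p i))) \<le> n" .
  qed
  have fac: "R = smult (coeff R n) (\<Prod>l<n. [:- ?r l, 1:])"
    by (rule distinct_roots_factorization) (use dist zero deg in auto)
  obtain z where "z \<notin> ?r ` {..<n}" using ex_new_if_finite[of "?r ` {..<n}"] infinite_UNIV_char_0 by blast
  from nonzero[OF this] have "R \<noteq> 0" by auto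
  hence "coeff R n \<noteq> 0" using fac by (metis smult_0_left)
  thus ?thesis using that fac R_def by blast
qed

section \<open>Simple poles and irreducible denominators\<close>

lemma coeff_poly_translate:
  "coeff (poly_translate p) 0 = p \<and> coeff (poly_translate p) (Suc 0) = pderiv p"
proof (induction p)
  case (pCons a p)
  have "map_poly (\<lambda>c. [:c:]) (pCons a p) = pCons [:a:] (map_poly (\<lambda>c. [:c:]) p)"
    by (rule poly_eqI) (simp add: coeff_map_poly coeff_pCons split: nat.split)
  hence "poly_translate (pCons a p) = [:[:a:]:] + [:[:0, 1:], 1:] * poly_translate p"
    unfolding poly_translate_def by (simp only: pcompose_pCons)
  thus ?case using pCons.IH
    by (simp add: pderiv_pCons)
qed (simp add: poly_translate_def)

text \<open>For a simple pole the cofactor \<open>U\<close> is \<open>1\<close> and \<open>V\<close>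
  has constant term \<open>pderiv q\<close>, so the zeroth coefficient is the classical residue,
  numerator over derivative of the denominator.\<close>

lemma residue_series_nth_0:
  fixes P q :: "'a::field poly"
  assumes "q \<noteq> 0" "pderiv q \<noteq> 0"
  shows "fps_nth (residue_series P q q 1) 0 = Fract P (pderiv q)"
proof -
  define W where "W = poly_translate q"
  obtain a V where W: "W = pCons a V" by (cases W)
  have a: "a = q" using coeff_poly_translate[of q] W unfolding W_def by simp
  have "W - [:q:] = [:0, 1:] * V" by (simp add: W a)
  hence V: "(W - [:q:]) div [:0, 1:] = V" by (simp del: mult_pCons_left)
  have cV: "coeff V 0 = pderiv q" using coeff_poly_translate[of q] W unfolding W_def by simp
  have tr1: "poly_translate 1 = (1 :: 'a poly poly)" by (simp add: poly_translate_def)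
  show ?thesis
    using assms coeff_poly_translate[of P] cV V
    by (simp add: residue_series_def Let_def W_def[symmetric] tr1 coeff_map_poly Fract_conv_to_fract)
qed

text \<open>Once a factor \<open>q m\<close>, a nonunit by the degree condition, is split off from
  \<open>Q\<close>, the cofactor is a unit; it contains \<open>q m ^ (m - 1)\<close>.\<close>

lemma squarefree_decomposition_irreducible:
  fixes Q :: "'a::field poly"
  assumes "irreducible Q" "squarefree_decomposition Q m q"
  shows "m = 1" "q 1 = Q"
proof -
  from assms(2) have m: "m \<ge> 1" and Q: "Q = (\<Prod>i=1..m. q i ^ i)" and deg: "degree (q m) > 0"
    by (auto simp: squarefree_decomposition_def)
  have nu: "\<not> q m dvd 1" using deg by (auto simp: is_unit_poly_iff)
  have "{1..m} = insert m {1..<m}" using m by auto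
  hence "Q = q m ^ m * (\<Prod>i=1..<m. q i ^ i)" unfolding Q by simp
  also have "\<dots> = q m * (q m ^ (m - 1) * (\<Prod>i=1..<m. q i ^ i))"
    using m by (simp add: power_eq_if mult.assoc)
  finally have "is_unit (q m ^ (m - 1) * (\<Prod>i=1..<m. q i ^ i))"
    using irreducibleD[OF assms(1)] nu by blast
  hence "is_unit (q m ^ (m - 1))" by (meson dvd_trans dvd_triv_left)
  hence "m - 1 = 0" using nu by (meson dvd_power dvd_trans gr0I)
  with m show "m = 1" by simp
  with Q show "q 1 = Q" by simp
qed

lemma irreducible_imp_squarefree:
  fixes p :: "'a::field poly"
  assumes "irreducible p" shows "squarefree p"
proof (rule squarefreeI)
  fix x assume "x ^ 2 dvd p"
  then obtain k where "p = x ^ 2 * k" by (rule dvdE)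
  hence "p = x * (x * k)" by (simp add: power2_eq_square mult.assoc)
  with irreducibleD[OF assms] have "is_unit x \<or> is_unit (x * k)" by blast
  thus "is_unit x" by (meson dvd_trans dvd_triv_left)
qed

lemma algebraic_residues_irreducible_iff:
  fixes P Q R :: "'a::field_char_0 poly"
  assumes "irreducible Q"
  shows "algebraic_residues P Q R \<longleftrightarrow> residue_factor P Q Q 1 R"
proof
  assume "algebraic_residues P Q R"
  then obtain m q r where *: "squarefree_decomposition Q m q"
    "\<forall>i\<in>{1..m}. residue_factor P Q (q i) i (r i)" "R = (\<Prod>i=1..m. r i)"
    unfolding algebraic_residues_def by blast
  from squarefree_decomposition_irreducible[OF assms *(1)] * show "residue_factor P Q Q 1 R" by simp
next
  assume R: "residue_factor P Q Q 1 R"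
  have "degree Q \<noteq> 0"
  proof
    assume "degree Q = 0"
    moreover have "Q \<noteq> 0" using assms by auto
    ultimately have "is_unit Q" by (simp add: is_unit_iff_degree)
    with assms show False using irreducible_not_unit by blast
  qed
  hence "squarefree_decomposition Q 1 (\<lambda>_. Q)"
    using irreducible_imp_squarefree[OF assms] by (simp add: squarefree_decomposition_def)
  thus "algebraic_residues P Q R" unfolding algebraic_residues_def using R
    by (intro exI[of _ 1] exI[of _ "\<lambda>_. Q"] exI[of _ "\<lambda>_. R"]) simp
qed

text \<open>A fraction whose denominator has minimal degree is in lowest terms, since a nonconstant
  common divisor could be cancelled. This supplies the \<open>A\<close>, \<open>B\<close> needed for
  the existence of an output.\<close>

lemma coprime_Fract_exists:
  fixes x :: "'a::field poly fract"
  obtains A B where "B \<noteq> 0" "coprime A B" "Fract A B = x"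
proof -
  define n where "n = (LEAST n. \<exists>A B. B \<noteq> 0 \<and> Fract A B = x \<and> degree B = n)"
  have "\<exists>n A B. B \<noteq> 0 \<and> Fract A B = x \<and> degree B = n" by (cases x) auto
  from LeastI_ex[OF this] obtain A B where B: "B \<noteq> 0" "Fract A B = x" "degree B = n"
    unfolding n_def by blast
  have min: "n \<le> degree D" if "D \<noteq> 0" "Fract C D = x" for C D
    unfolding n_def by (rule Least_le) (use that in blast)
  have "coprime A B"
  proof (rule coprimeI)
    fix c assume "c dvd A" "c dvd B"
    then obtain A' B' where *: "A = c * A'" "B = c * B'" by (auto elim!: dvdE)
    with B have c: "c \<noteq> 0" "B' \<noteq> 0" by auto
    have "Fract A' B' = x" using B * c by (auto simp: eq_fract)
    with min c B(3) have "degree B \<le> degree B'" by blast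
    with * c have "degree c = 0" by (simp add: degree_mult_eq)
    with c show "is_unit c" by (simp add: is_unit_iff_degree)
  qed
  with B that show ?thesis by blast
qed

text \<open>The composed sum depends only on the multiset of roots. As these are distinct, two
  enumerations differ by a permutation \<tau> of the indices, and \<tau> permutes the
  \<open>c\<close>-element index sets.\<close>

lemma prod_linear_subset_sums_cong:
  fixes f g :: "nat \<Rightarrow> 'a::idom"
  assumes eq: "(\<Prod>i<d. [:- f i, 1:]) = (\<Prod>i<d. [:- g i, 1:])" and inj: "inj_on g {..<d}"
  shows "inj_on f {..<d}"
    and "(\<Prod>I\<in>{I. I \<subseteq> {..<d} \<and> card I = c}. [:- (\<Sum>i\<in>I. f i), 1:]) =
         (\<Prod>I\<in>{I. I \<subseteq> {..<d} \<and> card I = c}. [:- (\<Sum>i\<in>I. g i), 1:])"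
proof -
  have "f ` {..<d} = {x. poly (\<Prod>i<d. [:- f i, 1:]) x = 0}" using poly_prod_linear_eq_0_iff[of "{..<d}" f] by blast
  also have "\<dots> = g ` {..<d}" unfolding eq using poly_prod_linear_eq_0_iff[of "{..<d}" g] by blast
  finally have img: "f ` {..<d} = g ` {..<d}" .
  hence "card (f ` {..<d}) = card {..<d}" using inj by (simp add: card_image)
  thus injf: "inj_on f {..<d}" by (simp add: eq_card_imp_inj_on)
  define \<tau> where "\<tau> = inv_into {..<d} g \<circ> f"
  have bij: "bij_betw \<tau> {..<d} {..<d}" unfolding \<tau>_def
    using bij_betw_trans[of f "{..<d}" "g ` {..<d}" "inv_into {..<d} g" "{..<d}"] injf inj img
    by (simp add: bij_betw_def inj_on_inv_into)
  have f: "f i = g (\<tau> i)" if "i < d" for i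
    using that img by (simp add: \<tau>_def) (metis f_inv_into_f imageI lessThan_iff)
  let ?S = "{I. I \<subseteq> {..<d} \<and> card I = c}"
  have injS: "inj_on (image \<tau>) ?S"
    by (rule inj_on_subset[OF inj_on_image_Pow[OF bij_betw_imp_inj_on[OF bij]]]) auto
  have sub: "image \<tau> ` ?S \<subseteq> ?S"
  proof clarsimp
    fix I assume "I \<subseteq> {..<d}"
    moreover from this have "inj_on \<tau> I" using bij by (meson bij_betw_imp_inj_on inj_on_subset)
    ultimately show "\<tau> ` I \<subseteq> {..<d} \<and> card (\<tau> ` I) = card I"
      using bij by (auto simp: card_image bij_betw_def)
  qed
  have fin: "finite ?S" by (rule finite_subset[of _ "Pow {..<d}"]) auto
  have bijS: "bij_betw (image \<tau>) ?S ?S"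
    using endo_inj_surj[OF fin sub injS] injS by (simp add: bij_betw_def)
  have "(\<Prod>I\<in>?S. [:- (\<Sum>i\<in>I. f i), 1:]) = (\<Prod>I\<in>?S. [:- (\<Sum>i\<in>\<tau> ` I. g i), 1:])"
  proof (rule prod.cong)
    fix I assume I: "I \<in> ?S"
    hence "inj_on \<tau> I" by (intro inj_on_subset[OF bij_betw_imp_inj_on[OF bij]]) auto
    hence "(\<Sum>i\<in>\<tau> ` I. g i) = (\<Sum>i\<in>I. g (\<tau> i))" by (simp add: sum.reindex)
    also have "\<dots> = (\<Sum>i\<in>I. f i)" by (rule sum.cong) (use I f in auto)
    finally show "[:- (\<Sum>i\<in>I. f i), 1:] = [:- (\<Sum>i\<in>\<tau> ` I. g i), 1:]" by simp
  qed simp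
  also have "\<dots> = (\<Prod>I\<in>?S. [:- (\<Sum>i\<in>I. g i), 1:])"
    by (rule prod.reindex_bij_betw[OF bijS])
  finally show "(\<Prod>I\<in>?S. [:- (\<Sum>i\<in>I. f i), 1:]) = (\<Prod>I\<in>?S. [:- (\<Sum>i\<in>I. g i), 1:])" .
qed

section \<open>Generic polynomials and sums of residues\<close>

text \<open>The splitting field sits inside the field itself: \<phi> embeds the field in such a way
  that the image of \<open>Q\<close> acquires the roots \<rho>, so roots and coefficients share one
  type. The maps \<open>s\<close> take the place of Galois automorphisms over the image of
  \<phi>.\<close>

locale generic_splitting = \<phi>: field_hom \<phi> for \<phi> :: "'l::field_char_0 \<Rightarrow> 'l" +
  fixes d :: nat and \<rho> :: "nat \<Rightarrow> 'l" and Q :: "'l poly"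
  assumes inj_\<rho>: "inj_on \<rho> {..<d}" and degree_Q: "degree Q = d" and d_ge_2: "d \<ge> 2"
    and root: "l < d \<Longrightarrow> poly (map_poly \<phi> Q) (\<rho> l) = 0"
    and symmetry: "\<pi> permutes {..<d} \<Longrightarrow>
      \<exists>s. field_hom s \<and> (\<forall>x. s (\<phi> x) = \<phi> x) \<and> (\<forall>l<d. s (\<rho> l) = \<rho> (\<pi> l))"
begin

sublocale \<phi>p: map_poly_inj_idom_hom \<phi> ..

lemma symmetry_poly:
  assumes s: "field_hom s" "\<And>x. s (\<phi> x) = \<phi> x"
  shows "s (poly (map_poly \<phi> p) x) = poly (map_poly \<phi> p) (s x)"
proof -
  interpret s: field_hom s by fact
  have "map_poly s (map_poly \<phi> p) = map_poly \<phi> p"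
    by (rule poly_eqI) (simp add: s(2))
  thus ?thesis by (metis s.poly_map_poly)
qed

text \<open>If the image of \<open>H\<close> vanishes at one \<open>\<tau> k\<close>, the maps
  \<open>s\<close> spread the zero to all of \<open>J\<close>, so \<open>degree H\<close> is at
  least \<open>card J\<close>. In a factorization of \<open>T\<close>, a factor vanishing at some
  \<open>\<tau> k\<close> therefore has the full degree, and the other one is constant.\<close>

lemma irreducible_orbit:
  assumes T: "map_poly \<phi> T = smult c (\<Prod>k\<in>J. [:- \<tau> k, 1:])" and c: "c \<noteq> 0"
    and J: "finite J" "J \<noteq> {}" and inj: "inj_on \<tau> J"
    and trans: "\<And>k l. k \<in> J \<Longrightarrow> l \<in> J \<Longrightarrow>
      \<exists>s. field_hom s \<and> (\<forall>x. s (\<phi> x) = \<phi> x) \<and> s (\<tau> k) = \<tau> l"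
  shows "irreducible T"
proof -
  have "degree (map_poly \<phi> T) = card J" using c unfolding T degree_smult_eq degree_prod_linear by simp
  hence degT: "degree T = card J" by simp
  have "card J > 0" using J by (simp add: card_gt_0_iff)
  have key: "card J \<le> degree H" if "H \<noteq> 0" "k \<in> J" "poly (map_poly \<phi> H) (\<tau> k) = 0" for H k
  proof -
    have "poly (map_poly \<phi> H) (\<tau> l) = 0" if l: "l \<in> J" for l
    proof -
      obtain s where s: "field_hom s" "\<forall>x. s (\<phi> x) = \<phi> x" "s (\<tau> k) = \<tau> l"
        using trans \<open>k \<in> J\<close> l by blast
      interpret s: field_hom s by fact
      have "poly (map_poly \<phi> H) (s (\<tau> k)) = s (poly (map_poly \<phi> H) (\<tau> k))"
        using symmetry_poly[OF s(1)] s(2) by simp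
      thus ?thesis using \<open>poly (map_poly \<phi> H) (\<tau> k) = 0\<close> s by simp
    qed
    hence "\<tau> ` J \<subseteq> {x. poly (map_poly \<phi> H) x = 0}" by auto
    hence "card (\<tau> ` J) \<le> card {x. poly (map_poly \<phi> H) x = 0}"
      by (rule card_mono[rotated]) (use that in \<open>simp add: poly_roots_finite\<close>)
    also have "\<dots> \<le> degree (map_poly \<phi> H)" using that by (intro card_poly_roots_bound) simp
    finally show ?thesis using inj by (simp add: card_image)
  qed
  show ?thesis
  proof (rule irreducibleI)
    show T0: "T \<noteq> 0" using degT \<open>card J > 0\<close> by auto
    show "\<not> is_unit T" using T0 degT \<open>card J > 0\<close> by (simp add: is_unit_iff_degree)
    fix F G assume FG: "T = F * G"
    with T0 have nz: "F \<noteq> 0" "G \<noteq> 0" by auto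
    have deg: "degree F + degree G = card J" using nz degT by (simp add: FG degree_mult_eq)
    obtain k where k: "k \<in> J" using J by auto
    have "poly (map_poly \<phi> T) (\<tau> k) = 0" using k J by (auto simp: T poly_prod)
    hence "poly (map_poly \<phi> F) (\<tau> k) = 0 \<or> poly (map_poly \<phi> G) (\<tau> k) = 0"
      by (simp add: FG \<phi>p.hom_mult)
    hence "degree F = 0 \<or> degree G = 0" using key[OF _ k] nz deg by force
    thus "is_unit F \<or> is_unit G" using nz by (simp add: is_unit_iff_degree)
  qed
qed

section \<open>The polynomial Q as the minimal polynomial of each of its roots\<close>

lemma Q_nonzero: "Q \<noteq> 0" using degree_Q d_ge_2 by auto

lemma map_Q: "map_poly \<phi> Q = smult (\<phi> (lead_coeff Q)) (\<Prod>l<d. [:- \<rho> l, 1:])"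
  using distinct_roots_factorization[OF inj_\<rho> root] degree_Q by simp

lemma transposition_symmetry:
  assumes "a < d" "b < d"
  obtains s where "field_hom s" "\<And>x. s (\<phi> x) = \<phi> x"
    "\<And>l. l < d \<Longrightarrow> s (\<rho> l) = \<rho> (transpose a b l)"
  using symmetry[of "transpose a b"] assms permutes_swap_id[of a "{..<d}" b] by auto

lemma irreducible_Q: "irreducible Q"
proof (rule irreducible_orbit[OF map_Q])
  show "\<phi> (lead_coeff Q) \<noteq> 0" using Q_nonzero by simp
  show "{..<d} \<noteq> {}" using d_ge_2 by (auto simp: lessThan_empty_iff)
  fix k l assume "k \<in> {..<d}" "l \<in> {..<d}"
  thus "\<exists>s. field_hom s \<and> (\<forall>x. s (\<phi> x) = \<phi> x) \<and> s (\<rho> k) = \<rho> l"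
    using transposition_symmetry[of k l] by (metis lessThan_iff transpose_apply_first)
qed (use inj_\<rho> in auto)

lemma pderiv_root_nonzero:
  assumes "l < d" shows "poly (map_poly \<phi> (pderiv Q)) (\<rho> l) \<noteq> 0"
proof -
  let ?R = "\<Prod>k\<in>{..<d} - {l}. [:- \<rho> k, 1:]"
  have "map_poly \<phi> Q = smult (\<phi> (lead_coeff Q)) ([:- \<rho> l, 1:] * ?R)"
    unfolding map_Q using assms by (subst prod.remove[of _ l]) auto
  hence "map_poly \<phi> (pderiv Q) = smult (\<phi> (lead_coeff Q)) (pderiv ([:- \<rho> l, 1:] * ?R))"
    by (simp only: \<phi>.map_poly_pderiv pderiv_smult)
  hence "poly (map_poly \<phi> (pderiv Q)) (\<rho> l) = \<phi> (lead_coeff Q) * poly ?R (\<rho> l)"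
    by (simp only: pderiv_mult poly_smult poly_add poly_mult) (simp add: pderiv_pCons)
  moreover have "\<rho> l \<notin> \<rho> ` ({..<d} - {l})" using inj_\<rho> assms by (auto simp: inj_on_def)
  hence "poly ?R (\<rho> l) \<noteq> 0" by (subst poly_prod_linear_eq_0_iff) auto
  ultimately show ?thesis using Q_nonzero by simp
qed

text \<open>The remainder modulo \<open>Q\<close> vanishes at one root, hence by symmetry at all
  \<open>d\<close> of them, which is too many for its degree.\<close>

lemma dvd_of_root:
  assumes "l < d" "poly (map_poly \<phi> f) (\<rho> l) = 0"
  shows "Q dvd f"
proof -
  have "map_poly \<phi> f = map_poly \<phi> (f div Q * Q + f mod Q)" by simp
  also have "\<dots> = map_poly \<phi> (f div Q) * map_poly \<phi> Q + map_poly \<phi> (f mod Q)"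
    by (simp only: \<phi>p.hom_mult \<phi>p.hom_add)
  finally have *: "poly (map_poly \<phi> (f mod Q)) (\<rho> k) = poly (map_poly \<phi> f) (\<rho> k)" if "k < d" for k
    using root[OF that] by simp
  have "poly (map_poly \<phi> (f mod Q)) (\<rho> k) = 0" if k: "k < d" for k
  proof -
    obtain s where s: "field_hom s" "\<And>x. s (\<phi> x) = \<phi> x" "\<And>i. i < d \<Longrightarrow> s (\<rho> i) = \<rho> (transpose l k i)"
      using transposition_symmetry assms(1) k by blast
    interpret s: field_hom s by fact
    have "poly (map_poly \<phi> (f mod Q)) (\<rho> k) = s (poly (map_poly \<phi> (f mod Q)) (\<rho> l))"
      using symmetry_poly[of s] s assms(1) by simp
    thus ?thesis using * assms by simp
  qed
  moreover have "degree (f mod Q) < d" using degree_mod_less[of Q f] Q_nonzero degree_Q d_ge_2 by auto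
  ultimately have "map_poly \<phi> (f mod Q) = 0"
    using distinct_roots_imp_0[OF inj_\<rho>, of "map_poly \<phi> (f mod Q)"] by (simp only: \<phi>.degree_map_poly_hom)
  hence "f mod Q = 0" by simp
  thus ?thesis by (simp add: mod_eq_0_iff_dvd)
qed

section \<open>Residues at the roots and their sums over index sets\<close>

context
  fixes P :: "'l poly"
  assumes P: "P \<noteq> 0" "degree P + 2 \<le> d"
begin

definition residue_value :: "nat \<Rightarrow> 'l" where
  "residue_value l = poly (map_poly \<phi> P) (\<rho> l) / poly (map_poly \<phi> (pderiv Q)) (\<rho> l)"

lemma symmetry_residue_value:
  assumes "field_hom s" "\<And>x. s (\<phi> x) = \<phi> x" "s (\<rho> k) = \<rho> l"
  shows "s (residue_value k) = residue_value l"
proof -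
  interpret s: field_hom s by fact
  show ?thesis unfolding residue_value_def s.hom_div using symmetry_poly[OF assms(1,2)] assms(3) by simp
qed

text \<open>If all residues were \<open>r\<close>, then \<open>P - r Q'\<close>, taken after \<phi>,
  would have \<open>d\<close> roots and degree below \<open>d\<close>, hence vanish. Its coefficient
  of index \<open>d - 1\<close> comes from \<open>Q'\<close> alone, since \<open>P\<close> has
  degree at most \<open>d - 2\<close>; this gives \<open>r = 0\<close> and then
  \<open>P = 0\<close>.\<close>

lemma residue_value_not_constant: "\<not> (\<forall>l<d. residue_value l = r)"
proof
  assume r: "\<forall>l<d. residue_value l = r"
  define F where "F = map_poly \<phi> P - smult r (map_poly \<phi> (pderiv Q))"
  have "poly F (\<rho> l) = 0" if "l < d" for l
    using r that pderiv_root_nonzero[OF that] by (auto simp: F_def residue_value_def field_simps)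
  moreover have "degree F \<le> d - 1" unfolding F_def
    by (intro degree_diff_le order_trans[OF degree_smult_le]) (use P degree_Q in \<open>auto simp: degree_pderiv\<close>)
  ultimately have F: "F = 0" using distinct_roots_imp_0[OF inj_\<rho>, of F] d_ge_2 by auto
  have "coeff F (d - 1) = - r * \<phi> (of_nat d * lead_coeff Q)"
    using P d_ge_2 degree_Q by (auto simp: F_def coeff_pderiv coeff_eq_0)
  moreover have "\<phi> (of_nat d * lead_coeff Q) \<noteq> 0" using Q_nonzero d_ge_2 by simp
  ultimately have "r = 0" using F by simp
  hence "map_poly \<phi> P = 0" using F by (simp add: F_def)
  with P show False by simp
qed

lemma residue_value_inj: 
  assumes "a < d" "b < d" "residue_value a = residue_value b" shows "a = b"
proof (rule ccontr)
  assume ab: "a \<noteq> b"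
  have "residue_value l = residue_value a" if l: "l < d" for l
  proof (cases "l = a")
    case False
    \<comment> \<open>The transposition of \<open>b\<close> and \<open>l\<close> moves the residue
      of \<open>b\<close> to that of \<open>l\<close> and leaves the residue of \<open>a\<close> in
      place.\<close>
    obtain s where s: "field_hom s" "\<And>x. s (\<phi> x) = \<phi> x" "\<And>i. i < d \<Longrightarrow> s (\<rho> i) = \<rho> (transpose b l i)"
      using transposition_symmetry assms(2) l by blast
    have "s (residue_value a) = residue_value a" "s (residue_value b) = residue_value l"
      by (rule symmetry_residue_value[OF s(1,2)], use s(3) assms ab False in simp)+
    with assms(3) show ?thesis by simp
  qed simp
  thus False using residue_value_not_constant by blast
qed

lemma residue_value_sums_inj:
  "inj_on (\<lambda>I. \<Sum>i\<in>I. residue_value i) {I. I \<subseteq> {..<d} \<and> card I = c}"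
proof (rule inj_onI, rule ccontr)
  fix I J assume IJ: "I \<in> {I. I \<subseteq> {..<d} \<and> card I = c}" "J \<in> {I. I \<subseteq> {..<d} \<and> card I = c}"
    and eq: "(\<Sum>i\<in>I. residue_value i) = (\<Sum>i\<in>J. residue_value i)" and neq: "I \<noteq> J"
  have fin: "finite I" "finite J" using IJ finite_subset by blast+
  have "\<not> I \<subseteq> J" "\<not> J \<subseteq> I" using IJ neq fin by (auto dest: card_subset_eq)
  then obtain a b where ab: "a \<in> I" "a \<notin> J" "b \<in> J" "b \<notin> I" by blast
  hence abd: "a < d" "b < d" using IJ by auto
  obtain s where s: "field_hom s" "\<And>x. s (\<phi> x) = \<phi> x" "\<And>i. i < d \<Longrightarrow> s (\<rho> i) = \<rho> (transpose a b i)"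
    using transposition_symmetry abd by blast
  interpret s: field_hom s by fact
  let ?r = residue_value
  have *: "s (\<Sum>i\<in>K. ?r i) = (\<Sum>i\<in>K. ?r (transpose a b i))" if "K \<subseteq> {..<d}" for K
    unfolding s.hom_sum by (rule sum.cong) (use that s(3) in \<open>auto intro!: symmetry_residue_value[OF s(1,2)]\<close>)
  have fixd: "?r (transpose a b i) = ?r i" if "i \<noteq> a" "i \<noteq> b" for i using that by simp
  have I: "(\<Sum>i\<in>I. ?r (transpose a b i)) = ?r b + (\<Sum>i\<in>I - {a}. ?r i)"
    using ab fin by (subst sum.remove[of _ a]) (auto intro!: sum.cong fixd)
  have J: "(\<Sum>i\<in>J. ?r (transpose a b i)) = ?r a + (\<Sum>i\<in>J - {b}. ?r i)"
    using ab fin by (subst sum.remove[of _ b]) (auto intro!: sum.cong fixd)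
  have "?r b + (\<Sum>i\<in>I - {a}. ?r i) = ?r a + (\<Sum>i\<in>J - {b}. ?r i)"
    using * eq IJ I J by (metis (no_types, lifting) mem_Collect_eq)
  moreover have "?r a + (\<Sum>i\<in>I - {a}. ?r i) = ?r b + (\<Sum>i\<in>J - {b}. ?r i)"
    using eq sum.remove[OF fin(1) ab(1), of ?r] sum.remove[OF fin(2) ab(3), of ?r] by (simp only:)
  \<comment> \<open>Subtraction cancels the remaining sums over \<open>I - {a}\<close> and
    \<open>J - {b}\<close>; what is left says that twice \<open>?r b - ?r a\<close> vanishes, and
    \<open>2\<close> is invertible in characteristic 0.\<close>
  ultimately have "?r b - ?r a = ?r a - ?r b" by (metis add_diff_cancel_right)
  hence "2 * ?r a = 2 * ?r b" by (simp add: algebra_simps)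
  hence "a = b" using residue_value_inj abd by simp
  with ab show False by blast
qed

text \<open>The algorithm works with \<open>A/B\<close>, the reduced form of \<open>P/Q'\<close>.
  \<open>B\<close> vanishes at no root: otherwise \<open>A Q' = P B\<close> would make
  \<open>A\<close> vanish there too, and \<open>Q\<close> would divide both. So the values of
  \<open>A/B\<close> at the roots are the residues, and the resultant may be computed after applying
  \<phi>.\<close>

lemma map_residue_resultant:
  assumes "residue_factor P Q Q 1 R"
  obtains c where "c \<noteq> 0" "map_poly \<phi> R = smult c (\<Prod>l<d. [:- residue_value l, 1:])"
proof -
  have pd: "pderiv Q \<noteq> 0" using degree_Q d_ge_2 by (simp add: pderiv_eq_0_iff)
  obtain A B where AB: "B \<noteq> 0" "coprime A B" "Fract A B = Fract P (pderiv Q)" "R = residue_resultant A B Q"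
    using assms degree_Q d_ge_2 residue_series_nth_0[OF Q_nonzero pd, of P]
    by (auto simp: residue_factor_def)
  have eq: "A * pderiv Q = P * B" using AB pd by (simp add: eq_fract)
  hence eq': "poly (map_poly \<phi> A) x * poly (map_poly \<phi> (pderiv Q)) x = poly (map_poly \<phi> P) x * poly (map_poly \<phi> B) x" for x
    by (metis \<phi>p.hom_mult poly_mult)
  have Bnz: "poly (map_poly \<phi> B) (\<rho> l) \<noteq> 0" if "l < d" for l
  proof
    assume B0: "poly (map_poly \<phi> B) (\<rho> l) = 0"
    hence "poly (map_poly \<phi> A) (\<rho> l) = 0" using eq'[of "\<rho> l"] pderiv_root_nonzero[OF that] by simp
    hence "Q dvd A" "Q dvd B" using dvd_of_root[OF that] B0 by auto
    hence "is_unit Q" using AB(2) coprime_common_divisor by blast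
    with irreducible_Q show False using irreducible_not_unit by blast
  qed
  have val: "poly (map_poly \<phi> A) (\<rho> l) / poly (map_poly \<phi> B) (\<rho> l) = residue_value l" if "l < d" for l
    using eq'[of "\<rho> l"] Bnz[OF that] pderiv_root_nonzero[OF that] by (simp add: residue_value_def field_simps)
  have R: "map_poly \<phi> R = residue_resultant (map_poly \<phi> A) (map_poly \<phi> B) (map_poly \<phi> Q)"
  proof -
    interpret pp: map_poly_inj_comm_ring_hom "map_poly \<phi>" ..
    have lift: "map_poly (map_poly \<phi>) (map_poly (\<lambda>c. [:c:]) p) = map_poly (\<lambda>c. [:c:]) (map_poly \<phi> p)" for p
      by (rule poly_eqI) (simp add: coeff_map_poly \<phi>.map_poly_pCons_hom)
    have "map_poly \<phi> R = resultant
       (map_poly (map_poly \<phi>) (map_poly (\<lambda>c. [:c:]) A - smult [:0, 1:] (map_poly (\<lambda>c. [:c:]) B)))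
       (map_poly (map_poly \<phi>) (map_poly (\<lambda>c. [:c:]) Q))"
      unfolding AB(4) residue_resultant_def Let_def by (rule \<phi>p.resultant_hom[symmetric])
    thus ?thesis
      by (simp add: residue_resultant_def Let_def pp.hom_minus \<phi>p.map_poly_hom_smult lift \<phi>.map_poly_pCons_hom)
  qed
  have "inj_on (\<lambda>l. poly (map_poly \<phi> A) (\<rho> l) / poly (map_poly \<phi> B) (\<rho> l)) {..<d}"
    by (rule inj_onI) (use val residue_value_inj in auto)
  then obtain c where c: "c \<noteq> 0" "map_poly \<phi> R = smult c (\<Prod>l<d.
      [:- (poly (map_poly \<phi> A) (\<rho> l) / poly (map_poly \<phi> B) (\<rho> l)), 1:])"
    using d_ge_2 degree_Q
      residue_resultant_distinct[of "map_poly \<phi> Q" d \<rho> "map_poly \<phi> B" "map_poly \<phi> A"] inj_\<rho> root Bnz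
    unfolding R by auto
  moreover have "(\<Prod>l<d. [:- (poly (map_poly \<phi> A) (\<rho> l) / poly (map_poly \<phi> B) (\<rho> l)), 1:]) =
      (\<Prod>l<d. [:- residue_value l, 1:])" by (rule prod.cong) (use val in auto)
  ultimately show ?thesis using that by simp
qed

text \<open>A bijection from \<open>I\<close> to \<open>J\<close> and one between the complements
  glue to a permutation of all indices.\<close>

lemma subset_symmetry:
  assumes "I \<subseteq> {..<d}" "J \<subseteq> {..<d}" "card I = card J"
  obtains s where "field_hom s" "\<And>x. s (\<phi> x) = \<phi> x"
    "s (\<Sum>i\<in>I. residue_value i) = (\<Sum>i\<in>J. residue_value i)"
proof -
  have fin: "finite I" "finite J" using assms finite_subset by blast+
  obtain f where f: "bij_betw f I J" using fin assms(3) finite_same_card_bij by blast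
  have "card ({..<d} - I) = card ({..<d} - J)" using assms fin by (simp add: card_Diff_subset)
  from finite_same_card_bij[OF _ _ this]
  obtain g where g: "bij_betw g ({..<d} - I) ({..<d} - J)" by auto
  define \<pi> where "\<pi> x = (if x \<in> I then f x else if x \<in> {..<d} - I then g x else x)" for x
  have "bij_betw \<pi> I J" using f by (subst bij_betw_cong[of _ _ f]) (simp_all add: \<pi>_def)
  moreover have "bij_betw \<pi> ({..<d} - I) ({..<d} - J)"
    using g by (subst bij_betw_cong[of _ _ g]) (simp_all add: \<pi>_def)
  ultimately have "bij_betw \<pi> (I \<union> ({..<d} - I)) (J \<union> ({..<d} - J))"
    by (rule bij_betw_combine) auto
  hence "bij_betw \<pi> {..<d} {..<d}" using assms by (simp add: Un_absorb1)
  moreover have "\<pi> x = x" if "x \<notin> {..<d}" for x using that assms by (auto simp: \<pi>_def)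
  ultimately have "\<pi> permutes {..<d}" by (rule bij_imp_permutes)
  then obtain s where s: "field_hom s" "\<forall>x. s (\<phi> x) = \<phi> x" "\<forall>l<d. s (\<rho> l) = \<rho> (\<pi> l)"
    using symmetry by blast
  interpret s: field_hom s by fact
  have "s (\<Sum>i\<in>I. residue_value i) = (\<Sum>i\<in>I. residue_value (\<pi> i))" unfolding s.hom_sum
    by (rule sum.cong) (use assms s in \<open>auto intro!: symmetry_residue_value\<close>)
  also have "\<dots> = (\<Sum>i\<in>J. residue_value i)"
    using \<open>bij_betw \<pi> I J\<close> by (rule sum.reindex_bij_betw)
  finally show ?thesis using that s by blast
qed

context
  fixes R :: "'l poly" and k :: 'l
  assumes k: "k \<noteq> 0" and R: "map_poly \<phi> R = smult k (\<Prod>l<d. [:- residue_value l, 1:])"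
begin

lemma degree_R: "degree R = d"
proof -
  have "degree (map_poly \<phi> R) = d" using k unfolding R degree_smult_eq degree_prod_linear by simp
  thus ?thesis by simp
qed

text \<open>\<alpha> enumerates the roots of \<open>R\<close> in arbitrary order, so only the
  products can be compared: \<Theta> maps the roots of \<open>R\<close> to the roots of its image
  under \<phi>, which are the residues.\<close>

lemma roots_R_transfer:
  assumes \<alpha>: "map_poly to_ac R = smult (to_ac (lead_coeff R)) (\<Prod>i<d. [:- \<alpha> i, 1:])"
    and \<Theta>: "field_hom \<Theta>" "\<And>x. \<Theta> (to_ac x) = to_ac (\<phi> x)"
  shows "(\<Prod>i<d. [:- \<Theta> (\<alpha> i), 1:]) = (\<Prod>i<d. [:- to_ac (residue_value i), 1:])"
proof -
  interpret \<Theta>: field_hom \<Theta> by fact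
  interpret ac: field_hom "to_ac :: 'l \<Rightarrow> _" by (rule to_ac_hom)
  interpret \<Theta>p: map_poly_inj_idom_hom \<Theta> ..
  interpret acp: map_poly_inj_idom_hom "to_ac :: 'l \<Rightarrow> _" ..
  have "map_poly \<Theta> (map_poly to_ac R) = map_poly to_ac (map_poly \<phi> R)"
    by (rule poly_eqI) (simp add: \<Theta>(2))
  hence "smult (to_ac (\<phi> (lead_coeff R))) (\<Prod>i<d. [:- \<Theta> (\<alpha> i), 1:]) =
      smult (to_ac k) (\<Prod>i<d. [:- to_ac (residue_value i), 1:])"
    by (simp add: \<alpha> R \<Theta>p.hom_prod acp.hom_prod \<Theta>.map_poly_hom_smult ac.map_poly_hom_smult
      \<Theta>.map_poly_pCons_hom ac.map_poly_pCons_hom \<Theta>(2) \<Theta>.hom_uminus)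
  moreover have "\<phi> (lead_coeff R) = k"
  proof -
    have "lead_coeff (map_poly \<phi> R) = k" unfolding R by (simp add: lead_coeff_prod)
    thus ?thesis by simp
  qed
  ultimately show ?thesis using k by (simp add: smult_eq_iff)
qed

lemma to_ac_\<phi>_hom: "field_hom (\<lambda>x. to_ac (\<phi> x))"
  by unfold_locales (auto simp: \<phi>.hom_add \<phi>.hom_mult)

lemma \<phi>_extension_exists: obtains \<Theta> :: "'l alg_closure \<Rightarrow> 'l alg_closure"
  where "field_hom \<Theta>" "\<And>x. \<Theta> (to_ac x) = to_ac (\<phi> x)"
  using alg_closure_hom_extension[OF to_ac_\<phi>_hom partial_hom_range[OF to_ac_\<phi>_hom]] by metis

lemma inj_to_ac_residue: "inj_on (\<lambda>i. to_ac (residue_value i)) {..<d}"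
  by (rule inj_onI) (use residue_value_inj in auto)

lemma map_composed_sum:
  assumes "pure_composed_sum c R S"
  shows "map_poly \<phi> S = (\<Prod>I\<in>{I. I \<subseteq> {..<d} \<and> card I = c}. [:- (\<Sum>i\<in>I. residue_value i), 1:])"
proof -
  obtain \<alpha> where \<alpha>: "map_poly to_ac R = smult (to_ac (lead_coeff R)) (\<Prod>i<d. [:- \<alpha> i, 1:])"
    and S: "map_poly to_ac S = (\<Prod>I\<in>{I. I \<subseteq> {..<d} \<and> card I = c}. [:- (\<Sum>i\<in>I. \<alpha> i), 1:])"
    using assms unfolding pure_composed_sum_def degree_R by blast
  obtain \<Theta> :: "'l alg_closure \<Rightarrow> 'l alg_closure"
    where \<Theta>: "field_hom \<Theta>" "\<And>x. \<Theta> (to_ac x) = to_ac (\<phi> x)" using \<phi>_extension_exists by blast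
  interpret \<Theta>: field_hom \<Theta> by fact
  interpret ac: field_hom "to_ac :: 'l \<Rightarrow> _" by (rule to_ac_hom)
  interpret \<Theta>p: map_poly_inj_idom_hom \<Theta> ..
  interpret acp: map_poly_inj_idom_hom "to_ac :: 'l \<Rightarrow> _" ..
  let ?S = "{I. I \<subseteq> {..<d} \<and> card I = c}"
  have "map_poly to_ac (map_poly \<phi> S) = map_poly \<Theta> (map_poly to_ac S)"
    by (rule poly_eqI) (simp add: \<Theta>(2))
  also have "\<dots> = (\<Prod>I\<in>?S. [:- (\<Sum>i\<in>I. \<Theta> (\<alpha> i)), 1:])"
    by (simp add: S \<Theta>p.hom_prod \<Theta>.map_poly_pCons_hom \<Theta>.hom_uminus \<Theta>.hom_sum)
  also have "\<dots> = (\<Prod>I\<in>?S. [:- (\<Sum>i\<in>I. to_ac (residue_value i)), 1:])"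
    by (rule prod_linear_subset_sums_cong(2)[OF roots_R_transfer[OF \<alpha> \<Theta>] inj_to_ac_residue])
  also have "\<dots> = map_poly to_ac (\<Prod>I\<in>?S. [:- (\<Sum>i\<in>I. residue_value i), 1:])"
    by (simp add: acp.hom_prod ac.map_poly_pCons_hom to_ac_sum)
  finally show ?thesis by simp
qed

lemma irreducible_composed_sum:
  assumes "pure_composed_sum c R S" "c \<le> d"
  shows "irreducible S" "degree S = d choose c"
proof -
  let ?S = "{I. I \<subseteq> {..<d} \<and> card I = c}"
  note S = map_composed_sum[OF assms(1)]
  have "degree (map_poly \<phi> S) = card ?S" unfolding S by (rule degree_prod_linear)
  also have "\<dots> = d choose c" using n_subsets[of "{..<d}" c] by simp
  finally show "degree S = d choose c" by simp
  show "irreducible S"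
  proof (rule irreducible_orbit)
    show "map_poly \<phi> S = smult 1 (\<Prod>I\<in>?S. [:- (\<Sum>i\<in>I. residue_value i), 1:])" by (simp add: S)
    show "finite ?S" by (rule finite_subset[of _ "Pow {..<d}"]) auto
    show "?S \<noteq> {}" using assms(2) by (auto intro!: exI[of _ "{..<c}"])
    fix I J assume "I \<in> ?S" "J \<in> ?S"
    thus "\<exists>s. field_hom s \<and> (\<forall>x. s (\<phi> x) = \<phi> x) \<and>
        s (\<Sum>i\<in>I. residue_value i) = (\<Sum>i\<in>J. residue_value i)"
      by (elim CollectE conjE subset_symmetry[of I J]) auto
  qed (use residue_value_sums_inj in auto)
qed

text \<open>The product over index sets is formed in the closure. A homomorphism of the closure over
  the base permutes the roots of \<open>R\<close>, hence fixes this product, so its coefficients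
  belong to the base field.\<close>

lemma composed_sum_exists: "\<exists>S. pure_composed_sum c R S"
proof -
  interpret ac: field_hom "to_ac :: 'l \<Rightarrow> _" by (rule to_ac_hom)
  have "R \<noteq> 0" using degree_R d_ge_2 by auto
  hence "map_poly to_ac R \<noteq> 0" by (simp add: poly_eq_iff)
  then obtain \<alpha> where "map_poly to_ac R = smult (lead_coeff (map_poly to_ac R))
      (\<Prod>i<degree (map_poly to_ac R). [:- \<alpha> i, 1:])"
    by (rule alg_closed_linear_factors)
  hence \<alpha>: "map_poly to_ac R = smult (to_ac (lead_coeff R)) (\<Prod>i<d. [:- \<alpha> i, 1:])"
    by (simp only: ac.degree_map_poly_hom ac.coeff_map_poly_hom degree_R)
  \<comment> \<open>The roots of \<open>R\<close> are distinct because their images under an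
    extension of \<phi> are the distinct residues.\<close>
  have inj: "inj_on \<alpha> {..<d}"
  proof -
    obtain \<Theta> :: "'l alg_closure \<Rightarrow> 'l alg_closure"
      where \<Theta>: "field_hom \<Theta>" "\<And>x. \<Theta> (to_ac x) = to_ac (\<phi> x)" using \<phi>_extension_exists by blast
    from prod_linear_subset_sums_cong(1)[OF roots_R_transfer[OF \<alpha> \<Theta>] inj_to_ac_residue]
    show ?thesis by (auto simp: inj_on_def)
  qed
  define T where "T = (\<Prod>I\<in>{I. I \<subseteq> {..<d} \<and> card I = c}. [:- (\<Sum>i\<in>I. \<alpha> i), 1:])"
  have "coeff T n \<in> range to_ac" for n
  proof (rule alg_closure_fixed_imp_base)
    fix \<Theta> :: "'l alg_closure \<Rightarrow> 'l alg_closure"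
    assume \<Theta>: "field_hom \<Theta>" "\<And>x. \<Theta> (to_ac x) = to_ac x"
    interpret \<Theta>: field_hom \<Theta> by fact
    interpret \<Theta>p: map_poly_inj_idom_hom \<Theta> ..
    have "map_poly \<Theta> (map_poly to_ac R) = map_poly to_ac R"
      by (rule poly_eqI) (simp add: \<Theta>(2))
    hence "smult (to_ac (lead_coeff R)) (\<Prod>i<d. [:- \<Theta> (\<alpha> i), 1:]) =
        smult (to_ac (lead_coeff R)) (\<Prod>i<d. [:- \<alpha> i, 1:])"
      by (simp add: \<alpha> \<Theta>p.hom_prod \<Theta>.map_poly_hom_smult \<Theta>.map_poly_pCons_hom \<Theta>(2) \<Theta>.hom_uminus)
    hence "(\<Prod>i<d. [:- \<Theta> (\<alpha> i), 1:]) = (\<Prod>i<d. [:- \<alpha> i, 1:])"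
      using \<open>R \<noteq> 0\<close> by (simp add: smult_eq_iff)
    from prod_linear_subset_sums_cong(2)[OF this inj, of c]
    have "map_poly \<Theta> T = T"
      by (simp add: T_def \<Theta>p.hom_prod \<Theta>.map_poly_pCons_hom \<Theta>.hom_uminus \<Theta>.hom_sum)
    thus "\<Theta> (coeff T n) = coeff T n" by (metis \<Theta>.coeff_map_poly_hom)
  qed
  hence "map_poly to_ac (map_poly of_ac T) = T"
    by (intro poly_eqI) (simp add: coeff_map_poly to_ac_of_ac)
  thus ?thesis unfolding pure_composed_sum_def T_def
    by (intro exI conjI) (use \<alpha> in \<open>simp_all add: degree_R\<close>)
qed

end

theorem composed_residue_sum_irreducible:
  assumes "algebraic_residues P Q R" "pure_composed_sum c R S" "c \<le> d"
  shows "irreducible S" "degree S = d choose c"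
proof -
  have "residue_factor P Q Q 1 R"
    using assms(1) algebraic_residues_irreducible_iff[OF irreducible_Q] by simp
  then obtain k where k: "k \<noteq> 0" "map_poly \<phi> R = smult k (\<Prod>l<d. [:- residue_value l, 1:])"
    by (rule map_residue_resultant)
  from irreducible_composed_sum[OF k assms(2,3)] show "irreducible S" "degree S = d choose c" .
qed

theorem composed_residue_sum_exists: "\<exists>R S. algebraic_residues P Q R \<and> pure_composed_sum c R S"
proof -
  obtain A B where "B \<noteq> 0" "coprime A B" "Fract A B = fps_nth (residue_series P Q Q 1) 0"
    by (rule coprime_Fract_exists)
  hence rf: "residue_factor P Q Q 1 (residue_resultant A B Q)"
    using degree_Q d_ge_2 by (auto simp: residue_factor_def)
  then obtain k where "k \<noteq> 0" "map_poly \<phi> (residue_resultant A B Q) = smult k (\<Prod>l<d. [:- residue_value l, 1:])"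
    by (rule map_residue_resultant)
  from composed_sum_exists[OF this] rf show ?thesis
    using algebraic_residues_irreducible_iff[OF irreducible_Q] by blast
qed

end

end

section \<open>Polynomial rings and their fields of fractions\<close>

type_synonym 'v rat_mpoly = "('v \<Rightarrow>\<^sub>0 nat) \<Rightarrow>\<^sub>0 rat"

definition mpoly_var :: "'v \<Rightarrow> 'v rat_mpoly" where
  "mpoly_var w = Poly_Mapping.single (Poly_Mapping.single w 1) 1"

definition mpoly_const :: "rat \<Rightarrow> 'v rat_mpoly" where
  "mpoly_const a = Poly_Mapping.single 0 a"

definition monom_eval :: "('v \<Rightarrow> 'r::comm_ring_1) \<Rightarrow> ('v \<Rightarrow>\<^sub>0 nat) \<Rightarrow> 'r" where
  "monom_eval g m = (\<Prod>w\<in>Poly_Mapping.keys m. g w ^ Poly_Mapping.lookup m w)"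

definition mpoly_eval :: "(rat \<Rightarrow> 'r::comm_ring_1) \<Rightarrow> ('v \<Rightarrow> 'r) \<Rightarrow> 'v rat_mpoly \<Rightarrow> 'r" where
  "mpoly_eval c g p = (\<Sum>m\<in>Poly_Mapping.keys p. c (Poly_Mapping.lookup p m) * monom_eval g m)"

lemma poly_mapping_sum_singles:
  "(\<Sum>m\<in>Poly_Mapping.keys p. Poly_Mapping.single m (Poly_Mapping.lookup p m)) = p"
proof (rule poly_mapping_eqI)
  fix k
  have "(\<Sum>m\<in>Poly_Mapping.keys p. (Poly_Mapping.lookup p m when m = k)) =
      (\<Sum>m\<in>Poly_Mapping.keys p. if m = k then Poly_Mapping.lookup p k else 0)"
    by (rule sum.cong) (auto simp: when_def)
  thus "Poly_Mapping.lookup (\<Sum>m\<in>Poly_Mapping.keys p. Poly_Mapping.single m (Poly_Mapping.lookup p m)) k =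
      Poly_Mapping.lookup p k"
    by (simp add: lookup_sum lookup_single in_keys_iff)
qed

lemma monom_eval_superset:
  assumes "finite S" "Poly_Mapping.keys m \<subseteq> S"
  shows "monom_eval g m = (\<Prod>w\<in>S. g w ^ Poly_Mapping.lookup m w)"
  unfolding monom_eval_def
  by (rule prod.mono_neutral_left) (use assms in \<open>auto simp: in_keys_iff\<close>)

lemma monom_eval_add: "monom_eval g (m + n) = monom_eval g m * monom_eval g n"
proof -
  let ?S = "Poly_Mapping.keys m \<union> Poly_Mapping.keys n"
  have "monom_eval g (m + n) = (\<Prod>w\<in>?S. g w ^ Poly_Mapping.lookup (m + n) w)"
    by (rule monom_eval_superset) (use Poly_Mapping.keys_add[of m n] in auto)
  also have "\<dots> = (\<Prod>w\<in>?S. g w ^ Poly_Mapping.lookup m w) * (\<Prod>w\<in>?S. g w ^ Poly_Mapping.lookup n w)"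
    by (simp add: lookup_add power_add prod.distrib)
  also have "(\<Prod>w\<in>?S. g w ^ Poly_Mapping.lookup m w) = monom_eval g m"
    by (rule monom_eval_superset[symmetric]) auto
  also have "(\<Prod>w\<in>?S. g w ^ Poly_Mapping.lookup n w) = monom_eval g n"
    by (rule monom_eval_superset[symmetric]) auto
  finally show ?thesis .
qed

context
  fixes c :: "rat \<Rightarrow> 'r::comm_ring_1"
  assumes c: "comm_ring_hom c"
begin

interpretation c: comm_ring_hom c by (rule c)

lemma mpoly_eval_superset:
  assumes "finite S" "Poly_Mapping.keys p \<subseteq> S"
  shows "mpoly_eval c g p = (\<Sum>m\<in>S. c (Poly_Mapping.lookup p m) * monom_eval g m)"
  unfolding mpoly_eval_def
  by (rule sum.mono_neutral_left) (use assms in \<open>auto simp: in_keys_iff\<close>)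

lemma mpoly_eval_single: "mpoly_eval c g (Poly_Mapping.single m a) = c a * monom_eval g m"
  by (subst mpoly_eval_superset[of "{m}"]) auto

lemma mpoly_eval_add: "mpoly_eval c g (p + q) = mpoly_eval c g p + mpoly_eval c g q"
proof -
  let ?S = "Poly_Mapping.keys p \<union> Poly_Mapping.keys q"
  have "mpoly_eval c g (p + q) = (\<Sum>m\<in>?S. c (Poly_Mapping.lookup (p + q) m) * monom_eval g m)"
    by (rule mpoly_eval_superset) (use Poly_Mapping.keys_add[of p q] in auto)
  also have "\<dots> = (\<Sum>m\<in>?S. c (Poly_Mapping.lookup p m) * monom_eval g m) +
      (\<Sum>m\<in>?S. c (Poly_Mapping.lookup q m) * monom_eval g m)"
    by (simp add: lookup_add c.hom_add algebra_simps sum.distrib)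
  also have "(\<Sum>m\<in>?S. c (Poly_Mapping.lookup p m) * monom_eval g m) = mpoly_eval c g p"
    by (rule mpoly_eval_superset[symmetric]) auto
  also have "(\<Sum>m\<in>?S. c (Poly_Mapping.lookup q m) * monom_eval g m) = mpoly_eval c g q"
    by (rule mpoly_eval_superset[symmetric]) auto
  finally show ?thesis .
qed

lemma mpoly_eval_0: "mpoly_eval c g 0 = 0" by (simp add: mpoly_eval_def)

lemma mpoly_eval_sum: "mpoly_eval c g (\<Sum>i\<in>I. f i) = (\<Sum>i\<in>I. mpoly_eval c g (f i))"
  by (induction I rule: infinite_finite_induct) (auto simp: mpoly_eval_add mpoly_eval_0)

lemma mpoly_eval_mult: "mpoly_eval c g (p * q) = mpoly_eval c g p * mpoly_eval c g q"
proof -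
  let ?s = "\<lambda>p m. Poly_Mapping.single m (Poly_Mapping.lookup p m)"
  have pq: "p = (\<Sum>m\<in>Poly_Mapping.keys p. ?s p m)" "q = (\<Sum>n\<in>Poly_Mapping.keys q. ?s q n)"
    by (simp_all add: poly_mapping_sum_singles)
  have "p * q = (\<Sum>m\<in>Poly_Mapping.keys p. \<Sum>n\<in>Poly_Mapping.keys q. ?s p m * ?s q n)"
    by (subst pq(1), subst pq(2)) (rule sum_product)
  hence "mpoly_eval c g (p * q) = (\<Sum>m\<in>Poly_Mapping.keys p. \<Sum>n\<in>Poly_Mapping.keys q.
      (c (Poly_Mapping.lookup p m) * monom_eval g m) * (c (Poly_Mapping.lookup q n) * monom_eval g n))"
    by (simp add: mpoly_eval_sum mult_single mpoly_eval_single monom_eval_add c.hom_mult mult_ac)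
  thus ?thesis by (simp add: mpoly_eval_def sum_product)
qed

lemma mpoly_eval_var: "mpoly_eval c g (mpoly_var w) = g w"
  by (simp add: mpoly_var_def mpoly_eval_single monom_eval_def)

lemma mpoly_eval_const: "mpoly_eval c g (mpoly_const a) = c a"
  by (simp add: mpoly_const_def mpoly_eval_single monom_eval_def)

lemma mpoly_eval_hom: "comm_ring_hom (mpoly_eval c g)"
proof unfold_locales
  show "mpoly_eval c g 1 = 1" using mpoly_eval_const[of g 1] by (simp add: mpoly_const_def)
qed (auto simp: mpoly_eval_add mpoly_eval_mult mpoly_eval_0)

end

lemma single_conv_prod:
  "Poly_Mapping.single m a = mpoly_const a * monom_eval mpoly_var m"
proof -
  have pow: "Poly_Mapping.single (Poly_Mapping.single w k) 1 = (mpoly_var w ^ k :: 'a rat_mpoly)" for w k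
  proof (induction k)
    case (Suc k)
    have "Poly_Mapping.single (Poly_Mapping.single w (Suc k)) 1 =
      (Poly_Mapping.single (Poly_Mapping.single w 1) 1 * Poly_Mapping.single (Poly_Mapping.single w k) 1 :: 'a rat_mpoly)"
      by (simp add: mult_single single_add[symmetric])
    thus ?case using Suc by (simp add: mpoly_var_def)
  qed simp
  have "Poly_Mapping.single (\<Sum>w\<in>S. Poly_Mapping.single w (k w)) 1 = (\<Prod>w\<in>S. mpoly_var w ^ k w :: 'a rat_mpoly)" for S k
  proof (induction S rule: infinite_finite_induct)
    case (insert w S)
    have "Poly_Mapping.single (\<Sum>w\<in>insert w S. Poly_Mapping.single w (k w)) 1 =
      (Poly_Mapping.single (Poly_Mapping.single w (k w)) 1 *
       Poly_Mapping.single (\<Sum>w\<in>S. Poly_Mapping.single w (k w)) 1 :: 'a rat_mpoly)"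
      using insert.hyps by (simp add: mult_single)
    thus ?case using insert.hyps insert.IH by (simp only: pow) simp
  qed simp_all
  from this[of "Poly_Mapping.lookup m" "Poly_Mapping.keys m"]
  have "Poly_Mapping.single m 1 = (monom_eval mpoly_var m :: 'a rat_mpoly)"
    by (simp add: poly_mapping_sum_singles monom_eval_def)
  moreover have "Poly_Mapping.single m a = mpoly_const a * Poly_Mapping.single m 1"
    by (simp add: mpoly_const_def mult_single)
  ultimately show ?thesis by simp
qed

lemma mpoly_hom_eqI:
  assumes f: "comm_ring_hom f" and h: "comm_ring_hom h"
    and "\<And>a. f (mpoly_const a) = h (mpoly_const a)" "\<And>w. f (mpoly_var w) = h (mpoly_var w)"
  shows "f p = h p"
proof -
  interpret f: comm_ring_hom f by fact
  interpret h: comm_ring_hom h by fact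
  have "f (Poly_Mapping.single m a) = h (Poly_Mapping.single m a)" for m a
    unfolding single_conv_prod monom_eval_def
    by (simp add: f.hom_mult h.hom_mult f.hom_prod h.hom_prod f.hom_power h.hom_power assms(3,4))
  moreover have "p = (\<Sum>m\<in>Poly_Mapping.keys p. Poly_Mapping.single m (Poly_Mapping.lookup p m))"
    by (simp add: poly_mapping_sum_singles)
  ultimately show ?thesis by (metis (no_types, lifting) f.hom_sum h.hom_sum sum.cong)
qed

lemma mpoly_var_inject [simp]: "mpoly_var w = mpoly_var w' \<longleftrightarrow> w = w'"
  by (auto simp: mpoly_var_def dest!: arg_cong[of _ _ "\<lambda>p. Poly_Mapping.keys p"]) 

lemma mpoly_var_nonzero [simp]: "mpoly_var w \<noteq> 0"
  by (auto simp: mpoly_var_def dest!: arg_cong[of _ _ "\<lambda>p. Poly_Mapping.keys p"]) 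

lemma mpoly_const_hom: "comm_ring_hom (mpoly_const :: rat \<Rightarrow> 'v rat_mpoly)"
  by unfold_locales (auto simp: mpoly_const_def single_add mult_single)

text \<open>The generators of Q[b][t], with \<open>mp_T\<close> standing for \<open>t\<close>.
  Substitutions are prescribed on this ring, where generators have free images, and passed to the
  fractions afterwards.\<close>

abbreviation mp_C :: "rat \<Rightarrow> 'v rat_mpoly poly" where "mp_C a \<equiv> [:mpoly_const a:]"
abbreviation mp_V :: "'v \<Rightarrow> 'v rat_mpoly poly" where "mp_V w \<equiv> [:mpoly_var w:]"
abbreviation mp_T :: "'v rat_mpoly poly" where "mp_T \<equiv> [:0, 1:]"

lemma comm_ring_hom_comp:
  assumes "comm_ring_hom f" "comm_ring_hom h" shows "comm_ring_hom (\<lambda>x. f (h x))"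
proof -
  interpret f: comm_ring_hom f by fact
  interpret h: comm_ring_hom h by fact
  show ?thesis by unfold_locales (auto simp: f.hom_add h.hom_add f.hom_mult h.hom_mult)
qed

lemma mp_C_hom: "comm_ring_hom (mp_C :: rat \<Rightarrow> 'v rat_mpoly poly)"
proof -
  interpret comm_ring_hom "mpoly_const :: rat \<Rightarrow> 'v rat_mpoly" by (rule mpoly_const_hom)
  show ?thesis by unfold_locales (auto simp: hom_add hom_mult)
qed

definition mp_eval :: "(rat \<Rightarrow> 'r::comm_ring_1) \<Rightarrow> ('v \<Rightarrow> 'r) \<Rightarrow> 'r \<Rightarrow> 'v rat_mpoly poly \<Rightarrow> 'r" where
  "mp_eval c g \<tau> p = poly (map_poly (mpoly_eval c g) p) \<tau>"

context
  fixes c :: "rat \<Rightarrow> 'r::comm_ring_1"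
  assumes c: "comm_ring_hom c"
begin

lemma mp_eval_hom: "comm_ring_hom (mp_eval c g \<tau>)"
proof -
  interpret e: comm_ring_hom "mpoly_eval c g" by (rule mpoly_eval_hom[OF c])
  interpret ep: map_poly_comm_ring_hom "mpoly_eval c g" ..
  show ?thesis unfolding mp_eval_def by unfold_locales (auto simp: ep.hom_add ep.hom_mult)
qed

lemma mp_eval_C: "mp_eval c g \<tau> (mp_C a) = c a"
  and mp_eval_V: "mp_eval c g \<tau> (mp_V w) = g w"
  and mp_eval_T: "mp_eval c g \<tau> mp_T = \<tau>"
proof -
  interpret e: comm_ring_hom "mpoly_eval c g" by (rule mpoly_eval_hom[OF c])
  show "mp_eval c g \<tau> (mp_C a) = c a" "mp_eval c g \<tau> (mp_V w) = g w" "mp_eval c g \<tau> mp_T = \<tau>"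
    by (simp_all add: mp_eval_def e.map_poly_pCons_hom mpoly_eval_const[OF c] mpoly_eval_var[OF c])
qed

end

text \<open>Uniqueness half of the universal property: identities between composed substitutions
  reduce to constants, indeterminates and \<open>t\<close>.\<close>

lemma mp_hom_eqI:
  assumes f: "comm_ring_hom f" and h: "comm_ring_hom h"
    and C: "\<And>a. f (mp_C a) = h (mp_C a)" and V: "\<And>w. f (mp_V w) = h (mp_V w)" and T: "f mp_T = h mp_T"
  shows "f p = h p"
proof (induction p)
  case 0
  interpret f: comm_ring_hom f by fact
  interpret h: comm_ring_hom h by fact
  show ?case by simp
next
  case (pCons a p)
  interpret f: comm_ring_hom f by fact
  interpret h: comm_ring_hom h by fact
  have const: "comm_ring_hom (\<lambda>a :: 'a rat_mpoly. [:a:])" by unfold_locales auto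
  have "f [:a:] = h [:a:]"
    by (rule mpoly_hom_eqI[OF comm_ring_hom_comp[OF f const] comm_ring_hom_comp[OF h const]]) (rule C V)+
  moreover have "pCons a p = [:a:] + mp_T * p" by simp
  ultimately show ?case using pCons T by (metis f.hom_add f.hom_mult h.hom_add h.hom_mult)
qed

section \<open>Passage to fields of fractions\<close>

lemma clear_denominators:
  fixes p :: "'a::idom fract poly"
  obtains \<delta> q where "\<delta> \<noteq> 0" "smult (to_fract \<delta>) p = map_poly to_fract q"
proof -
  have "\<exists>\<delta> q. \<delta> \<noteq> 0 \<and> smult (to_fract \<delta>) p = map_poly to_fract q"
  proof (induction p)
    case 0
    show ?case by (intro exI[of _ 1] exI[of _ 0]) simp
  next
    case (pCons a p)
    then obtain \<delta> q where \<delta>: "\<delta> \<noteq> 0" "smult (to_fract \<delta>) p = map_poly to_fract q" by blast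
    obtain x y where a: "a = to_fract x / to_fract y" "y \<noteq> 0"
      by (cases a) (auto simp: Fract_conv_to_fract)
    have "smult (to_fract (y * \<delta>)) (pCons a p) = map_poly to_fract (pCons (\<delta> * x) (smult y q))"
    proof -
      have "smult (to_fract (y * \<delta>)) p = smult (to_fract y) (map_poly to_fract q)"
        by (simp add: \<delta>(2)[symmetric])
      moreover have "to_fract (y * \<delta>) * a = to_fract (\<delta> * x)" using a by simp
      ultimately show ?thesis
        by (simp del: to_fract_mult add: to_fract_hom.map_poly_pCons_hom to_fract_hom.map_poly_hom_smult)
    qed
    thus ?case using \<delta> a by (intro exI[of _ "y * \<delta>"] exI) auto
  qed
  thus ?thesis using that by blast
qed

text \<open>Injectivity of \<open>h\<close> keeps denominators nonzero, so quotients can be mapped.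
  The hypothesis \<open>frac\<close> asks that every element be a quotient of images of \<iota>,
  which fits Q(b)(t), an iterated field of fractions over Q[b][t].\<close>

lemma inj_hom_fraction_extension:
  fixes \<iota> :: "'d::comm_ring_1 \<Rightarrow> 'l::field" and h :: "'d \<Rightarrow> 'f::field"
  assumes \<iota>: "inj_comm_ring_hom \<iota>" and h: "inj_comm_ring_hom h"
    and frac: "\<And>x. \<exists>p q. q \<noteq> 0 \<and> x = \<iota> p / \<iota> q"
  obtains H where "field_hom H" "\<And>p. H (\<iota> p) = h p"
proof -
  interpret \<iota>: inj_comm_ring_hom \<iota> by fact
  interpret h: inj_comm_ring_hom h by fact
  define H where "H x = (SOME r. \<exists>p q. q \<noteq> 0 \<and> x = \<iota> p / \<iota> q \<and> r = h p / h q)" for x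
  have H: "H (\<iota> p / \<iota> q) = h p / h q" if q: "q \<noteq> 0" for p q
    unfolding H_def
  proof (rule some_equality)
    fix r assume "\<exists>p' q'. q' \<noteq> 0 \<and> \<iota> p / \<iota> q = \<iota> p' / \<iota> q' \<and> r = h p' / h q'"
    then obtain p' q' where *: "q' \<noteq> 0" "\<iota> p / \<iota> q = \<iota> p' / \<iota> q'" "r = h p' / h q'" by blast
    hence "\<iota> (p * q') = \<iota> (p' * q)" using q by (simp add: frac_eq_eq \<iota>.hom_mult)
    hence "p * q' = p' * q" by simp
    hence "h p * h q' = h p' * h q" by (metis h.hom_mult)
    thus "r = h p / h q" using * q by (simp add: frac_eq_eq)
  qed (use q in blast)
  have H1: "H (\<iota> p) = h p" for p using H[of 1 p] by simp
  have "field_hom H"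
  proof unfold_locales
    show "H 0 = 0" "H 1 = 1" using H1[of 0] H1[of 1] by auto
    fix x y
    obtain p q p' q' where xy: "q \<noteq> 0" "x = \<iota> p / \<iota> q" "q' \<noteq> 0" "y = \<iota> p' / \<iota> q'"
      using frac[of x] frac[of y] by blast
    have nz: "q * q' \<noteq> 0"
    proof
      assume "q * q' = 0"
      hence "\<iota> q * \<iota> q' = 0" by (metis \<iota>.hom_mult \<iota>.hom_zero)
      with xy show False by simp
    qed
    have "x + y = \<iota> (p * q' + p' * q) / \<iota> (q * q')"
      using xy by (simp add: \<iota>.hom_add \<iota>.hom_mult field_simps)
    moreover have "h (p * q' + p' * q) / h (q * q') = h p / h q + h p' / h q'"
      using xy by (simp add: h.hom_add h.hom_mult field_simps)
    ultimately show "H (x + y) = H x + H y" using xy nz by (simp add: H)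
    have "x * y = \<iota> (p * p') / \<iota> (q * q')" using xy by (simp add: \<iota>.hom_mult)
    moreover have "h (p * p') / h (q * q') = (h p / h q) * (h p' / h q')" by (simp add: h.hom_mult)
    ultimately show "H (x * y) = H x * H y" using xy nz by (simp add: H)
  qed
  with H1 that show ?thesis by blast
qed

definition mp_fract :: "'v::linorder rat_mpoly poly \<Rightarrow> 'v rat_fun poly fract" where
  "mp_fract p = to_fract (map_poly to_fract p)"

lemma mp_fract_hom: "inj_comm_ring_hom (mp_fract :: 'v::linorder rat_mpoly poly \<Rightarrow> _)"
proof -
  interpret t: map_poly_inj_comm_ring_hom "to_fract :: 'v rat_mpoly \<Rightarrow> _" ..
  show ?thesis by unfold_locales (auto simp: mp_fract_def t.hom_add t.hom_mult)
qed

lemma mp_fract_quotient: "\<exists>p q. q \<noteq> 0 \<and> x = mp_fract p / mp_fract q"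
proof -
  obtain a b where x: "x = to_fract a / to_fract b" "b \<noteq> 0" by (cases x) (auto simp: Fract_conv_to_fract)
  obtain \<alpha> a' where a: "\<alpha> \<noteq> 0" "smult (to_fract \<alpha>) a = map_poly to_fract a'" by (rule clear_denominators)
  obtain \<beta> b' where b: "\<beta> \<noteq> 0" "smult (to_fract \<beta>) b = map_poly to_fract b'" by (rule clear_denominators)
  have A: "map_poly to_fract (smult \<beta> a') = smult (to_fract \<beta> * to_fract \<alpha>) a"
    by (simp add: to_fract_hom.map_poly_hom_smult a(2)[symmetric])
  have B: "map_poly to_fract (smult \<alpha> b') = smult (to_fract \<beta> * to_fract \<alpha>) b"
    by (simp add: to_fract_hom.map_poly_hom_smult b(2)[symmetric] mult.commute)
  have sm: "to_fract (smult k p) = to_fract [:k:] * to_fract p" for k :: "'a rat_fun" and p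
    by (simp flip: to_fract_mult)
  have "mp_fract (smult \<beta> a') / mp_fract (smult \<alpha> b') = x"
    using x a b unfolding mp_fract_def A B sm by simp
  moreover have "smult \<alpha> b' \<noteq> 0"
  proof
    assume "smult \<alpha> b' = 0"
    hence "smult (to_fract \<beta> * to_fract \<alpha>) b = 0" unfolding B[symmetric] by (simp only: map_poly_0)
    thus False using x a b by simp
  qed
  ultimately show ?thesis by metis
qed

section \<open>The generic denominator\<close>

text \<open>If no power of x above \<open>n\<close> occurs, this is \<open>y^n F(t/y, y)\<close>:
  the term \<open>x^i y^j\<close> becomes \<open>t^i y^(n - i + j)\<close>. The inner variable of
  the result is \<open>t\<close>.\<close>

definition diag_subst :: "nat \<Rightarrow> 'a::comm_ring_1 poly poly \<Rightarrow> 'a poly poly" where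
  "diag_subst n F = (\<Sum>j\<le>degree F. \<Sum>i\<le>n. monom (monom (coeff (coeff F j) i) i) (n - i + j))"

lemma coeff_diag_subst:
  "coeff (coeff (diag_subst n F) k) i =
    (if i \<le> n \<and> n \<le> k + i then coeff (coeff F (k + i - n)) i else 0)"
proof -
  have "coeff (coeff (diag_subst n F) k) i =
      (\<Sum>j\<le>degree F. \<Sum>i'\<le>n. if i' = i then (if j = k + i - n \<and> n \<le> k + i then coeff (coeff F j) i else 0) else 0)"
    unfolding diag_subst_def coeff_sum by (intro sum.cong refl) auto
  also have "\<dots> = (\<Sum>j\<le>degree F. if j = k + i - n then (if i \<le> n \<and> n \<le> k + i then coeff (coeff F j) i else 0) else 0)"
    by (intro sum.cong refl) auto
  also have "\<dots> = (if i \<le> n \<and> n \<le> k + i then coeff (coeff F (k + i - n)) i else 0)"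
    by (auto simp: coeff_eq_0)
  finally show ?thesis .
qed

lemma degree_diag_subst_le: "degree (diag_subst n F) \<le> n + degree F"
proof (rule degree_le, intro allI impI)
  fix k assume "n + degree F < k"
  thus "coeff (diag_subst n F) k = 0"
    by (intro poly_eqI) (auto simp: coeff_diag_subst coeff_eq_0)
qed

lemma coeff_box_poly:
  "coeff (coeff (box_poly m n b) j) i = (if i \<le> m \<and> j \<le> n then b i j else 0)"
proof -
  have "coeff (coeff (box_poly m n b) j) i =
      (\<Sum>i'\<le>m. \<Sum>j'\<le>n. if j' = j then (if i' = i then b i j else 0) else 0)"
    unfolding box_poly_def coeff_sum by (intro sum.cong refl) auto
  also have "\<dots> = (\<Sum>i'\<le>m. if i' = i then (if j \<le> n then b i j else 0) else 0)"
    by (intro sum.cong refl) auto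
  also have "\<dots> = (if i \<le> m \<and> j \<le> n then b i j else 0)" by auto
  finally show ?thesis .
qed

text \<open>The coefficient of index \<open>k\<close> is, up to sign, the elementary symmetric
  polynomial of degree \<open>d - k\<close> in the roots, hence homogeneous of that degree.\<close>

lemma coeff_prod_linear_scale:
  fixes w :: "nat \<Rightarrow> 'a::idom"
  assumes "k \<le> d"
  shows "coeff (\<Prod>l<d. [:- (t * w l), 1:]) k = t ^ (d - k) * coeff (\<Prod>l<d. [:- w l, 1:]) k"
  using assms
proof (induction d arbitrary: k)
  case (Suc d)
  have step: "coeff (p * [:- a, 1:]) k = (if k = 0 then 0 else coeff p (k - 1)) - a * coeff p k" for p and a :: 'a
    by (simp add: coeff_pCons split: nat.split)
  show ?case
  proof (cases "k = Suc d")
    case True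
    have "coeff (\<Prod>l<Suc d. [:- f l, 1:]) (Suc d) = 1" for f :: "nat \<Rightarrow> 'a"
      using degree_prod_linear[of f "{..<Suc d}"] by (metis card_lessThan)
    thus ?thesis using True by (simp del: prod.lessThan_Suc)
  next
    case False
    hence k: "k \<le> d" using Suc.prems by simp
    have "coeff (\<Prod>l<d. [:- (t * w l), 1:]) (k - 1) = t ^ (Suc d - k) * coeff (\<Prod>l<d. [:- w l, 1:]) (k - 1)" if "k \<noteq> 0"
      using Suc.IH[of "k - 1"] k that by (simp add: Suc_diff_le[symmetric])
    moreover have "t ^ (Suc d - k) = t * t ^ (d - k)" using k by (simp add: Suc_diff_le)
    ultimately show ?thesis unfolding prod.lessThan_Suc step
      using Suc.IH[OF k] by (auto simp: algebra_simps)
  qed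
qed simp

section \<open>The denominator for a box of indeterminates\<close>

locale generic_box =
  fixes dx dy :: nat and v :: "nat \<Rightarrow> nat \<Rightarrow> 'v::linorder"
  assumes dx: "dx > 0" and dy: "dy > 0"
    and v_inj: "inj_on (\<lambda>(i, j). v i j) ({..dx} \<times> {..dy})"
begin

abbreviation "d \<equiv> dx + dy"

lemma v_eq_iff: "i \<le> dx \<Longrightarrow> j \<le> dy \<Longrightarrow> i' \<le> dx \<Longrightarrow> j' \<le> dy \<Longrightarrow> v i j = v i' j' \<longleftrightarrow> i = i' \<and> j = j'"
  using v_inj unfolding inj_on_def by fastforce

text \<open>
  Among the indeterminates in the coefficient of \<open>y^k\<close> in \<open>y^dx B(t/y, y)\<close>, \<open>u k\<close> comes with the smallest power
  of \<open>t\<close>, namely \<open>t^(dx - k)\<close> (truncated subtraction).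
\<close>

definition u :: "nat \<Rightarrow> 'v" where "u k = v (dx - k) (k - dx)"

lemma u_eq_iff: "k \<le> d \<Longrightarrow> l \<le> d \<Longrightarrow> u k = u l \<longleftrightarrow> k = l"
  unfolding u_def by (subst v_eq_iff) auto

lemma inj_u: "inj_on u {..d}" using u_eq_iff by (auto simp: inj_on_def)

text \<open>The exponents of \<open>t\<close> in the coefficient of \<open>y^k\<close>: the pairs
  \<open>(i, k + i - dx)\<close> form the diagonal \<open>j - i = k - dx\<close> of the box.
  Distinct diagonals are disjoint, which is why the coefficients of \<open>generic_Q\<close> share
  no indeterminate.\<close>

definition diag_index :: "nat \<Rightarrow> nat set" where
  "diag_index k = {i. i \<le> dx \<and> dx \<le> k + i \<and> k + i - dx \<le> dy}"

definition generic_Q :: "'v rat_mpoly poly poly" where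
  "generic_Q = diag_subst dx (box_poly dx dy (\<lambda>i j. mpoly_var (v i j)))"

lemma finite_diag_index: "finite (diag_index k)"
  by (rule finite_subset[of _ "{..dx}"]) (auto simp: diag_index_def)

lemma mp_V_T_monom: "mp_V (w :: 'v) * mp_T ^ i = monom (mpoly_var w) i"
proof -
  have "mp_T ^ i = (monom 1 i :: 'v rat_mpoly poly)" by (simp add: monom_altdef)
  thus ?thesis by (simp only:) (simp add: smult_monom)
qed

lemma coeff_generic_Q: "coeff generic_Q k = (\<Sum>i\<in>diag_index k. mp_V (v i (k + i - dx)) * mp_T ^ i)"
proof (rule poly_eqI)
  fix i
  have "coeff (\<Sum>i\<in>diag_index k. mp_V (v i (k + i - dx)) * mp_T ^ i) i =
      (\<Sum>i'\<in>diag_index k. if i' = i then mpoly_var (v i (k + i - dx)) else 0)"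
    unfolding mp_V_T_monom coeff_sum by (rule sum.cong) auto
  also have "\<dots> = coeff (coeff generic_Q k) i"
    using finite_diag_index[of k] by (auto simp: generic_Q_def coeff_diag_subst coeff_box_poly diag_index_def)
  finally show "coeff (coeff generic_Q k) i = coeff (\<Sum>i\<in>diag_index k. mp_V (v i (k + i - dx)) * mp_T ^ i) i" ..
qed

lemma base_in_diag_index: "k \<le> d \<Longrightarrow> dx - k \<in> diag_index k"
  by (auto simp: diag_index_def)

lemma coeff_generic_Q_split:
  assumes "k \<le> d"
  shows "coeff generic_Q k = mp_V (u k) * mp_T ^ (dx - k) +
    (\<Sum>i\<in>diag_index k - {dx - k}. mp_V (v i (k + i - dx)) * mp_T ^ i)"
proof -
  have "k + (dx - k) - dx = k - dx" by simp
  thus ?thesis unfolding coeff_generic_Q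
    by (subst sum.remove[OF finite_diag_index base_in_diag_index[OF assms]]) (simp add: u_def)
qed

lemma coeff_generic_Q_top: "coeff generic_Q d = mp_V (u d)"
proof -
  have "diag_index d = {0}" by (auto simp: diag_index_def)
  thus ?thesis by (simp add: coeff_generic_Q u_def)
qed

lemma degree_generic_Q: "degree generic_Q = d"
proof (rule antisym)
  show "degree generic_Q \<le> d"
  proof (rule degree_le, intro allI impI)
    fix k assume "d < k"
    hence "diag_index k = {}" by (auto simp: diag_index_def)
    thus "coeff generic_Q k = 0" by (simp add: coeff_generic_Q)
  qed
  show "d \<le> degree generic_Q" by (rule le_degree) (simp add: coeff_generic_Q_top)
qed

text \<open>\<open>u l\<close> is the first element of the \<open>l\<close>-th diagonal, so a later
  element of the \<open>k\<close>-th diagonal is none of the \<open>u l\<close>. A substitution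
  acting on the \<open>u l\<close> alone leaves these terms fixed.\<close>

lemma interior_not_u:
  assumes "i \<in> diag_index k - {dx - k}" "k \<le> d"
  shows "v i (k + i - dx) \<notin> u ` {..d}"
proof
  assume "v i (k + i - dx) \<in> u ` {..d}"
  then obtain l where l: "l \<le> d" "v i (k + i - dx) = v (dx - l) (l - dx)" by (auto simp: u_def)
  hence "i = dx - l" "k + i - dx = l - dx"
    using assms by (subst (asm) v_eq_iff; auto simp: diag_index_def)+
  with assms l(1) show False by (auto simp: diag_index_def)
qed

text \<open>
  The indeterminates \<open>W_l = u l\<close> for \<open>l < d\<close> and \<open>e = u d\<close> are reused.  The value substituted for \<open>u k\<close> is the one
  that makes the coefficient of \<open>y^k\<close> equal to that of \<open>e (y - t W_0) \<dots> (y - t W_(d-1))\<close>; the division by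
  \<open>t^(dx - k)\<close> is exact because \<open>dx - k \<le> d - k\<close>.
\<close>

definition generic_prod :: "'v rat_mpoly poly poly" where
  "generic_prod = (\<Prod>l<d. [:- mp_V (u l), 1:])"

definition generic_coeff :: "nat \<Rightarrow> 'v rat_mpoly poly" where
  "generic_coeff k = mp_V (u d) * coeff generic_prod k * mp_T ^ (d - k - (dx - k))"

definition generic_subst :: "'v \<Rightarrow> 'v rat_mpoly poly" where
  "generic_subst w = (if w \<in> u ` {..d} then
     let k = inv_into {..d} u w in
       generic_coeff k - (\<Sum>i\<in>diag_index k - {dx - k}. mp_V (v i (k + i - dx)) * mp_T ^ (i - (dx - k)))
     else mp_V w)"

definition generic_hom :: "'v rat_mpoly poly \<Rightarrow> 'v rat_mpoly poly" where
  "generic_hom = mp_eval mp_C generic_subst mp_T"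

lemma generic_subst_u:
  assumes "k \<le> d"
  shows "generic_subst (u k) = generic_coeff k -
    (\<Sum>i\<in>diag_index k - {dx - k}. mp_V (v i (k + i - dx)) * mp_T ^ (i - (dx - k)))"
  using assms inv_into_f_f[OF inj_u, of k] by (simp add: generic_subst_def Let_def)

lemma generic_hom: "comm_ring_hom generic_hom"
  unfolding generic_hom_def by (rule mp_eval_hom[OF mp_C_hom])

lemma generic_hom_C: "generic_hom (mp_C a) = mp_C a"
  and generic_hom_V: "generic_hom (mp_V w) = generic_subst w"
  and generic_hom_T: "generic_hom mp_T = mp_T"
  unfolding generic_hom_def by (rule mp_eval_C[OF mp_C_hom] mp_eval_V[OF mp_C_hom] mp_eval_T[OF mp_C_hom])+

lemma T_split:
  assumes "i \<in> diag_index k" shows "(mp_T :: 'v rat_mpoly poly) ^ i = mp_T ^ (i - (dx - k)) * mp_T ^ (dx - k)"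
  using assms by (auto simp: diag_index_def simp flip: power_add)

lemma T_generic_coeff:
  assumes "k \<le> d"
  shows "generic_coeff k * mp_T ^ (dx - k) = mp_V (u d) * coeff generic_prod k * mp_T ^ (d - k)"
proof -
  have "d - k = d - k - (dx - k) + (dx - k)" using assms by simp
  hence "(mp_T :: 'v rat_mpoly poly) ^ (d - k) = mp_T ^ (d - k - (dx - k)) * mp_T ^ (dx - k)"
    by (metis power_add)
  thus ?thesis by (simp only: generic_coeff_def mult.assoc)
qed

lemma generic_hom_interior:
  assumes "i \<in> diag_index k - {dx - k}" "k \<le> d"
  shows "generic_hom (mp_V (v i (k + i - dx))) = mp_V (v i (k + i - dx))"
  using interior_not_u[OF assms] by (simp only: generic_hom_V generic_subst_def if_False)

text \<open>After multiplication by \<open>t^(dx - k)\<close>, the sum subtracted in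
  \<open>generic_subst\<close> cancels the remaining terms of the diagonal, which the substitution
  leaves untouched.\<close>

lemma generic_hom_coeff_Q:
  assumes "k \<le> d"
  shows "generic_hom (coeff generic_Q k) = mp_V (u d) * coeff generic_prod k * mp_T ^ (d - k)"
proof -
  interpret h: comm_ring_hom generic_hom by (rule generic_hom)
  let ?S = "\<lambda>f. (\<Sum>i\<in>diag_index k - {dx - k}. mp_V (v i (k + i - dx)) * mp_T ^ f i)"
  have "generic_hom (?S (\<lambda>i. i)) = ?S (\<lambda>i. i)"
    unfolding h.hom_sum h.hom_mult h.hom_power generic_hom_T
    by (intro sum.cong refl arg_cong2[of _ _ _ _ "(*)"] generic_hom_interior assms)
  moreover have "?S (\<lambda>i. i) = ?S (\<lambda>i. i - (dx - k)) * mp_T ^ (dx - k)"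
    unfolding sum_distrib_right by (rule sum.cong) (auto simp only: T_split mult.assoc)
  ultimately have "generic_hom (coeff generic_Q k) =
      generic_subst (u k) * mp_T ^ (dx - k) + ?S (\<lambda>i. i - (dx - k)) * mp_T ^ (dx - k)"
    unfolding coeff_generic_Q_split[OF assms] h.hom_add h.hom_mult h.hom_power generic_hom_T generic_hom_V by (simp only:)
  also have "\<dots> = generic_coeff k * mp_T ^ (dx - k)"
    unfolding generic_subst_u[OF assms] distrib_right[symmetric] diff_add_cancel ..
  finally show ?thesis unfolding T_generic_coeff[OF assms] .
qed

text \<open>Since \<open>t^(d - k) (t W)^k = t^d W^k\<close>, the power of \<open>t\<close> does not
  depend on \<open>k\<close>, and the value is a multiple of that of \<open>generic_prod\<close> at
  its own root \<open>W\<close>.\<close>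

lemma generic_Q_root:
  assumes "l < d"
  shows "poly (map_poly generic_hom generic_Q) (mp_T * mp_V (u l)) = 0"
proof -
  interpret h: comm_ring_hom generic_hom by (rule generic_hom)
  let ?W = "mp_V (u l)"
  have deg: "degree generic_prod = d" unfolding generic_prod_def by (simp only: degree_prod_linear card_lessThan)
  have "poly (map_poly generic_hom generic_Q) (mp_T * ?W) =
      (\<Sum>k\<le>d. coeff (map_poly generic_hom generic_Q) k * (mp_T * ?W) ^ k)"
    by (rule poly_altdef_le) (use degree_map_poly_le[of generic_hom generic_Q] degree_generic_Q in simp)
  also have "\<dots> = (\<Sum>k\<le>d. (mp_V (u d) * mp_T ^ d) * (coeff generic_prod k * ?W ^ k))"
  proof (rule sum.cong[OF refl])
    fix k assume k: "k \<in> {..d}"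
    hence "(mp_T :: 'v rat_mpoly poly) ^ d = mp_T ^ (d - k) * mp_T ^ k" by (simp flip: power_add)
    thus "coeff (map_poly generic_hom generic_Q) k * (mp_T * ?W) ^ k =
        (mp_V (u d) * mp_T ^ d) * (coeff generic_prod k * ?W ^ k)"
      unfolding h.coeff_map_poly_hom power_mult_distrib
      using k by (simp only: generic_hom_coeff_Q atMost_iff mult_ac)
  qed
  also have "\<dots> = (mp_V (u d) * mp_T ^ d) * (\<Sum>k\<le>d. coeff generic_prod k * ?W ^ k)"
    by (rule sum_distrib_left[symmetric])
  also have "(\<Sum>k\<le>d. coeff generic_prod k * ?W ^ k) = poly generic_prod ?W"
    by (rule poly_altdef_le[symmetric]) (simp only: deg)
  also have "\<dots> = 0" unfolding generic_prod_def
    by (subst poly_prod_linear_eq_0_iff) (use assms in auto)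
  finally show ?thesis by simp
qed

text \<open>
  Sending \<open>W_l\<close> to \<open>y_l / t\<close>, where the \<open>y_l\<close> are the roots of \<open>generic_Q\<close> in the algebraic closure,
  gives a left inverse of \<open>generic_hom\<close>.
\<close>

lemma inj_generic_hom: "inj_comm_ring_hom generic_hom"
proof -
  interpret h: comm_ring_hom generic_hom by (rule generic_hom)
  interpret ac: field_hom "to_ac :: 'v rat_fun poly fract \<Rightarrow> _" by (rule to_ac_hom)
  interpret mf: inj_comm_ring_hom "mp_fract :: 'v rat_mpoly poly \<Rightarrow> _" by (rule mp_fract_hom)
  define \<kappa> where "\<kappa> p = to_ac (mp_fract p)" for p :: "'v rat_mpoly poly"
  interpret \<kappa>: inj_comm_ring_hom \<kappa>
    by unfold_locales (auto simp: \<kappa>_def mf.hom_add mf.hom_mult)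
  let ?Q = "map_poly \<kappa> generic_Q"
  have lc: "lead_coeff ?Q = \<kappa> (mp_V (u d))" by (simp add: degree_generic_Q coeff_generic_Q_top)
  have "generic_Q \<noteq> 0" using degree_generic_Q dx by auto
  then obtain y where "?Q = smult (lead_coeff ?Q) (\<Prod>i<degree ?Q. [:- y i, 1:])"
    using alg_closed_linear_factors[of ?Q] by auto
  hence y: "?Q = smult (\<kappa> (mp_V (u d))) (\<Prod>i<d. [:- y i, 1:])"
    unfolding lc by (simp only: \<kappa>.degree_map_poly_hom degree_generic_Q)
  let ?t = "\<kappa> mp_T"
  have t: "?t \<noteq> 0" by simp
  \<comment> \<open>Only the \<open>u l\<close> with \<open>l < d\<close> stand for roots; the
    leading coefficient \<open>u d\<close> and all other indeterminates keep their values.\<close>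
  define g where "g w = (if w \<in> u ` {..<d} then y (inv_into {..d} u w) / ?t else \<kappa> (mp_V w))" for w
  define \<psi> where "\<psi> = mp_eval (\<lambda>a. \<kappa> (mp_C a)) g ?t"
  have C: "comm_ring_hom (\<lambda>a. \<kappa> (mp_C a))" by (rule comm_ring_hom_comp[OF \<kappa>.comm_ring_hom_axioms mp_C_hom])
  interpret \<psi>: comm_ring_hom \<psi> unfolding \<psi>_def by (rule mp_eval_hom[OF C])
  interpret \<psi>p: map_poly_comm_ring_hom \<psi> ..
  have \<psi>C: "\<psi> (mp_C a) = \<kappa> (mp_C a)" and \<psi>V: "\<psi> (mp_V w) = g w" and \<psi>T: "\<psi> mp_T = ?t" for a w
    unfolding \<psi>_def by (rule mp_eval_C[OF C] mp_eval_V[OF C] mp_eval_T[OF C])+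
  have gu: "g (u l) = y l / ?t" if "l < d" for l
  proof -
    have "inv_into {..d} u (u l) = l" using that by (intro inv_into_f_f[OF inj_u]) simp
    thus ?thesis using that by (simp add: g_def)
  qed
  have "u d \<notin> u ` {..<d}"
  proof
    assume "u d \<in> u ` {..<d}"
    then obtain l where "l < d" "u d = u l" by auto
    thus False using u_eq_iff[of d l] by simp
  qed
  hence gd: "g (u d) = \<kappa> (mp_V (u d))" by (simp add: g_def)
  have \<psi>prod: "?t ^ (d - k) * \<psi> (coeff generic_prod k) = coeff (\<Prod>i<d. [:- y i, 1:]) k" if k: "k \<le> d" for k
  proof -
    have "map_poly \<psi> generic_prod = (\<Prod>l<d. [:- (y l / ?t), 1:])"
      unfolding generic_prod_def \<psi>p.hom_prod
      by (rule prod.cong) (simp_all only: \<psi>.map_poly_pCons_hom \<psi>.hom_uminus \<psi>V gu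
        lessThan_iff \<psi>.hom_one map_poly_0)
    hence "\<psi> (coeff generic_prod k) = coeff (\<Prod>l<d. [:- (y l / ?t), 1:]) k"
      by (metis \<psi>.coeff_map_poly_hom)
    thus ?thesis using coeff_prod_linear_scale[OF k, of ?t "\<lambda>l. y l / ?t"] t by simp
  qed
  have inverse: "\<psi> (generic_hom p) = \<kappa> p" for p
  proof (rule mp_hom_eqI[OF comm_ring_hom_comp[OF \<psi>.comm_ring_hom_axioms generic_hom] \<kappa>.comm_ring_hom_axioms])
    show "\<psi> (generic_hom (mp_C a)) = \<kappa> (mp_C a)" for a by (simp only: generic_hom_C \<psi>C)
    show "\<psi> (generic_hom mp_T) = \<kappa> mp_T" by (simp only: generic_hom_T \<psi>T)
    show "\<psi> (generic_hom (mp_V w)) = \<kappa> (mp_V w)" for w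
    proof (cases "w \<in> u ` {..d}")
      case False
      hence "w \<notin> u ` {..<d}" by auto
      with False show ?thesis unfolding generic_hom_V generic_subst_def by (simp add: \<psi>V g_def)
    next
      case True
      then obtain k where k: "k \<le> d" "w = u k" by auto
      let ?S = "\<lambda>f. (\<Sum>i\<in>diag_index k - {dx - k}. \<kappa> (mp_V (v i (k + i - dx))) * ?t ^ f i)"
      have gi: "g (v i (k + i - dx)) = \<kappa> (mp_V (v i (k + i - dx)))" if "i \<in> diag_index k - {dx - k}" for i
        using interior_not_u[OF that k(1)] unfolding g_def by (subst if_not_P) auto
      have "\<psi> (generic_subst (u k)) = \<psi> (generic_coeff k) - ?S (\<lambda>i. i - (dx - k))"
        unfolding generic_subst_u[OF k(1)] \<psi>.hom_minus \<psi>.hom_sum \<psi>.hom_mult \<psi>.hom_power \<psi>V \<psi>T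
        by (intro arg_cong2[of _ _ _ _ "(-)"] refl sum.cong) (simp add: gi)
      \<comment> \<open>Compared after multiplication by \<open>?t ^ (dx - k)\<close>: the
        coefficient of \<open>y^k\<close> in \<open>?Q\<close> is expressed both through its roots
        and through the indeterminates of its diagonal.\<close>
      hence "\<psi> (generic_subst (u k)) * ?t ^ (dx - k) =
          \<psi> (generic_coeff k * mp_T ^ (dx - k)) - ?S (\<lambda>i. i - (dx - k)) * ?t ^ (dx - k)"
        by (simp only: \<psi>.hom_mult \<psi>.hom_power \<psi>T left_diff_distrib)
      also have "?S (\<lambda>i. i - (dx - k)) * ?t ^ (dx - k) = ?S (\<lambda>i. i)"
        unfolding sum_distrib_right by (rule sum.cong) (auto simp: diag_index_def mult.assoc simp flip: power_add)
      also have "\<psi> (generic_coeff k * mp_T ^ (dx - k)) = \<kappa> (mp_V (u d)) * (?t ^ (d - k) * \<psi> (coeff generic_prod k))"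
        unfolding T_generic_coeff[OF k(1)] \<psi>.hom_mult \<psi>.hom_power \<psi>T \<psi>V gd by (simp only: mult_ac)
      also have "\<dots> = coeff ?Q k" unfolding \<psi>prod[OF k(1)] by (simp only: y coeff_smult)
      also have "\<dots> = \<kappa> (mp_V (u k)) * ?t ^ (dx - k) + ?S (\<lambda>i. i)"
        unfolding \<kappa>.coeff_map_poly_hom coeff_generic_Q_split[OF k(1)] \<kappa>.hom_add \<kappa>.hom_sum \<kappa>.hom_mult \<kappa>.hom_power ..
      finally have "\<psi> (generic_subst (u k)) * ?t ^ (dx - k) = \<kappa> (mp_V (u k)) * ?t ^ (dx - k)" by simp
      hence "\<psi> (generic_subst (u k)) = \<kappa> (mp_V (u k))" using t by simp
      thus ?thesis by (simp only: k(2) generic_hom_V)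
    qed
  qed
  show ?thesis
  proof unfold_locales
    fix p assume "generic_hom p = 0"
    hence "\<kappa> p = 0" using inverse[of p] by simp
    thus "p = 0" by simp
  qed
qed

section \<open>Permutations of the roots as substitutions\<close>

definition perm_var :: "(nat \<Rightarrow> nat) \<Rightarrow> 'v \<Rightarrow> 'v" where
  "perm_var \<pi> w = (if w \<in> u ` {..d} then u (\<pi> (inv_into {..d} u w)) else w)"

definition perm_hom :: "(nat \<Rightarrow> nat) \<Rightarrow> 'v rat_mpoly poly \<Rightarrow> 'v rat_mpoly poly" where
  "perm_hom \<pi> = mp_eval mp_C (\<lambda>w. mp_V (perm_var \<pi> w)) mp_T"

lemma perm_hom: "comm_ring_hom (perm_hom \<pi>)"
  unfolding perm_hom_def by (rule mp_eval_hom[OF mp_C_hom])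

lemma perm_hom_C: "perm_hom \<pi> (mp_C a) = mp_C a"
  and perm_hom_V: "perm_hom \<pi> (mp_V w) = mp_V (perm_var \<pi> w)"
  and perm_hom_T: "perm_hom \<pi> mp_T = mp_T"
  unfolding perm_hom_def by (rule mp_eval_C[OF mp_C_hom] mp_eval_V[OF mp_C_hom] mp_eval_T[OF mp_C_hom])+

lemma perm_var_u: "k \<le> d \<Longrightarrow> perm_var \<pi> (u k) = u (\<pi> k)"
  using inv_into_f_f[OF inj_u, of k] by (simp add: perm_var_def)

context
  fixes \<pi> assumes \<pi>: "\<pi> permutes {..<d}"
begin

lemma perm_le: "k \<le> d \<Longrightarrow> \<pi> k \<le> d"
  using permutes_in_image[OF \<pi>, of k] permutes_not_in[OF \<pi>, of k] by (cases "k < d") auto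

lemma perm_top: "\<pi> d = d" using permutes_not_in[OF \<pi>, of d] by simp

lemma inj_perm_hom: "inj_comm_ring_hom (perm_hom \<pi>)"
proof -
  interpret h: comm_ring_hom "perm_hom \<pi>" by (rule perm_hom)
  interpret i: comm_ring_hom "perm_hom (inv_into UNIV \<pi>)" by (rule perm_hom)
  have id: "comm_ring_hom (\<lambda>p :: 'v rat_mpoly poly. p)" by unfold_locales auto
  have "perm_hom (inv_into UNIV \<pi>) (perm_hom \<pi> p) = p" for p
  proof (rule mp_hom_eqI[OF comm_ring_hom_comp[OF perm_hom perm_hom] id])
    fix w
    show "perm_hom (inv_into UNIV \<pi>) (perm_hom \<pi> (mp_V w)) = mp_V w"
    proof (cases "w \<in> u ` {..d}")
      case True
      then obtain k where k: "k \<le> d" "w = u k" by auto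
      thus ?thesis using perm_le[OF k(1)] permutes_inverses(2)[OF \<pi>]
        by (simp only: perm_hom_V perm_var_u)
    next
      case False
      thus ?thesis by (simp only: perm_hom_V perm_var_def if_False)
    qed
  qed (simp_all only: perm_hom_C perm_hom_T)
  thus ?thesis by unfold_locales (metis i.hom_zero)
qed

lemma perm_generic_prod: "perm_hom \<pi> (coeff generic_prod k) = coeff generic_prod k"
proof -
  interpret h: comm_ring_hom "perm_hom \<pi>" by (rule perm_hom)
  interpret hp: map_poly_comm_ring_hom "perm_hom \<pi>" ..
  have "map_poly (perm_hom \<pi>) generic_prod = (\<Prod>l<d. [:- mp_V (u (\<pi> l)), 1:])"
    unfolding generic_prod_def hp.hom_prod
    by (rule prod.cong) (simp_all only: h.map_poly_pCons_hom h.hom_uminus perm_hom_V perm_var_u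
      lessThan_iff less_imp_le h.hom_one map_poly_0)
  also have "\<dots> = generic_prod" unfolding generic_prod_def
    by (rule prod.reindex_bij_betw[OF permutes_imp_bij[OF \<pi>]])
  finally show ?thesis by (metis h.coeff_map_poly_hom)
qed

text \<open>The \<open>u l\<close> with \<open>l < d\<close> enter the values of
  \<open>generic_subst\<close> only through the coefficients of \<open>generic_prod\<close>, which
  are symmetric in them; everything else is fixed by \<pi>.\<close>

lemma perm_generic_hom: "perm_hom \<pi> (generic_hom p) = generic_hom p"
proof (rule mp_hom_eqI[OF comm_ring_hom_comp[OF perm_hom generic_hom] generic_hom])
  interpret h: comm_ring_hom "perm_hom \<pi>" by (rule perm_hom)
  fix w
  show "perm_hom \<pi> (generic_hom (mp_V w)) = generic_hom (mp_V w)"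
  proof (cases "w \<in> u ` {..d}")
    case False
    thus ?thesis by (simp only: generic_hom_V generic_subst_def perm_hom_V perm_var_def if_False)
  next
    case True
    then obtain k where k: "k \<le> d" "w = u k" by auto
    have "perm_hom \<pi> (mp_V (v i (k + i - dx))) = mp_V (v i (k + i - dx))" if "i \<in> diag_index k - {dx - k}" for i
      using interior_not_u[OF that k(1)] by (simp only: perm_hom_V perm_var_def if_False)
    hence S: "perm_hom \<pi> (\<Sum>i\<in>diag_index k - {dx - k}. mp_V (v i (k + i - dx)) * mp_T ^ (i - (dx - k))) =
        (\<Sum>i\<in>diag_index k - {dx - k}. mp_V (v i (k + i - dx)) * mp_T ^ (i - (dx - k)))"
      unfolding h.hom_sum h.hom_mult h.hom_power perm_hom_T
      by (intro sum.cong refl arg_cong2[of _ _ _ _ "(*)"])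
    have "perm_hom \<pi> (generic_coeff k) = generic_coeff k"
      unfolding generic_coeff_def h.hom_mult h.hom_power perm_hom_T perm_generic_prod perm_hom_V
        perm_var_u[OF order_refl] perm_top ..
    thus ?thesis unfolding k(2) generic_hom_V generic_subst_u[OF k(1)] h.hom_minus S by (simp only:)
  qed
qed (simp_all only: generic_hom_C generic_hom_T perm_hom_C perm_hom_T)

end

text \<open>The factor \<open>c\<close> is there because the coprime denominator in the algorithm is
  determined only up to a constant; neither \<phi> nor the roots depend on it.\<close>

theorem generic_splitting_exists:
  obtains \<phi> \<rho> where "\<And>c. c \<noteq> 0 \<Longrightarrow> generic_splitting \<phi> d \<rho> (smult c (map_poly mp_fract generic_Q))"
proof -
  interpret mf: inj_comm_ring_hom "mp_fract :: 'v rat_mpoly poly \<Rightarrow> _" by (rule mp_fract_hom)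
  interpret g: inj_comm_ring_hom generic_hom by (rule inj_generic_hom)
  have inj_comp: "inj_comm_ring_hom (\<lambda>p. mp_fract (h p))"
    if "inj_comm_ring_hom h" for h :: "'v rat_mpoly poly \<Rightarrow> 'v rat_mpoly poly"
  proof -
    interpret h: inj_comm_ring_hom h by fact
    show ?thesis by unfold_locales (auto simp: h.hom_add h.hom_mult mf.hom_add mf.hom_mult)
  qed
  obtain \<phi> where \<phi>: "field_hom \<phi>" "\<And>p. \<phi> (mp_fract p) = mp_fract (generic_hom p)"
    using inj_hom_fraction_extension[OF mp_fract_hom inj_comp[OF inj_generic_hom] mp_fract_quotient] by metis
  interpret \<phi>: field_hom \<phi> by fact
  define \<rho> where "\<rho> l = mp_fract (mp_T * mp_V (u l))" for l
  have "generic_splitting \<phi> d \<rho> (smult c (map_poly mp_fract generic_Q))" if c: "c \<noteq> 0" for c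
  proof unfold_locales
    show "inj_on \<rho> {..<d}"
    proof (rule inj_onI)
      fix k l assume "k \<in> {..<d}" "l \<in> {..<d}" "\<rho> k = \<rho> l"
      thus "k = l" using u_eq_iff[of k l] by (auto simp: \<rho>_def)
    qed
    show "degree (smult c (map_poly mp_fract generic_Q)) = d" using c by (simp add: degree_generic_Q)
    show "2 \<le> d" using dx dy by simp
    fix l assume l: "l < d"
    have "map_poly \<phi> (map_poly mp_fract generic_Q) = map_poly mp_fract (map_poly generic_hom generic_Q)"
      by (rule poly_eqI) (simp add: \<phi>(2))
    hence "poly (map_poly \<phi> (map_poly mp_fract generic_Q)) (\<rho> l) =
        mp_fract (poly (map_poly generic_hom generic_Q) (mp_T * mp_V (u l)))"
      unfolding \<rho>_def by (simp only: mf.poly_map_poly)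
    thus "poly (map_poly \<phi> (smult c (map_poly mp_fract generic_Q))) (\<rho> l) = 0"
      by (simp only: generic_Q_root[OF l] \<phi>.map_poly_hom_smult poly_smult mf.hom_zero mult_zero_right)
  next
    fix \<pi> assume \<pi>: "\<pi> permutes {..<d}"
    obtain s where s: "field_hom s" "\<And>p. s (mp_fract p) = mp_fract (perm_hom \<pi> p)"
      using inj_hom_fraction_extension[OF mp_fract_hom inj_comp[OF inj_perm_hom[OF \<pi>]] mp_fract_quotient] by metis
    interpret s: field_hom s by fact
    interpret ph: comm_ring_hom "perm_hom \<pi>" by (rule perm_hom)
    have "s (\<phi> x) = \<phi> x" for x
    proof -
      obtain p q where x: "x = mp_fract p / mp_fract q" using mp_fract_quotient by blast
      show ?thesis unfolding x \<phi>.hom_div s.hom_div \<phi>(2) s(2) perm_generic_hom[OF \<pi>] ..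
    qed
    moreover have "s (\<rho> l) = \<rho> (\<pi> l)" if "l < d" for l
      unfolding \<rho>_def s(2) ph.hom_mult perm_hom_T perm_hom_V using that by (simp only: perm_var_u less_imp_le)
    ultimately show "\<exists>s. field_hom s \<and> (\<forall>x. s (\<phi> x) = \<phi> x) \<and> (\<forall>l<d. s (\<rho> l) = \<rho> (\<pi> l))"
      using s(1) by blast
  qed
  thus ?thesis using that by blast
qed

end

section \<open>Small branches\<close>

lemma poly_add_expansion:
  fixes p :: "'a::idom poly"
  obtains r where "poly p (x + h) = poly p x + poly (pderiv p) x * h + h ^ 2 * r"
proof -
  have "\<exists>r. poly p (x + h) = poly p x + poly (pderiv p) x * h + h ^ 2 * r"
  proof (induction p)
    case (pCons a p)
    then obtain r where r: "poly p (x + h) = poly p x + poly (pderiv p) x * h + h ^ 2 * r" by blast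
    have "poly (pCons a p) (x + h) = a + (x + h) * (poly p x + poly (pderiv p) x * h + h ^ 2 * r)"
      by (simp add: r)
    thus ?case
      by (intro exI[of _ "poly (pderiv p) x + (x + h) * r"])
        (simp add: pderiv_pCons algebra_simps power2_eq_square)
  qed simp
  thus ?thesis using that by blast
qed

lemma poly_cong_dvd:
  fixes p :: "'a::comm_ring_1 poly"
  assumes "c dvd x - y" shows "c dvd poly p x - poly p y"
proof (induction p)
  case (pCons a p)
  have "poly (pCons a p) x - poly (pCons a p) y = x * (poly p x - poly p y) + (x - y) * poly p y"
    by (simp add: algebra_simps)
  thus ?case using pCons assms by simp
qed simp

lemma fps_X_power_dvd_iff:
  fixes f :: "'a::field fps"
  shows "fps_X ^ n dvd f \<longleftrightarrow> (\<forall>i<n. fps_nth f i = 0)"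
proof
  assume "fps_X ^ n dvd f"
  thus "\<forall>i<n. fps_nth f i = 0" by (auto simp: fps_X_power_mult_nth elim!: dvdE)
next
  assume *: "\<forall>i<n. fps_nth f i = 0"
  have "f = fps_X ^ n * fps_shift n f"
    by (rule fps_ext) (use * in \<open>auto simp: fps_X_power_mult_nth\<close>)
  thus "fps_X ^ n dvd f" by (metis dvd_triv_left)
qed

text \<open>One Newton step: a correction \<open>h\<close> of order \<open>n + 1\<close> acts
  linearly up to a multiple of \<open>h^2\<close>, which has order at least \<open>2 n + 2\<close>
  and does not reach the coefficient to be killed.\<close>

lemma fps_hensel_step:
  fixes G :: "'a::field fps poly"
  assumes a: "poly (pderiv (map_poly (\<lambda>f. fps_nth f 0) G)) a \<noteq> 0"
    and w: "fps_nth w 0 = a" "fps_X ^ Suc n dvd poly G w"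
  obtains w' where "fps_nth w' 0 = a" "fps_X ^ Suc (Suc n) dvd poly G w'" "\<forall>i\<le>n. fps_nth w' i = fps_nth w i"
proof -
  interpret c0: idom_hom "\<lambda>f :: 'a fps. fps_nth f 0" by unfold_locales auto
  let ?D = "poly (pderiv (map_poly (\<lambda>f. fps_nth f 0) G)) a"
  have D: "fps_nth (poly (pderiv G) w) 0 = ?D"
    using c0.poly_map_poly[of "pderiv G" w] w(1) by (simp add: c0.map_poly_pderiv)
  \<comment> \<open>Chosen so that \<open>G(w)\<close> and \<open>G'(w) h\<close> cancel in the
    coefficient of index \<open>n + 1\<close>; \<open>?D\<close> is the constant term of
    \<open>G'(w)\<close>.\<close>
  define c where "c = - fps_nth (poly G w) (Suc n) / ?D"
  define h where "h = fps_const c * fps_X ^ Suc n"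
  obtain r where r: "poly G (w + h) = poly G w + poly (pderiv G) w * h + h ^ 2 * r"
    by (rule poly_add_expansion)
  have hnth: "fps_nth (h * f) i = (if i < Suc n then 0 else c * fps_nth f (i - Suc n))" for f i
    unfolding h_def by (simp add: mult.assoc fps_X_power_mult_nth del: power_Suc)
  have "fps_nth (poly G (w + h)) i = 0" if "i < Suc (Suc n)" for i
  proof -
    have h2: "fps_nth (h ^ 2 * r) i = 0"
      using that hnth[of "h * r" i] hnth[of r "i - Suc n"] by (simp add: power2_eq_square mult.assoc)
    have h1: "fps_nth (poly (pderiv G) w * h) i = (if i < Suc n then 0 else c * ?D)"
      using that hnth[of "poly (pderiv G) w" i] D by (simp add: mult.commute)
    show ?thesis
    proof (cases "i < Suc n")
      case True
      hence "fps_nth (poly G w) i = 0" using w(2) fps_X_power_dvd_iff by blast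
      thus ?thesis using h1 h2 True by (simp add: r)
    next
      case False
      hence "i = Suc n" using that by simp
      thus ?thesis using h1 h2 a by (simp add: r c_def)
    qed
  qed
  hence "fps_X ^ Suc (Suc n) dvd poly G (w + h)" using fps_X_power_dvd_iff by blast
  moreover have "fps_nth (w + h) i = fps_nth w i" if "i \<le> n" for i
    using that hnth[of 1 i] by simp
  ultimately show ?thesis using that[of "w + h"] w(1) by auto
qed

lemma fps_hensel:
  fixes G :: "'a::field fps poly"
  assumes root: "poly (map_poly (\<lambda>f. fps_nth f 0) G) a = 0"
    and simple: "poly (pderiv (map_poly (\<lambda>f. fps_nth f 0) G)) a \<noteq> 0"
  obtains w where "fps_nth w 0 = a" "poly G w = 0"
proof -
  interpret c0: idom_hom "\<lambda>f :: 'a fps. fps_nth f 0" by unfold_locales auto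
  let ?P = "\<lambda>n w. fps_nth w 0 = a \<and> fps_X ^ Suc n dvd poly G w"
  have "\<exists>W. \<forall>n. ?P n (W n) \<and> (\<forall>i\<le>n. fps_nth (W (Suc n)) i = fps_nth (W n) i)"
  proof (rule dependent_nat_choice)
    have "fps_nth (poly G (fps_const a)) 0 = 0"
      using c0.poly_map_poly[of G "fps_const a"] root by simp
    hence "fps_X ^ Suc 0 dvd poly G (fps_const a)" by (subst fps_X_power_dvd_iff) simp
    thus "\<exists>w. ?P 0 w" by (intro exI[of _ "fps_const a"]) simp
    fix w n assume "?P n w"
    thus "\<exists>w'. ?P (Suc n) w' \<and> (\<forall>i\<le>n. fps_nth w' i = fps_nth w i)"
      using fps_hensel_step[OF simple] by metis
  qed
  then obtain W where W: "\<And>n. ?P n (W n)" "\<And>n i. i \<le> n \<Longrightarrow> fps_nth (W (Suc n)) i = fps_nth (W n) i" by metis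
  \<comment> \<open>The approximations stabilize coefficientwise; the \<open>n\<close>-th
    coefficient of the limit is reached at \<open>W n\<close>.\<close>
  define w where "w = Abs_fps (\<lambda>n. fps_nth (W n) n)"
  have stable: "fps_nth (W n) i = fps_nth (W i) i" if "i \<le> n" for i n
    using that by (induction n rule: dec_induct) (auto simp: W(2))
  have "fps_nth (poly G w) n = 0" for n
  proof -
    have "fps_nth (w - W n) i = 0" if "i < Suc n" for i
      using stable[of i n] that by (simp add: w_def)
    hence "fps_X ^ Suc n dvd w - W n" using fps_X_power_dvd_iff by blast
    hence "fps_X ^ Suc n dvd poly G w - poly G (W n)" by (rule poly_cong_dvd)
    hence "fps_X ^ Suc n dvd (poly G w - poly G (W n)) + poly G (W n)" using W(1)[of n] by (intro dvd_add) auto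
    hence "fps_X ^ Suc n dvd poly G w" by (simp only: diff_add_cancel)
    thus ?thesis using fps_X_power_dvd_iff by blast
  qed
  hence "poly G w = 0" by (simp add: fps_eq_iff)
  moreover have "fps_nth w 0 = a" using W(1)[of 0] by (simp add: w_def)
  ultimately show ?thesis using that by blast
qed

lemma distinct_roots_dvd:
  fixes p :: "'a::idom poly" and \<rho> :: "nat \<Rightarrow> 'a"
  assumes "inj_on \<rho> {..<n}" "\<And>l. l < n \<Longrightarrow> poly p (\<rho> l) = 0"
  shows "(\<Prod>l<n. [:- \<rho> l, 1:]) dvd p"
  using assms
proof (induction n)
  case (Suc n)
  have "inj_on \<rho> {..<n}" using Suc.prems(1) by (rule inj_on_subset) auto
  with Suc obtain q where q: "p = (\<Prod>l<n. [:- \<rho> l, 1:]) * q" by (auto elim: dvdE)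
  have "\<rho> n \<notin> \<rho> ` {..<n}"
  proof
    assume "\<rho> n \<in> \<rho> ` {..<n}"
    then obtain l where "l < n" "\<rho> n = \<rho> l" by auto
    with inj_onD[OF Suc.prems(1), of n l] show False by simp
  qed
  hence "poly (\<Prod>l<n. [:- \<rho> l, 1:]) (\<rho> n) \<noteq> 0" by (subst poly_prod_linear_eq_0_iff) auto
  moreover have "poly p (\<rho> n) = 0" using Suc.prems(2) by simp
  ultimately have "poly q (\<rho> n) = 0" unfolding q by simp
  then obtain r where "q = [:- \<rho> n, 1:] * r" unfolding poly_eq_0_iff_dvd by (rule dvdE)
  hence "p = (\<Prod>l<Suc n. [:- \<rho> l, 1:]) * r" by (simp only: q prod.lessThan_Suc mult.assoc)
  thus ?case by (rule dvdI)
qed simp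

section \<open>Ramified substitutions and Puiseux series\<close>

lemma fps_nth_compose_X_pow:
  fixes f :: "'a::idom fps"
  assumes "N > 0"
  shows "fps_nth (f oo fps_X ^ N) m = (if N dvd m then fps_nth f (m div N) else 0)"
proof -
  have "fps_nth (f oo fps_X ^ N) m = (\<Sum>i = 0..m. if m = N * i then fps_nth f i else 0)"
    unfolding fps_compose_nth by (rule sum.cong) (simp_all flip: power_mult)
  also have "\<dots> = (\<Sum>i = 0..m. if i = m div N then (if N dvd m then fps_nth f (m div N) else 0) else 0)"
    by (rule sum.cong) (use assms in auto)
  also have "\<dots> = (if N dvd m then fps_nth f (m div N) else 0)" by simp
  finally show ?thesis .
qed

lemma fps_compose_X_pow_hom:
  assumes "N > 0" shows "idom_hom (\<lambda>f :: 'a::field fps. f oo fps_X ^ N)"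
proof unfold_locales
  have 0: "fps_nth (fps_X ^ N :: 'a fps) 0 = 0" using assms by simp
  show "(f * g) oo fps_X ^ N = (f oo fps_X ^ N) * (g oo fps_X ^ N)" for f g :: "'a fps"
    by (rule fps_compose_mult_distrib[OF 0])
qed (simp_all add: fps_compose_add_distrib)

text \<open>With \<open>s = t^(1/N)\<close> one has \<open>f(s^N) = f(t)\<close>, so a branch found
  with a ramified parameter is identified with an unramified one.\<close>

lemma puiseux_compose_X_pow:
  fixes f :: "'a::field fps"
  assumes N: "N > 0"
  shows "puiseux N (fps_to_fls (f oo fps_X ^ N)) = puiseux 1 (fps_to_fls f)"
proof
  fix r :: rat
  show "puiseux N (fps_to_fls (f oo fps_X ^ N)) r = puiseux 1 (fps_to_fls f) r"
  proof (cases "r * of_nat N \<in> \<int>")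
    case False
    hence "r \<notin> \<int>" by (metis Ints_mult Ints_of_nat)
    with False show ?thesis by (simp add: puiseux_def)
  next
    case True
    then obtain z where z: "r * of_nat N = of_int z" by (auto elim: Ints_cases)
    have r: "r = of_int z / of_nat N" using z N by (simp add: field_simps)
    show ?thesis
    proof (cases "int N dvd z")
      case True
      then obtain k where k: "z = int N * k" by (rule dvdE)
      hence rk: "r = of_int k" using r N by simp
      have "fls_nth (fps_to_fls (f oo fps_X ^ N)) z = fls_nth (fps_to_fls f) k"
      proof (cases "k < 0")
        case True
        hence "z < 0" using k N by (simp add: mult_pos_neg)
        with True show ?thesis by simp
      next
        case False
        then obtain m where m: "k = int m" by (metis nonneg_int_cases not_less)
        hence "z = int (N * m)" using k by simp
        thus ?thesis using N m by (simp add: fps_nth_compose_X_pow del: of_nat_mult)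
      qed
      thus ?thesis using z rk by (simp add: puiseux_def)
    next
      case False
      have "r \<notin> \<int>"
      proof
        assume "r \<in> \<int>"
        then obtain k where "r = of_int k" by (auto elim: Ints_cases)
        hence "(of_int z :: rat) = of_int (k * int N)" using z by simp
        hence "z = k * int N" by (simp only: of_int_eq_iff)
        with False show False by simp
      qed
      moreover have "fls_nth (fps_to_fls (f oo fps_X ^ N)) z = 0"
      proof (cases "z < 0")
        case False
        then obtain m where "z = int m" by (metis nonneg_int_cases not_less)
        thus ?thesis using \<open>\<not> int N dvd z\<close> N by (simp add: fps_nth_compose_X_pow)
      qed simp
      ultimately show ?thesis using z by (simp add: puiseux_def)
    qed
  qed
qed

definition poly_to_fps :: "'a::field poly \<Rightarrow> 'a alg_closure fps" where
  "poly_to_fps q = fps_of_poly (map_poly to_ac q)"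

lemma poly_to_fps_hom: "idom_hom (poly_to_fps :: 'a::field poly \<Rightarrow> _)"
proof -
  interpret ac: field_hom "to_ac :: 'a \<Rightarrow> _" by (rule to_ac_hom)
  interpret acp: map_poly_inj_idom_hom "to_ac :: 'a \<Rightarrow> _" ..
  show ?thesis unfolding poly_to_fps_def
    by unfold_locales (auto simp: acp.hom_add acp.hom_mult fps_of_poly_add fps_of_poly_mult)
qed

lemma fps_nth_poly_to_fps [simp]: "fps_nth (poly_to_fps q) i = to_ac (coeff q i)"
  by (simp add: poly_to_fps_def coeff_map_poly)

text \<open>Evaluation at \<open>t = s^N\<close> becomes a substitution in the power series
  coefficients, a ring homomorphism, which can be applied to a factorization.\<close>

lemma poly_eval2_fls:
  assumes "N > 0"
  shows "poly_eval2 (\<lambda>a. fls_const (to_ac a)) Q (fls_X ^ N) f =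
    poly (map_poly (\<lambda>g. fps_to_fls (g oo fps_X ^ N)) (map_poly poly_to_fps Q)) f"
proof -
  interpret ac: field_hom "to_ac :: 'a \<Rightarrow> _" by (rule to_ac_hom)
  have 0: "fps_nth (fps_X ^ N :: 'a alg_closure fps) 0 = 0" using assms by simp
  have "poly (map_poly (\<lambda>a. fls_const (to_ac a)) q) (fls_X ^ N) = fps_to_fls (poly_to_fps q oo fps_X ^ N)"
    for q :: "'a poly"
  proof (induction q)
    case 0
    thus ?case by (simp add: poly_to_fps_def)
  next
    case (pCons a q)
    have "poly_to_fps (pCons a q) = fps_const (to_ac a) + poly_to_fps q * fps_X"
      by (simp add: poly_to_fps_def ac.map_poly_pCons_hom fps_of_poly_pCons)
    hence "poly_to_fps (pCons a q) oo fps_X ^ N =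
        fps_const (to_ac a) + (poly_to_fps q oo fps_X ^ N) * fps_X ^ N"
      using 0 by (simp add: fps_compose_add_distrib fps_compose_mult_distrib)
    thus ?case using pCons
      by (simp add: map_poly_pCons fls_times_fps_to_fls fps_to_fls_power mult.commute)
  qed
  thus ?thesis unfolding poly_eval2_def
    by (subst map_poly_map_poly) (simp_all add: o_def poly_to_fps_def)
qed

text \<open>
  Substituting \<open>y = t w\<close> in \<open>y^n F(t/y, y)\<close> and dividing by \<open>t^n\<close> leaves a polynomial in \<open>w\<close> whose reduction
  modulo \<open>t\<close> is \<open>\<beta>\<close>; its simple roots lift by Hensel's lemma.  The quotient of \<open>y^n F(t/y, y)\<close>
  by the resulting linear factors takes the value \<open>F(0, 0)\<close> at \<open>t = y = 0\<close>, so it has no small root.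
\<close>

theorem card_small_branches:
  fixes F :: "'a::field_char_0 poly poly" and n :: nat and \<omega> :: "nat \<Rightarrow> 'a alg_closure"
  defines "\<beta> \<equiv> map_poly to_ac (\<Sum>i\<le>n. monom (coeff (coeff F 0) i) (n - i))"
  assumes F00: "coeff (coeff F 0) 0 \<noteq> 0"
    and \<omega>: "inj_on \<omega> {..<n}" "\<And>k. k < n \<Longrightarrow> poly \<beta> (\<omega> k) = 0" "\<And>k. k < n \<Longrightarrow> poly (pderiv \<beta>) (\<omega> k) \<noteq> 0"
  shows "card (small_branches (diag_subst n F)) = n"
proof -
  interpret ac: field_hom "to_ac :: 'a \<Rightarrow> _" by (rule to_ac_hom)
  interpret acp: map_poly_inj_idom_hom "to_ac :: 'a \<Rightarrow> _" ..
  interpret s: idom_hom "poly_to_fps :: 'a poly \<Rightarrow> _" by (rule poly_to_fps_hom)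
  interpret sp: map_poly_idom_hom "poly_to_fps :: 'a poly \<Rightarrow> _" ..
  interpret c0: idom_hom "\<lambda>f :: 'a alg_closure fps. fps_nth f 0" by unfold_locales auto
  interpret c0p: map_poly_idom_hom "\<lambda>f :: 'a alg_closure fps. fps_nth f 0" ..
  let ?a = "\<lambda>i j. to_ac (coeff (coeff F j) i)"
  define Fs where "Fs = map_poly poly_to_fps (diag_subst n F)"
  define G where "G = (\<Sum>j\<le>degree F. \<Sum>i\<le>n. monom (fps_const (?a i j) * fps_X ^ j) (n - i + j))"
  have spm: "poly_to_fps (monom a i) = fps_const (to_ac a) * fps_X ^ i" for a :: 'a and i
    by (simp add: poly_to_fps_def fps_of_poly_monom)
  have Fs: "Fs = (\<Sum>j\<le>degree F. \<Sum>i\<le>n. monom (fps_const (?a i j) * fps_X ^ i) (n - i + j))"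
    unfolding Fs_def diag_subst_def by (simp add: sp.hom_sum spm)
  have FsG: "poly Fs (fps_X * w) = fps_X ^ n * poly G w" for w
    unfolding Fs G_def poly_sum sum_distrib_left
  proof (intro sum.cong refl)
    fix i j assume "i \<in> {..n}"
    hence "fps_X ^ i * fps_X ^ (n - i + j) = (fps_X ^ n * fps_X ^ j :: 'a alg_closure fps)"
      by (simp flip: power_add)
    hence "fps_const (?a i j) * (fps_X ^ i * fps_X ^ (n - i + j)) * w ^ (n - i + j) =
        fps_const (?a i j) * (fps_X ^ n * fps_X ^ j) * w ^ (n - i + j)" by (simp only:)
    thus "poly (monom (fps_const (?a i j) * fps_X ^ i) (n - i + j)) (fps_X * w) =
        fps_X ^ n * poly (monom (fps_const (?a i j) * fps_X ^ j) (n - i + j)) w"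
      unfolding poly_monom power_mult_distrib by (simp only: mult.assoc mult.left_commute)
  qed
  \<comment> \<open>Modulo \<open>t\<close> only the terms with \<open>j = 0\<close>
    survive.\<close>
  have c0G: "map_poly (\<lambda>f. fps_nth f 0) G = \<beta>"
  proof -
    have "map_poly (\<lambda>f. fps_nth f 0) G = (\<Sum>j\<le>degree F. \<Sum>i\<le>n. monom (?a i j * 0 ^ j) (n - i + j))"
      unfolding G_def by (simp add: c0p.hom_sum fps_power_zeroth)
    also have "\<dots> = (\<Sum>j\<le>degree F. if j = 0 then \<Sum>i\<le>n. monom (?a i 0) (n - i) else 0)"
      by (rule sum.cong) (auto simp: zero_power)
    also have "\<dots> = \<beta>" by (simp add: \<beta>_def acp.hom_sum)
    finally show ?thesis .
  qed
  have "\<exists>w. fps_nth w 0 = \<omega> k \<and> poly G w = 0" if "k < n" for k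
    using fps_hensel[of G "\<omega> k"] \<omega>(2,3)[OF that] unfolding c0G by blast
  then obtain w where w: "\<And>k. k < n \<Longrightarrow> fps_nth (w k) 0 = \<omega> k" "\<And>k. k < n \<Longrightarrow> poly G (w k) = 0" by metis
  define b where "b k = fps_X * w k" for k
  have b0: "fps_nth (b k) 0 = 0" for k by (simp add: b_def)
  have b1: "fps_nth (b k) 1 = \<omega> k" if "k < n" for k using w(1)[OF that] by (simp add: b_def)
  have broot: "poly Fs (b k) = 0" if "k < n" for k using w(2)[OF that] by (simp add: b_def FsG)
  have binj: "inj_on b {..<n}"
  proof (rule inj_onI)
    fix k l assume "k \<in> {..<n}" "l \<in> {..<n}" "b k = b l"
    thus "k = l" using b1[of k] b1[of l] \<omega>(1) by (auto simp: inj_on_def)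
  qed
  obtain H where H: "Fs = (\<Prod>k<n. [:- b k, 1:]) * H"
    using distinct_roots_dvd[OF binj broot] by (auto elim: dvdE)
  \<comment> \<open>Modulo \<open>t\<close> the branches \<open>b k\<close> vanish and their product
    becomes \<open>y^n\<close>; so \<open>H(0, 0)\<close> is the coefficient of \<open>y^n\<close>
    in \<open>Fs\<close> at \<open>t = 0\<close>, which is \<open>F(0, 0)\<close>.\<close>
  have H0: "fps_nth (coeff H 0) 0 \<noteq> 0"
  proof -
    have "map_poly (\<lambda>f. fps_nth f 0) Fs = (\<Prod>k<n. [:0, 1:]) * map_poly (\<lambda>f. fps_nth f 0) H"
      unfolding H c0p.hom_mult c0p.hom_prod
      by (simp add: c0.map_poly_pCons_hom c0.hom_uminus b0)
    also have "(\<Prod>k<n. [:0, 1:]) = (monom 1 n :: 'a alg_closure poly)" by (simp add: monom_altdef)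
    finally have "coeff (map_poly (\<lambda>f. fps_nth f 0) Fs) n = coeff (monom 1 n * map_poly (\<lambda>f. fps_nth f 0) H) n"
      by simp
    hence "fps_nth (coeff Fs n) 0 = fps_nth (coeff H 0) 0"
      by (simp add: coeff_monom_mult)
    moreover have "fps_nth (coeff Fs n) 0 = ?a 0 0" by (simp add: Fs_def coeff_diag_subst)
    ultimately show ?thesis using F00 by (metis to_ac_eq_0_iff)
  qed
  let ?B = "\<lambda>k. puiseux 1 (fps_to_fls (b k))"
  have "small_branches (diag_subst n F) = ?B ` {..<n}"
  proof (rule equalityI; rule subsetI)
    fix \<xi> assume "\<xi> \<in> small_branches (diag_subst n F)"
    then obtain N f where Nf: "\<xi> = puiseux N f" "N > 0"
      "poly (map_poly (\<lambda>g. fps_to_fls (g oo fps_X ^ N)) Fs) f = 0" "\<forall>r\<le>0. puiseux N f r = 0"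
      unfolding small_branches_def Fs_def using poly_eval2_fls by (auto simp: poly_eval2_fls)
    interpret \<theta>: idom_hom "\<lambda>g :: 'a alg_closure fps. g oo fps_X ^ N" by (rule fps_compose_X_pow_hom[OF Nf(2)])
    interpret \<theta>p: map_poly_idom_hom "\<lambda>g :: 'a alg_closure fps. g oo fps_X ^ N" ..
    interpret fls: idom_hom "fps_to_fls :: 'a alg_closure fps \<Rightarrow> _"
      by unfold_locales (auto simp: fls_times_fps_to_fls)
    \<comment> \<open>A small Puiseux series has neither negative powers nor a constant term, so
      \<open>f\<close> is a power series vanishing at \<open>0\<close>.\<close>
    have neg: "fls_nth f z = 0" if "z \<le> 0" for z
    proof -
      have "puiseux N f (of_int z / of_nat N) = 0"
        using Nf(4) that Nf(2) by (auto simp: divide_le_0_iff)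
      thus ?thesis using Nf(2) by (simp add: puiseux_def)
    qed
    define f' where "f' = fls_regpart f"
    have f': "f = fps_to_fls f'" by (rule fls_eqI) (auto simp: f'_def neg)
    have f'0: "fps_nth f' 0 = 0" by (simp add: f'_def neg)
    let ?t = "map_poly (\<lambda>g. g oo fps_X ^ N)"
    have "map_poly (\<lambda>g. fps_to_fls (g oo fps_X ^ N)) Fs = map_poly fps_to_fls (?t Fs)"
      by (subst map_poly_map_poly) (simp_all add: o_def)
    hence "fps_to_fls (poly (?t Fs) f') = 0" using Nf(3) by (simp add: f')
    hence "poly (?t Fs) f' = 0" by simp
    hence "poly (?t (\<Prod>k<n. [:- b k, 1:])) f' * poly (?t H) f' = 0"
      by (simp only: H \<theta>p.hom_mult poly_mult)
    moreover have "poly (?t H) f' \<noteq> 0"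
    proof
      assume "poly (?t H) f' = 0"
      hence "fps_nth (poly (?t H) f') 0 = 0" by simp
      moreover have "fps_nth (poly (?t H) f') 0 = poly (map_poly (\<lambda>f. fps_nth f 0) (?t H)) 0"
        using c0.poly_map_poly[of "?t H" f'] f'0 by simp
      ultimately show False using H0 by (simp add: poly_0_coeff_0)
    qed
    ultimately have "poly (?t (\<Prod>k<n. [:- b k, 1:])) f' = 0" by simp
    moreover have "?t (\<Prod>k<n. [:- b k, 1:]) = (\<Prod>k<n. [:- (b k oo fps_X ^ N), 1:])"
      unfolding \<theta>p.hom_prod by (simp add: \<theta>.map_poly_pCons_hom \<theta>.hom_uminus)
    ultimately have "f' \<in> (\<lambda>k. b k oo fps_X ^ N) ` {..<n}"
      using poly_prod_linear_eq_0_iff[of "{..<n}" "\<lambda>k. b k oo fps_X ^ N" f'] by simp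
    then obtain k where k: "k < n" "f' = b k oo fps_X ^ N" by auto
    thus "\<xi> \<in> ?B ` {..<n}" using Nf(1) f' puiseux_compose_X_pow[OF Nf(2)] by auto
  next
    fix \<xi> assume "\<xi> \<in> ?B ` {..<n}"
    then obtain k where k: "k < n" "\<xi> = ?B k" by auto
    interpret fls: idom_hom "fps_to_fls :: 'a alg_closure fps \<Rightarrow> _"
      by unfold_locales (auto simp: fls_times_fps_to_fls)
    have "poly (map_poly fps_to_fls Fs) (fps_to_fls (b k)) = 0"
      using broot[OF k(1)] by simp
    hence "poly_eval2 (\<lambda>a. fls_const (to_ac a)) (diag_subst n F) (fls_X ^ 1) (fps_to_fls (b k)) = 0"
      by (subst poly_eval2_fls) (simp_all add: Fs_def)
    moreover have "puiseux 1 (fps_to_fls (b k)) r = 0" if "r \<le> 0" for r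
    proof (cases "r \<in> \<int>")
      case True
      then obtain z where z: "r = of_int z" by (auto elim: Ints_cases)
      hence "z \<le> 0" using that by simp
      thus ?thesis using z b0[of k] by (cases "z = 0") (auto simp: puiseux_def)
    qed (simp add: puiseux_def)
    ultimately show "\<xi> \<in> small_branches (diag_subst n F)"
      unfolding small_branches_def k(2) by blast
  qed
  \<comment> \<open>The branches are told apart by their coefficients \<omega> at the first power of
    \<open>t\<close>.\<close>
  moreover have "inj_on ?B {..<n}"
  proof (rule inj_onI)
    fix k l assume kl: "k \<in> {..<n}" "l \<in> {..<n}" "?B k = ?B l"
    have "?B i 1 = \<omega> i" if "i < n" for i using b1[OF that] by (simp add: puiseux_def)
    with kl have "\<omega> k = \<omega> l" by (metis lessThan_iff)
    thus "k = l" using kl \<omega>(1) by (auto simp: inj_on_def)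
  qed
  ultimately show ?thesis by (simp add: card_image)
qed

section \<open>Separability of the generic univariate polynomial\<close>

lemma (in comm_ring_hom) resultant_sub_hom:
  "resultant_sub m n (map_poly hom p) (map_poly hom q) = hom (resultant_sub m n p q)"
  unfolding resultant_sub_def by (simp add: sylvester_mat_sub_map hom_det[symmetric] del: hom_det)

lemma degree_pderiv_bound:
  fixes q :: "'a::idom poly"
  assumes "degree q \<le> n" shows "degree (pderiv q) \<le> n - 1"
  by (rule degree_le) (use assms in \<open>auto simp: coeff_pderiv coeff_eq_0\<close>)

lemma simple_roots_exist:
  fixes p :: "'a::alg_closed_field poly"
  assumes "p \<noteq> 0" and simple: "\<And>x. poly p x = 0 \<Longrightarrow> poly (pderiv p) x \<noteq> 0"
  obtains y where "inj_on y {..<degree p}" "\<And>k. k < degree p \<Longrightarrow> poly p (y k) = 0"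
proof -
  obtain y where y: "p = smult (lead_coeff p) (\<Prod>i<degree p. [:- y i, 1:])"
    using alg_closed_linear_factors[OF assms(1)] .
  have root: "poly p (y k) = 0" if "k < degree p" for k
    using poly_prod_linear_eq_0_iff[of "{..<degree p}" y "y k"] that by (subst y) simp
  have "inj_on y {..<degree p}"
  proof (rule inj_onI, rule ccontr)
    fix a b assume ab: "a \<in> {..<degree p}" "b \<in> {..<degree p}" "y a = y b" "a \<noteq> b"
    define R where "R = (\<Prod>i\<in>{..<degree p} - {a} - {b}. [:- y i, 1:])"
    have "(\<Prod>i<degree p. [:- y i, 1:]) = [:- y a, 1:] * ([:- y a, 1:] * R)"
      using ab by (subst prod.remove[of _ a], simp, simp, subst prod.remove[of _ b]) (simp_all add: R_def)
    hence "p = smult (lead_coeff p) ([:- y a, 1:] * ([:- y a, 1:] * R))" using y by simp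
    hence "poly (pderiv p) (y a) = poly (pderiv (smult (lead_coeff p) ([:- y a, 1:] * ([:- y a, 1:] * R)))) (y a)"
      by simp
    also have "\<dots> = 0"
      unfolding pderiv_smult pderiv_mult by (simp only: poly_smult poly_add poly_mult) (simp add: pderiv_pCons)
    finally show False using simple root ab by auto
  qed
  with root that show ?thesis by blast
qed

text \<open>Specializing to \<open>x^n - 1\<close> shows that the discriminant of the generic polynomial does not vanish.\<close>

lemma generic_poly_separable:
  fixes b :: "nat \<Rightarrow> 'v::linorder"
  assumes n: "n > 0" and b: "inj_on b {..n}"
    and x: "poly (map_poly to_ac (\<Sum>i\<le>n. monom (to_fract (mpoly_var (b i))) (n - i))) x = 0"
  shows "poly (pderiv (map_poly to_ac (\<Sum>i\<le>n. monom (to_fract (mpoly_var (b i))) (n - i)))) x \<noteq> 0"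
proof
  define p where "p = (\<Sum>i\<le>n. monom (mpoly_var (b i)) (n - i))"
  define \<kappa> where "\<kappa> q = to_ac (to_fract q)" for q :: "'v rat_mpoly"
  interpret \<kappa>: inj_idom_hom \<kappa> by unfold_locales (auto simp: \<kappa>_def)
  interpret \<kappa>p: map_poly_inj_idom_hom \<kappa> ..
  interpret ac: field_hom "to_ac :: 'v rat_fun \<Rightarrow> _" by (rule to_ac_hom)
  interpret acp: map_poly_inj_idom_hom "to_ac :: 'v rat_fun \<Rightarrow> _" ..
  have eq: "map_poly to_ac (\<Sum>i\<le>n. monom (to_fract (mpoly_var (b i))) (n - i)) = map_poly \<kappa> p"
    by (simp add: p_def acp.hom_sum \<kappa>p.hom_sum \<kappa>_def)
  have degp: "degree p \<le> n" unfolding p_def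
    by (rule degree_sum_le) (auto intro: order_trans[OF degree_monom_le])
  assume "poly (pderiv (map_poly to_ac (\<Sum>i\<le>n. monom (to_fract (mpoly_var (b i))) (n - i)))) x = 0"
  \<comment> \<open>A common root of \<open>p\<close> and its derivative makes their resultant
    vanish; injectivity of \<kappa> brings this back to the polynomial ring, where indeterminates
    can be specialized.\<close>
  hence "resultant_sub n (n - 1) (map_poly \<kappa> p) (map_poly \<kappa> (pderiv p)) = 0"
    using x n degp degree_pderiv_bound[OF degp] unfolding eq
    by (intro resultant_sub_common_root[of _ _ _ _ x])
      (auto simp: \<kappa>.map_poly_pderiv[symmetric] simp del: \<kappa>.map_poly_pderiv)
  hence res: "resultant_sub n (n - 1) p (pderiv p) = 0" by (simp add: \<kappa>.resultant_sub_hom)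
  define g where "g w = (if w = b 0 then 1 else if w = b n then -1 else 0 :: rat)" for w
  have id: "comm_ring_hom (\<lambda>a :: rat. a)" by unfold_locales auto
  define s where "s = mpoly_eval (\<lambda>a. a) g"
  interpret s: comm_ring_hom s unfolding s_def by (rule mpoly_eval_hom[OF id])
  interpret s: idom_hom s ..
  interpret sp: map_poly_comm_ring_hom s ..
  have bn: "b i = b 0 \<longleftrightarrow> i = 0" "b i = b n \<longleftrightarrow> i = n" if "i \<le> n" for i
    using b that n by (auto simp: inj_on_def)
  have sp: "map_poly s p = monom 1 n - 1"
  proof -
    have "map_poly s p = (\<Sum>i\<le>n. monom (g (b i)) (n - i))"
      unfolding p_def sp.hom_sum s.map_poly_hom_monom by (simp add: s_def mpoly_eval_var[OF id])
    also have "\<dots> = (\<Sum>i\<in>{0, n}. monom (g (b i)) (n - i))"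
      by (rule sum.mono_neutral_right) (use bn in \<open>auto simp: g_def\<close>)
    also have "\<dots> = monom (g (b 0)) n + monom (g (b n)) 0" using n by simp
    also have "g (b 0) = 1" by (simp add: g_def)
    also have "b n \<noteq> b 0" using bn(1)[of n] n by simp
    hence "g (b n) = - 1" by (simp add: g_def)
    also have "monom 1 n + monom (- 1) 0 = (monom 1 n - 1 :: rat poly)"
      by (rule poly_eqI) (simp add: coeff_1)
    finally show ?thesis .
  qed
  \<comment> \<open>With formal degrees the determinant commutes with any ring homomorphism, in
    particular with the noninjective \<open>s\<close>.\<close>
  have "resultant_sub n (n - 1) (map_poly s p) (map_poly s (pderiv p)) = 0"
    by (simp only: s.resultant_sub_hom res s.hom_zero)
  hence "resultant_sub n (n - 1) (monom 1 n - 1) (monom (of_nat n) (n - 1) :: rat poly) = 0"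
    unfolding s.map_poly_pderiv sp by (simp add: pderiv_diff pderiv_monom)
  then obtain f h :: "rat poly" where fh: "f \<noteq> 0 \<or> h \<noteq> 0" "f \<noteq> 0 \<Longrightarrow> degree f < n - 1"
    "f * (monom 1 n - 1) + h * monom (of_nat n) (n - 1) = 0"
    by (rule resultant_sub_eq_0_imp[rotated 2])
       (auto intro!: degree_diff_le degree_monom_le)
  \<comment> \<open>The relation \<open>f (x^n - 1) + n h x^(n - 1) = 0\<close> shows that
    \<open>x^(n - 1)\<close> divides \<open>f\<close>, whose degree is below \<open>n - 1\<close>
    unless \<open>f = 0\<close>.\<close>
  have "f = f * monom 1 n + h * monom (of_nat n) (n - 1)"
    using fh(3) by (simp add: algebra_simps)
  also have "\<dots> = monom 1 (n - 1) * (f * monom 1 1 + smult (of_nat n) h)"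
    using n by (simp add: algebra_simps mult_monom smult_monom flip: mult_smult_right)
  finally have f: "f = monom 1 (n - 1) * (f * monom 1 1 + smult (of_nat n) h)" .
  have "f = 0"
  proof (rule ccontr)
    assume "f \<noteq> 0"
    hence "f * monom 1 1 + smult (of_nat n) h \<noteq> 0" using f by auto
    hence "degree (monom 1 (n - 1) * (f * monom 1 1 + smult (of_nat n) h)) \<ge> n - 1"
      by (subst degree_mult_eq) (auto simp: degree_monom_eq)
    hence "degree f \<ge> n - 1" using f by simp
    with fh(2) \<open>f \<noteq> 0\<close> show False by simp
  qed
  with fh n show False by simp
qed

section \<open>The diagonal of a generic rational function\<close>

text \<open>A multiplier \<open>D\<close> of minimal degree works: a common divisor of
  \<open>[:D:]\<close> and \<Phi> is constant in the outer variable, can be cancelled from both, and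
  is a unit by minimality.\<close>

lemma clear_denominators_coprime:
  fixes p :: "'a::field poly fract poly"
  obtains D \<Phi> where "D \<noteq> 0" "coprime [:D:] \<Phi>" "smult (to_fract D) p = map_poly to_fract \<Phi>"
proof -
  let ?P = "\<lambda>n. \<exists>D \<Phi>. D \<noteq> 0 \<and> smult (to_fract D) p = map_poly to_fract \<Phi> \<and> degree D = n"
  define n where "n = (LEAST n. ?P n)"
  have "\<exists>n. ?P n" using clear_denominators[of p] by metis
  from LeastI_ex[OF this] obtain D \<Phi> where D: "D \<noteq> 0" "smult (to_fract D) p = map_poly to_fract \<Phi>" "degree D = n"
    unfolding n_def by blast
  have min: "n \<le> degree D'" if "D' \<noteq> 0" "smult (to_fract D') p = map_poly to_fract \<Phi>'" for D' \<Phi>'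
    unfolding n_def by (rule Least_le) (use that in blast)
  have "coprime [:D:] \<Phi>"
  proof (rule coprimeI)
    fix c assume "c dvd [:D:]" "c dvd \<Phi>"
    then obtain E \<Psi> where *: "[:D:] = c * E" "\<Phi> = c * \<Psi>" by (auto elim!: dvdE)
    with D(1) have nz: "c \<noteq> 0" "E \<noteq> 0" by auto
    have "degree c + degree E = degree [:D:]" using nz by (simp add: *(1) degree_mult_eq)
    hence "degree c = 0" "degree E = 0" by auto
    then obtain c0 D' where c0: "c = [:c0:]" "E = [:D':]" by (metis degree_eq_zeroE)
    have nz': "c0 \<noteq> 0" "D' \<noteq> 0" using nz c0 by auto
    have DD': "D = c0 * D'" using *(1) c0 by simp
    have "smult (to_fract c0) (smult (to_fract D') p) = map_poly to_fract \<Phi>" using D(2) by (simp add: DD')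
    also have "\<dots> = smult (to_fract c0) (map_poly to_fract \<Psi>)"
      using *(2) c0 by (simp add: to_fract_hom.map_poly_hom_smult)
    finally have "smult (to_fract D') p = map_poly to_fract \<Psi>" using nz' by (simp add: smult_eq_iff)
    from min[OF nz'(2) this] D(3) have "degree D \<le> degree D'" by simp
    hence "degree c0 = 0" using nz' by (simp add: DD' degree_mult_eq)
    hence "is_unit c0" using nz' by (simp add: is_unit_iff_degree)
    thus "is_unit c" by (simp add: c0 is_unit_const_poly_iff)
  qed
  with D that show ?thesis by blast
qed

text \<open>A unit leading coefficient allows division with remainder by \<open>g\<close> before
  passing to fractions. Over the fractions the remainder is divisible by \<open>g\<close> but, if
  nonzero, of smaller degree; so it vanishes.\<close>

lemma dvd_of_fract_dvd:
  fixes f g :: "'a::{idom_divide, algebraic_semidom} poly"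
  assumes dvd: "map_poly to_fract g dvd map_poly to_fract f" and lc: "is_unit (lead_coeff g)"
  shows "g dvd f"
proof -
  interpret tp: map_poly_inj_idom_hom "to_fract :: 'a \<Rightarrow> _" ..
  obtain q r where qr: "pseudo_divmod f g = (q, r)" by fastforce
  have g: "g \<noteq> 0" using lc by auto
  define c where "c = lead_coeff g ^ (Suc (degree f) - degree g)"
  have c: "is_unit c" unfolding c_def by (rule is_unit_power_iff[THEN iffD2]) (use lc in simp)
  have eq: "smult c f = g * q + r" and r: "r = 0 \<or> degree r < degree g"
    using pseudo_divmod[OF g qr] by (auto simp: c_def)
  have "map_poly to_fract r = smult (to_fract c) (map_poly to_fract f) - map_poly to_fract g * map_poly to_fract q"
    using arg_cong[OF eq, of "map_poly to_fract"]
    by (simp add: tp.hom_add tp.hom_mult to_fract_hom.map_poly_hom_smult)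
  hence "map_poly to_fract g dvd map_poly to_fract r" using dvd by (simp add: dvd_smult)
  hence "r = 0"
    using r dvd_imp_degree_le[of "map_poly to_fract g" "map_poly to_fract r"] by (cases "r = 0") simp_all
  hence "smult c f = g * q" using eq by simp
  moreover obtain c' where "1 = c * c'" using c by (auto elim: dvdE)
  hence "f = smult c' (smult c f)" by (simp add: mult.commute)
  ultimately show ?thesis by (metis dvd_smult dvd_triv_left)
qed

lemma poly_eval2_diag:
  fixes F :: "'a::field poly poly"
  defines "c \<equiv> (\<lambda>a :: 'a. to_fract [:[:a:]:])" and "t \<equiv> to_fract [:[:0, 1:]:]" and "y \<equiv> to_fract [:0, 1:]"
  assumes deg: "\<And>j. degree (coeff F j) \<le> n"
  shows "y ^ n * poly_eval2 c F (t / y) y = to_fract (diag_subst n F)"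
proof -
  have y: "y \<noteq> 0" by (simp add: y_def)
  have c0: "c 0 = 0" by (simp add: c_def)
  have inner: "poly (map_poly c q) x = (\<Sum>i\<le>n. c (coeff q i) * x ^ i)" if "degree q \<le> n" for q x
    using poly_altdef_le[of "map_poly c q" n x] that degree_map_poly_le[of c q]
    by (simp add: coeff_map_poly c0)
  have "poly_eval2 c F (t / y) y = (\<Sum>j\<le>degree F. poly (map_poly c (coeff F j)) (t / y) * y ^ j)"
    unfolding poly_eval2_def
    by (subst poly_altdef_le[of _ "degree F"]) (simp_all add: degree_map_poly_le coeff_map_poly)
  also have "\<dots> = (\<Sum>j\<le>degree F. \<Sum>i\<le>n. c (coeff (coeff F j) i) * (t / y) ^ i * y ^ j)"
    by (simp add: inner deg sum_distrib_right)
  finally have "y ^ n * poly_eval2 c F (t / y) y =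
      (\<Sum>j\<le>degree F. \<Sum>i\<le>n. y ^ n * (c (coeff (coeff F j) i) * (t / y) ^ i * y ^ j))"
    by (simp add: sum_distrib_left)
  also have "\<dots> = (\<Sum>j\<le>degree F. \<Sum>i\<le>n. to_fract (monom (monom (coeff (coeff F j) i) i) (n - i + j)))"
  proof (intro sum.cong refl)
    fix i j assume i: "i \<in> {..n}"
    have m: "monom (monom a i) m = [:[:a:]:] * [:[:0, 1:]:] ^ i * [:0, 1:] ^ m" for a :: 'a and m
    proof -
      have "[:[:a:]:] * [:[:0, 1:]:] ^ i = [:monom a i:]" by (simp add: poly_const_pow monom_altdef)
      thus ?thesis by (simp only:) (simp add: monom_altdef)
    qed
    have "y ^ n * (t / y) ^ i * y ^ j = t ^ i * y ^ (n - i + j)"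
    proof -
      have "y ^ n = y ^ (n - i) * y ^ i" using i by (simp flip: power_add)
      thus ?thesis using y by (simp add: power_divide power_add)
    qed
    hence "c a * (y ^ n * (t / y) ^ i * y ^ j) = c a * (t ^ i * y ^ (n - i + j))" for a
      by (simp only:)
    hence "y ^ n * (c a * (t / y) ^ i * y ^ j) = c a * t ^ i * y ^ (n - i + j)" for a
      by (simp only: mult_ac)
    thus "y ^ n * (c (coeff (coeff F j) i) * (t / y) ^ i * y ^ j) =
        to_fract (monom (monom (coeff (coeff F j) i) i) (n - i + j))"
      unfolding m c_def t_def y_def by (simp only: to_fract_mult to_fract_hom.hom_power)
  qed
  also have "\<dots> = to_fract (diag_subst n F)" by (simp add: diag_subst_def)
  finally show ?thesis .
qed

text \<open>Clearing \<open>y^n\<close> in the numerator and \<open>y^(n + 1)\<close> in the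
  denominator absorbs the factor \<open>1/y\<close> of the integrand.\<close>

lemma diagonal_integrand_eq:
  fixes A B :: "'a::field poly poly"
  assumes A: "\<And>j. degree (coeff A j) \<le> n" and B: "\<And>j. degree (coeff B j) \<le> Suc n"
  shows "diagonal_integrand A B = Fract (diag_subst n A) (diag_subst (Suc n) B)"
proof -
  let ?c = "\<lambda>a :: 'a. to_fract [:[:a:]:]" and ?t = "to_fract [:[:0, 1:]:]" and ?y = "to_fract [:0, 1:]"
  have y: "?y \<noteq> (0 :: 'a poly poly fract)" by simp
  have "diagonal_integrand A B = (?y ^ n * poly_eval2 ?c A (?t / ?y) ?y) / (?y ^ Suc n * poly_eval2 ?c B (?t / ?y) ?y)"
    using y by (simp add: diagonal_integrand_def Let_def)
  also have "\<dots> = Fract (diag_subst n A) (diag_subst (Suc n) B)"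
    unfolding poly_eval2_diag[OF A] poly_eval2_diag[OF B] Fract_conv_to_fract ..
  finally show ?thesis .
qed

lemma diag_subst_smult: "diag_subst n (smult [:k:] F) = smult [:k:] (diag_subst n F)"
  by (rule poly_eqI, rule poly_eqI) (simp add: coeff_diag_subst)

lemma degree_coeff_le_degree_x: "degree (coeff F j) \<le> degree_x F"
proof (cases "j \<le> degree F")
  case True
  thus ?thesis unfolding degree_x_def by (intro Max_ge) auto
qed (simp add: coeff_eq_0)

section \<open>Lowest terms and output for the generic denominator\<close>

context generic_box
begin

definition box_B :: "'v rat_fun poly poly" where
  "box_B = box_poly dx dy (\<lambda>i j. indet (v i j))"

definition box_Q :: "'v rat_fun poly poly" where
  "box_Q = diag_subst dx box_B"

lemma indet_eq: "indet w = to_fract (mpoly_var w)"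
  by (simp add: indet_def mpoly_var_def)

lemma indet_nonzero: "indet (w :: 'v) \<noteq> 0" by (simp add: indet_eq)

lemma box_Q_conv: "box_Q = map_poly (map_poly to_fract) generic_Q"
  by (rule poly_eqI, rule poly_eqI)
    (simp add: box_Q_def box_B_def generic_Q_def coeff_diag_subst coeff_box_poly coeff_map_poly indet_eq)

lemma fract_box_Q: "map_poly to_fract box_Q = map_poly mp_fract generic_Q"
  by (rule poly_eqI) (simp add: box_Q_conv coeff_map_poly mp_fract_def)

lemma coeff_box_Q_top: "coeff box_Q d = [:indet (u d):]"
  by (simp add: box_Q_conv coeff_map_poly coeff_generic_Q_top to_fract_hom.map_poly_pCons_hom indet_eq)

lemma degree_box_Q: "degree box_Q = d"
proof (rule antisym)
  show "degree box_Q \<le> d" using degree_map_poly_le[of "map_poly to_fract" generic_Q]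
    by (simp add: box_Q_conv degree_generic_Q)
  show "d \<le> degree box_Q" by (rule le_degree) (simp add: coeff_box_Q_top indet_nonzero)
qed

lemma box_Q_nonzero: "box_Q \<noteq> 0" using degree_box_Q dx by auto

lemma box_Q_splitting:
  obtains \<phi> \<rho> where "\<And>k. k \<noteq> 0 \<Longrightarrow> generic_splitting \<phi> d \<rho> (map_poly to_fract (smult [:k:] box_Q))"
proof -
  obtain \<phi> \<rho> where *: "\<And>c. c \<noteq> 0 \<Longrightarrow> generic_splitting \<phi> d \<rho> (smult c (map_poly mp_fract generic_Q))"
    using generic_splitting_exists by blast
  have "generic_splitting \<phi> d \<rho> (map_poly to_fract (smult [:k:] box_Q))" if "k \<noteq> 0" for k
    unfolding to_fract_hom.map_poly_hom_smult fract_box_Q by (rule *) (use that in simp)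
  with that show ?thesis by blast
qed

lemma irreducible_box_Q: "irreducible (map_poly to_fract box_Q)"
proof -
  obtain \<phi> \<rho> where "\<And>k. k \<noteq> 0 \<Longrightarrow> generic_splitting \<phi> d \<rho> (map_poly to_fract (smult [:k:] box_Q))"
    using box_Q_splitting by blast
  from generic_splitting.irreducible_Q[OF this[of 1]] show ?thesis by (simp flip: one_pCons)
qed

text \<open>Irreducibility over K(t), with K = Q(b), leaves a common divisor of degree
  \<open>0\<close> or \<open>d\<close> in \<open>y\<close>, and the second exceeds
  \<open>degree P\<close>. A divisor in K[t] divides the coefficient of \<open>y^d\<close>, which is
  a single indeterminate and thus a unit.\<close>

lemma coprime_box_Q:
  assumes P: "P \<noteq> 0" "degree P < d" shows "coprime P box_Q"
proof (rule coprimeI)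
  interpret tp: map_poly_inj_idom_hom "to_fract :: 'v rat_fun poly \<Rightarrow> _" ..
  fix c assume c: "c dvd P" "c dvd box_Q"
  then obtain e where e: "box_Q = c * e" by (auto elim: dvdE)
  have nz: "c \<noteq> 0" "e \<noteq> 0" using e box_Q_nonzero by auto
  have deg: "degree c + degree e = d" using nz degree_box_Q by (simp add: e degree_mult_eq)
  have "map_poly to_fract box_Q = map_poly to_fract c * map_poly to_fract e" by (simp add: e tp.hom_mult)
  hence "is_unit (map_poly to_fract c) \<or> is_unit (map_poly to_fract e)"
    by (rule irreducibleD[OF irreducible_box_Q])
  hence "degree c = 0 \<or> degree e = 0" using nz by (auto simp: is_unit_iff_degree)
  moreover have "degree c \<le> degree P" using c(1) P(1) by (rule dvd_imp_degree_le)
  ultimately have "degree c = 0" using deg P(2) by auto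
  then obtain c0 where c0: "c = [:c0:]" by (metis degree_eq_zeroE)
  have "c0 * coeff e d = [:indet (u d):]" using coeff_box_Q_top by (simp add: e c0)
  hence "c0 dvd [:indet (u d):]" by (metis dvd_triv_left)
  moreover have "is_unit [:indet (u d):]" using indet_nonzero by (simp add: is_unit_const_poly_iff)
  ultimately have "is_unit c0" using dvd_unit_imp_unit by blast
  thus "is_unit c" by (simp add: c0 is_unit_const_poly_iff)
qed

text \<open>Over K(t) the prime \<open>box_Q\<close> divides \<open>P0 * Q\<close> but, by degree,
  not \<open>P0\<close>; since its leading coefficient is a unit, it divides \<open>Q\<close>
  already in K[t][y]. The quotient is a common divisor of \<open>P\<close> and \<open>Q\<close>,
  hence a constant.\<close>

lemma coprime_representation:
  assumes P0: "P0 \<noteq> 0" "degree P0 < d" and PQ: "coprime P Q" "Q \<noteq> 0" "Fract P Q = Fract P0 box_Q"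
  obtains k where "k \<noteq> 0" "P = smult [:k:] P0" "Q = smult [:k:] box_Q"
proof -
  interpret tp: map_poly_inj_idom_hom "to_fract :: 'v rat_fun poly \<Rightarrow> _" ..
  have eq: "P * box_Q = P0 * Q" using PQ box_Q_nonzero by (simp add: eq_fract)
  have "prime_elem (map_poly to_fract box_Q)"
    by (rule field_poly_irreducible_imp_prime[OF irreducible_box_Q])
  moreover have "map_poly to_fract P0 * map_poly to_fract Q = map_poly to_fract P * map_poly to_fract box_Q"
    by (metis eq tp.hom_mult)
  hence "map_poly to_fract box_Q dvd map_poly to_fract P0 * map_poly to_fract Q" by simp
  ultimately have "map_poly to_fract box_Q dvd map_poly to_fract P0 \<or> map_poly to_fract box_Q dvd map_poly to_fract Q"
    by (rule prime_elem_dvd_multD)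
  moreover have "\<not> map_poly to_fract box_Q dvd map_poly to_fract P0"
    using dvd_imp_degree_le[of "map_poly to_fract box_Q" "map_poly to_fract P0"] P0 degree_box_Q by auto
  ultimately have "map_poly to_fract box_Q dvd map_poly to_fract Q" by blast
  hence "box_Q dvd Q"
    by (rule dvd_of_fract_dvd) (simp add: degree_box_Q coeff_box_Q_top is_unit_const_poly_iff indet_nonzero)
  then obtain H where H: "Q = box_Q * H" by (rule dvdE)
  have "box_Q * P = box_Q * (P0 * H)" using eq by (simp add: H mult_ac)
  hence P: "P = P0 * H" using box_Q_nonzero by simp
  have "is_unit H" by (rule coprime_common_divisor[OF PQ(1)]) (simp_all add: P H)
  then obtain c where c: "H = [:c:]" "c dvd 1" using is_unit_poly_iff by blast
  then obtain k where "c = [:k:]" "k dvd 1" using is_unit_poly_iff by blast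
  with c have k: "H = [:[:k:]:]" "k \<noteq> 0" by auto
  show ?thesis by (rule that[OF k(2)]) (simp_all add: P H k(1))
qed

lemma card_small_branches_box_Q:
  assumes "k \<noteq> 0"
  shows "card (small_branches (smult [:k:] box_Q)) = dx"
proof -
  interpret ac: field_hom "to_ac :: 'v rat_fun \<Rightarrow> _" by (rule to_ac_hom)
  let ?b = "\<lambda>i. v i 0"
  define \<beta> where "\<beta> = (\<Sum>i\<le>dx. monom (to_fract (mpoly_var (?b i))) (dx - i))"
  have b: "inj_on ?b {..dx}" using v_eq_iff by (auto simp: inj_on_def)
  have "coeff \<beta> dx = to_fract (mpoly_var (?b 0))"
  proof -
    have "coeff \<beta> dx = (\<Sum>i\<le>dx. if i = 0 then to_fract (mpoly_var (?b i)) else 0)"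
      unfolding \<beta>_def coeff_sum by (rule sum.cong) auto
    thus ?thesis by simp
  qed
  hence lc: "coeff \<beta> dx \<noteq> 0" by simp
  moreover have "degree \<beta> \<le> dx" unfolding \<beta>_def
    by (rule degree_sum_le) (auto intro: order_trans[OF degree_monom_le])
  ultimately have deg: "degree \<beta> = dx" using le_degree by (metis antisym)
  have "map_poly to_ac \<beta> \<noteq> 0" using lc by (metis ac.coeff_map_poly_hom coeff_0 to_ac_eq_0_iff)
  then obtain \<omega> where \<omega>: "inj_on \<omega> {..<degree (map_poly to_ac \<beta>)}"
      "\<And>l. l < degree (map_poly to_ac \<beta>) \<Longrightarrow> poly (map_poly to_ac \<beta>) (\<omega> l) = 0"
    using simple_roots_exist[of "map_poly to_ac \<beta>"] generic_poly_separable[OF dx b, folded \<beta>_def] by blast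
  have "(\<Sum>i\<le>dx. monom (coeff (coeff (smult [:k:] box_B) 0) i) (dx - i)) = smult k \<beta>"
    unfolding \<beta>_def smult_sum2 by (rule sum.cong) (auto simp: box_B_def coeff_box_poly smult_monom indet_eq)
  hence "card (small_branches (diag_subst dx (smult [:k:] box_B))) = dx"
    using \<omega> generic_poly_separable[OF dx b, folded \<beta>_def] assms deg
    by (intro card_small_branches[where \<omega> = \<omega>])
      (auto simp: ac.map_poly_hom_smult pderiv_smult box_B_def coeff_box_poly indet_nonzero)
  thus ?thesis by (simp add: diag_subst_smult box_Q_def)
qed

theorem algebraic_diagonal_box:
  assumes P0: "P0 \<noteq> 0" "degree P0 + 2 \<le> d"
    and integrand: "diagonal_integrand A box_B = Fract P0 box_Q"
  shows "\<exists>\<Phi>. algebraic_diagonal A box_B \<Phi>"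
    and "algebraic_diagonal A box_B \<Phi> \<Longrightarrow> irreducible (map_poly to_fract \<Phi>)"
    and "algebraic_diagonal A box_B \<Phi> \<Longrightarrow> degree (map_poly to_fract \<Phi>) = d choose dx"
proof -
  obtain \<phi> \<rho> where gs: "\<And>k. k \<noteq> 0 \<Longrightarrow> generic_splitting \<phi> d \<rho> (map_poly to_fract (smult [:k:] box_Q))"
    using box_Q_splitting by blast
  have d2: "degree P0 < d" using P0(2) by simp
  show "\<exists>\<Phi>. algebraic_diagonal A box_B \<Phi>"
  proof -
    have "generic_splitting \<phi> d \<rho> (map_poly to_fract box_Q)" using gs[of 1] by (simp flip: one_pCons)
    from generic_splitting.composed_residue_sum_exists[OF this, of "map_poly to_fract P0"
        "card (small_branches box_Q)"] P0
    obtain R S where RS: "algebraic_residues (map_poly to_fract P0) (map_poly to_fract box_Q) R"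
      "pure_composed_sum (card (small_branches box_Q)) R S" by auto
    obtain D \<Phi> where "D \<noteq> 0" "coprime [:D:] \<Phi>" "smult (to_fract D) S = map_poly to_fract \<Phi>"
      by (rule clear_denominators_coprime)
    moreover have "coeff (coeff box_B 0) 0 \<noteq> 0" by (simp add: box_B_def coeff_box_poly indet_nonzero)
    ultimately have "algebraic_diagonal A box_B \<Phi>"
      unfolding algebraic_diagonal_def integrand
      using RS coprime_box_Q[OF P0(1) d2] box_Q_nonzero by blast
    thus ?thesis by blast
  qed
  assume "algebraic_diagonal A box_B \<Phi>"
  then obtain P Q R S D where PQ: "Q \<noteq> 0" "coprime P Q" "Fract P Q = Fract P0 box_Q"
    and R: "algebraic_residues (map_poly to_fract P) (map_poly to_fract Q) R"
    and S: "pure_composed_sum (card (small_branches Q)) R S"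
    and D: "D \<noteq> 0" "smult (to_fract D) S = map_poly to_fract \<Phi>"
    unfolding algebraic_diagonal_def integrand by blast
  obtain k where k: "k \<noteq> 0" "P = smult [:k:] P0" "Q = smult [:k:] box_Q"
    using coprime_representation[OF P0(1) d2 PQ(2,1,3)] by blast
  have "card (small_branches Q) = dx" unfolding k(3) by (rule card_small_branches_box_Q[OF k(1)])
  hence S': "pure_composed_sum dx R S" using S by simp
  have P: "map_poly to_fract P \<noteq> 0" "degree (map_poly to_fract P) + 2 \<le> d"
    using k P0 by simp_all
  have "irreducible S" "degree S = d choose dx"
    using generic_splitting.composed_residue_sum_irreducible[OF gs[OF k(1)] P R[unfolded k(3)] S'] by simp_all
  \<comment> \<open>\<open>D\<close> is a unit over K(t), so \<Phi> and \<open>S\<close> differ by a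
    unit factor only.\<close>
  moreover have "map_poly to_fract \<Phi> = [:to_fract D:] * S" using D(2) by simp
  moreover have "is_unit [:to_fract D:]" using D(1) by (simp add: is_unit_const_poly_iff)
  ultimately show "irreducible (map_poly to_fract \<Phi>)" "degree (map_poly to_fract \<Phi>) = d choose dx"
    using D(1) by (simp_all only: irreducible_mult_unit_left) (simp add: degree_smult_eq)
qed

end

theorem proposition16:
  fixes d\<^sub>x d\<^sub>y :: nat
    and A :: "rat poly poly"
    and v :: "nat \<Rightarrow> nat \<Rightarrow> 'v::linorder"
    and A' B :: "'v rat_fun poly poly"
  assumes "d\<^sub>x > 0" and "d\<^sub>y > 0"
    and "A \<noteq> 0" and "degree_x A < d\<^sub>x" and "degree A < d\<^sub>y"
    \<comment> \<open>the indeterminates are indexed by exactly the pairs (i, j)\<close>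
    and "bij_betw (\<lambda>(i, j). v i j) ({..d\<^sub>x} \<times> {..d\<^sub>y}) (UNIV :: 'v set)"
  defines "A' \<equiv> map_poly (map_poly of_rat) A"
    and "B \<equiv> box_poly d\<^sub>x d\<^sub>y (\<lambda>i j. indet (v i j))"
  shows "(\<exists>\<Phi>. algebraic_diagonal A' B \<Phi>) \<and>
    (\<forall>\<Phi>. algebraic_diagonal A' B \<Phi> \<longrightarrow>
       irreducible (map_poly to_fract \<Phi> :: 'v rat_fun poly fract poly) \<and>
       degree (map_poly to_fract \<Phi> :: 'v rat_fun poly fract poly) = (d\<^sub>x + d\<^sub>y) choose d\<^sub>x)"
proof -
  interpret generic_box d\<^sub>x d\<^sub>y v
    using assms(1,2,6) by unfold_locales (auto simp: bij_betw_def)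
  have B: "B = box_B" by (simp add: B_def box_B_def)
  obtain n where n: "d\<^sub>x = Suc n" using assms(1) by (cases d\<^sub>x) auto
  have cA': "coeff (coeff A' j) i = of_rat (coeff (coeff A j) i)" for i j
    by (simp add: A'_def coeff_map_poly)
  have degA: "degree (coeff A j) \<le> n" for j
    using degree_coeff_le_degree_x[of A j] assms(4) n by simp
  have degA': "degree (coeff A' j) \<le> n" for j
    by (rule degree_le) (use degA[of j] in \<open>auto simp: cA' coeff_eq_0\<close>)
  have degB: "degree (coeff box_B j) \<le> Suc n" for j
  proof (rule degree_le, intro allI impI)
    fix i assume "Suc n < i"
    hence "d\<^sub>x < i" by (simp only: n)
    thus "coeff (coeff box_B j) i = 0" by (simp add: box_B_def coeff_box_poly)
  qed
  define P0 where "P0 = diag_subst n A'"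
  \<comment> \<open>Distinct monomials \<open>x^i y^j\<close> have distinct images
    \<open>t^i y^(n - i + j)\<close>, so nothing cancels.\<close>
  have "P0 \<noteq> 0"
  proof -
    obtain j i where ij: "coeff (coeff A j) i \<noteq> 0" using assms(3) by (metis leading_coeff_0_iff)
    hence "i \<le> n" using degA[of j] le_degree[OF ij] by simp
    hence "coeff (coeff P0 (n - i + j)) i = of_rat (coeff (coeff A j) i)"
      by (simp add: P0_def coeff_diag_subst cA')
    with ij show ?thesis by auto
  qed
  \<comment> \<open>The degree in \<open>y\<close> is at most
    \<open>(d\<^sub>x - 1) + (d\<^sub>y - 1)\<close>; this is the source of the bound
    \<open>d - 2\<close> on the numerator.\<close>
  moreover have "degree P0 + 2 \<le> d\<^sub>x + d\<^sub>y"
  proof -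
    have "degree A' \<le> degree A" unfolding A'_def by (rule degree_map_poly_le)
    with degree_diag_subst_le[of n A'] assms(5) n show ?thesis by (simp add: P0_def)
  qed
  moreover have "diagonal_integrand A' box_B = Fract P0 box_Q"
    using diagonal_integrand_eq[OF degA' degB] by (simp only: P0_def box_Q_def n[symmetric])
  ultimately show ?thesis unfolding B using algebraic_diagonal_box by blast
qed

end
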